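(* Let $\mathcal R$ be a polynomially bounded o-minimal structure expanding the real field $\mathbb R$. Let $\Omega\subset\mathbb R_+\times\mathbb R^2$ be an open set with $(0,0,0)\in\overline\Omega$, and let $F=(f_1,f_2):\Omega\to\mathbb R^2$ be a $C^1$ map definable in $\mathcal R$. Consider the differential system $$(S_F)\qquad y_1'=f_1(x,y_1,y_2),\quad y_2'=f_2(x,y_1,y_2).$$ Let $\gamma$ be a solution at $0$ of $(S_F)$ which has the regular separation property (with respect to $\mathcal R$), and let $\delta$ be another solution at $0$ of $(S_F)$ which has flat contact with $\gamma$. Then either $\mathcal F(x,\gamma,\delta)$ is a Hardy field, or else $\gamma$ and $\delta$ are interlaced.
   Context: Definable means definable with parameters in $\mathcal R$. A function "$f:\mathbb R^n\to\mathbb R$" may be partially defined, with a definable domain. All properties concern germs at $0^+$. A solution at $0$ of $(S_F)$ is a $C^1$ map $\gamma:(0,a)\to\mathbb R^2$, $a>0$, whose graph is contained in $\Omega$ and which satisfies $(S_F)$. Given two different solutions (different as germs at $0^+$) $\gamma,\delta$, put $\varepsilon:=\delta-\gamma$ on a common interval of definition; by uniqueness of solutions $\varepsilon$ does not vanish. Regular separation property: $\gamma$ has it if for every definable $f:\mathbb R^3\to\mathbb R$ whose domain contains the graph of $\gamma$ (for small $x$), there is $a>0$ such that either $f(x,\gamma(x))=0$ for all $x\in(0,a)$, or there is $k\in\mathbb N$ with $|f(x,\gamma(x))|\ge x^k$ for all $x\in(0,a)$. Flat contact: $\gamma,\delta$ (different) have flat contact if for every $k\in\mathbb N$ there is $a>0$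 such that $\|\varepsilon(x)\|\le x^k$ for all $x\in(0,a)$. Interlaced: $\gamma,\delta$ (different) are interlaced if any continuous measure $\theta:(0,a)\to\mathbb R$ of the angle between $(1,0)$ and $\varepsilon(x)/\|\varepsilon(x)\|$ satisfies $\lim_{x\to0}\theta(x)=+\infty$ or $\lim_{x\to 0}\theta(x)=-\infty$. $\mathcal F(x,\gamma,\delta)$ is the ring of germs at $0^+$ of the functions $x\mapsto f(x,\gamma(x),\delta(x))$, where $f$ ranges over all definable functions from $\mathbb R^5$ to $\mathbb R$ whose domain contains the graph of $x\mapsto(\gamma(x),\delta(x))$ (for small $x$). A Hardy field is a subring of the ring of germs at $0^+$ of functions $h:\mathbb R\to\mathbb R$ which is a field and is closed under the natural derivation. *)

theory Defs
  imports "HOL-Analysis.Analysis"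
begin

section \<open>O-minimal structures expanding the real field\<close>

text \<open>
  A structure is given by its definable sets: \<open>D n\<close> is the collection of the subsets of the
  \<open>n\<close>-dimensional real space (lists of length \<open>n\<close>) that are definable with parameters.
  Every real number being allowed as a parameter is the assumption \<open>parameter\<close>.
\<close>

locale real_field_structure =
  fixes D :: "nat \<Rightarrow> real list set set"
  assumes carrier: "A \<in> D n \<Longrightarrow> A \<subseteq> {xs. length xs = n}"
    and empty: "{} \<in> D n"
    and compl: "A \<in> D n \<Longrightarrow> {xs. length xs = n} - A \<in> D n"
    and union: "A \<in> D n \<Longrightarrow> B \<in> D n \<Longrightarrow> A \<union> B \<in> D n"
    and cylinder_left: "A \<in> D n \<Longrightarrow> {x # xs |x xs. xs \<in> A} \<in> D (Suc n)"
    and cylinder_right: "A \<in> D n \<Longrightarrow> {xs @ [x] |x xs. xs \<in> A} \<in> D (Suc n)"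
    and diagonal: "i < j \<Longrightarrow> j < n \<Longrightarrow> {xs. length xs = n \<and> xs ! i = xs ! j} \<in> D n"
    and projection: "A \<in> D (Suc n) \<Longrightarrow> butlast ` A \<in> D n"
    and parameter: "{[r]} \<in> D 1"
    and less: "{[x, y] |x y. x < y} \<in> D 2"
    and plus: "{[x, y, x + y] |x y. True} \<in> D 3"
    and times: "{[x, y, x * y] |x y. True} \<in> D 3"

locale ominimal_structure = real_field_structure +
  assumes ominimal: "A \<in> D 1 \<Longrightarrow>
    \<exists>I. finite I \<and> (\<forall>J\<in>I. is_interval J) \<and> {x. [x] \<in> A} = \<Union>I"

text \<open>A partial function \<open>f\<close> in \<open>n\<close> real variables with domain \<open>A\<close>; the values of \<open>f\<close> outside
  \<open>A\<close> are irrelevant. Definability of the graph entails definability of \<open>A\<close>.\<close>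

definition definable_fun ::
  "(nat \<Rightarrow> real list set set) \<Rightarrow> nat \<Rightarrow> real list set \<Rightarrow> (real list \<Rightarrow> real) \<Rightarrow> bool" where
  "definable_fun D n A f \<longleftrightarrow>
     A \<subseteq> {xs. length xs = n} \<and> {xs @ [f xs] |xs. xs \<in> A} \<in> D (Suc n)"

locale poly_bounded_ominimal_structure = ominimal_structure +
  assumes poly_bounded: "definable_fun D 1 A f \<Longrightarrow> eventually (\<lambda>t. [t] \<in> A) at_top \<Longrightarrow>
    \<exists>N::nat. eventually (\<lambda>t. \<bar>f [t]\<bar> \<le> t ^ N) at_top"


section \<open>Definable differential systems and their solutions at 0\<close>

definition definable_map ::
  "(nat \<Rightarrow> real list set set) \<Rightarrow> (real \<times> real \<times> real) set \<Rightarrow>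
    (real \<times> real \<times> real \<Rightarrow> real \<times> real) \<Rightarrow> bool" where
  "definable_map D \<Omega> F \<longleftrightarrow>
     {[x, y\<^sub>1, y\<^sub>2, fst (F (x, y\<^sub>1, y\<^sub>2)), snd (F (x, y\<^sub>1, y\<^sub>2))] |x y\<^sub>1 y\<^sub>2. (x, y\<^sub>1, y\<^sub>2) \<in> \<Omega>} \<in> D 5"

definition C1_on :: "'a::real_normed_vector set \<Rightarrow> ('a \<Rightarrow> 'b::real_normed_vector) \<Rightarrow> bool" where
  "C1_on U f \<longleftrightarrow> (\<exists>f' :: 'a \<Rightarrow> 'a \<Rightarrow>\<^sub>L 'b.
     (\<forall>p\<in>U. (f has_derivative blinfun_apply (f' p)) (at p)) \<and> continuous_on U f')"

text \<open>Curves are total functions on the reals of which only the values on some interval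
  \<open>(0, a)\<close> matter.\<close>

definition solution_at_0 ::
  "(real \<times> real \<times> real) set \<Rightarrow> (real \<times> real \<times> real \<Rightarrow> real \<times> real) \<Rightarrow>
    (real \<Rightarrow> real \<times> real) \<Rightarrow> bool" where
  "solution_at_0 \<Omega> F \<gamma> \<longleftrightarrow> (\<exists>a>0. \<gamma> C1_differentiable_on {0<..<a} \<and>
     (\<forall>x\<in>{0<..<a}. (x, \<gamma> x) \<in> \<Omega> \<and> (\<gamma> has_vector_derivative F (x, \<gamma> x)) (at x)))"

definition regular_separation ::
  "(nat \<Rightarrow> real list set set) \<Rightarrow> (real \<Rightarrow> real \<times> real) \<Rightarrow> bool" where
  "regular_separation D \<gamma> \<longleftrightarrow>
     (\<forall>A f. definable_fun D 3 A f \<longrightarrow>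
        (\<forall>\<^sub>F x in at_right 0. [x, fst (\<gamma> x), snd (\<gamma> x)] \<in> A) \<longrightarrow>
        (\<forall>\<^sub>F x in at_right 0. f [x, fst (\<gamma> x), snd (\<gamma> x)] = 0) \<or>
        (\<exists>k::nat. \<forall>\<^sub>F x in at_right 0. \<bar>f [x, fst (\<gamma> x), snd (\<gamma> x)]\<bar> \<ge> x ^ k))"

definition different_germs :: "(real \<Rightarrow> 'a) \<Rightarrow> (real \<Rightarrow> 'a) \<Rightarrow> bool" where
  "different_germs \<gamma> \<delta> \<longleftrightarrow> \<not> (\<forall>\<^sub>F x in at_right 0. \<gamma> x = \<delta> x)"

definition flat_contact :: "(real \<Rightarrow> real \<times> real) \<Rightarrow> (real \<Rightarrow> real \<times> real) \<Rightarrow> bool" where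
  "flat_contact \<gamma> \<delta> \<longleftrightarrow> different_germs \<gamma> \<delta> \<and>
     (\<forall>k::nat. \<forall>\<^sub>F x in at_right 0. norm (\<delta> x - \<gamma> x) \<le> x ^ k)"

definition angle_measure :: "real \<Rightarrow> (real \<Rightarrow> real \<times> real) \<Rightarrow> (real \<Rightarrow> real) \<Rightarrow> bool" where
  "angle_measure a \<epsilon> \<theta> \<longleftrightarrow> continuous_on {0<..<a} \<theta> \<and>
     (\<forall>x\<in>{0<..<a}. \<epsilon> x \<noteq> 0 \<and> \<epsilon> x /\<^sub>R norm (\<epsilon> x) = (cos (\<theta> x), sin (\<theta> x)))"

text \<open>For distinct solutions, the difference does not vanish near 0 by uniqueness. Requiring this
  here keeps the quantification over angle measures from being vacuous for arbitrary curves.\<close>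

definition interlaced :: "(real \<Rightarrow> real \<times> real) \<Rightarrow> (real \<Rightarrow> real \<times> real) \<Rightarrow> bool" where
  "interlaced \<gamma> \<delta> \<longleftrightarrow> (\<forall>\<^sub>F x in at_right 0. \<delta> x \<noteq> \<gamma> x) \<and>
     (\<forall>a>0. \<forall>\<theta>. angle_measure a (\<lambda>x. \<delta> x - \<gamma> x) \<theta> \<longrightarrow>
        filterlim \<theta> at_top (at_right 0) \<or> filterlim \<theta> at_bot (at_right 0))"


section \<open>Germs at \<open>0\<^sup>+\<close> and Hardy fields\<close>

definition germ_rel :: "(real \<Rightarrow> real) \<Rightarrow> (real \<Rightarrow> real) \<Rightarrow> bool" where
  "germ_rel g h \<longleftrightarrow> (\<forall>\<^sub>F x in at_right 0. g x = h x)"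

quotient_type germ = "real \<Rightarrow> real" / germ_rel
  morphisms rep_germ germ_of
proof (rule equivpI)
  show "reflp germ_rel" by (simp add: reflp_def germ_rel_def)
  show "symp germ_rel" by (simp add: symp_def germ_rel_def eq_commute)
  show "transp germ_rel"
    unfolding transp_def germ_rel_def by (auto elim: eventually_elim2)
qed

instantiation germ :: comm_ring_1
begin

lift_definition zero_germ :: germ is "\<lambda>_. 0" .

lift_definition one_germ :: germ is "\<lambda>_. 1" .

lift_definition plus_germ :: "germ \<Rightarrow> germ \<Rightarrow> germ" is "\<lambda>g h x. g x + h x"
  unfolding germ_rel_def by (auto elim: eventually_elim2)

lift_definition minus_germ :: "germ \<Rightarrow> germ \<Rightarrow> germ" is "\<lambda>g h x. g x - h x"
  unfolding germ_rel_def by (auto elim: eventually_elim2)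

lift_definition uminus_germ :: "germ \<Rightarrow> germ" is "\<lambda>g x. - g x"
  unfolding germ_rel_def by (auto elim: eventually_mono)

lift_definition times_germ :: "germ \<Rightarrow> germ \<Rightarrow> germ" is "\<lambda>g h x. g x * h x"
  unfolding germ_rel_def by (auto elim: eventually_elim2)

instance
  by standard (transfer; simp add: germ_rel_def algebra_simps)+

end

text \<open>The derivation on germs is partial: it is defined on the germs having a representative that
  is differentiable on some interval \<open>(0, a)\<close>.\<close>

definition germ_has_derivative :: "germ \<Rightarrow> germ \<Rightarrow> bool" where
  "germ_has_derivative g g' \<longleftrightarrow> (\<exists>h h'. g = germ_of h \<and> g' = germ_of h' \<and>
     (\<forall>\<^sub>F x in at_right 0. (h has_real_derivative h' x) (at x)))"

definition is_subring :: "'a::comm_ring_1 set \<Rightarrow> bool" where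
  "is_subring H \<longleftrightarrow> 1 \<in> H \<and> (\<forall>g\<in>H. \<forall>h\<in>H. g - h \<in> H \<and> g * h \<in> H)"

definition hardy_field :: "germ set \<Rightarrow> bool" where
  "hardy_field H \<longleftrightarrow> is_subring H \<and>
     (\<forall>g\<in>H. g \<noteq> 0 \<longrightarrow> (\<exists>h\<in>H. g * h = 1)) \<and>
     (\<forall>g\<in>H. \<exists>g'\<in>H. germ_has_derivative g g')"

definition germ_ring ::
  "(nat \<Rightarrow> real list set set) \<Rightarrow> (real \<Rightarrow> real \<times> real) \<Rightarrow> (real \<Rightarrow> real \<times> real) \<Rightarrow> germ set" where
  "germ_ring D \<gamma> \<delta> =
     {germ_of (\<lambda>x. f [x, fst (\<gamma> x), snd (\<gamma> x), fst (\<delta> x), snd (\<delta> x)]) |f A.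
        definable_fun D 5 A f \<and>
        (\<forall>\<^sub>F x in at_right 0. [x, fst (\<gamma> x), snd (\<gamma> x), fst (\<delta> x), snd (\<delta> x)] \<in> A)}"

end

theory Submission
  imports Defs
begin

text \<open>
  Write \<open>\<epsilon> = \<delta> - \<gamma>\<close>. Regular separation says that membership of \<open>(x, \<gamma> x)\<close> in a definable set is
  eventually constant, and that the germ at \<open>0\<close> of a definable subset of the line depending on
  \<open>(x, \<gamma> x)\<close> is decided on an interval of length \<open>x ^ k\<close>, which contains the flat function \<open>\<bar>\<epsilon>\<^sub>1\<bar>\<close>.
  On each half of the axis \<open>\<epsilon>\<^sub>1 = 0\<close> the sign of \<open>\<epsilon>\<^sub>1'\<close> is therefore eventually constant. If \<open>\<epsilon>\<^sub>1\<close> changes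
  sign infinitely often, the two halves are crossed in opposite directions, so \<open>\<epsilon>\<close> always turns the same
  way around \<open>0\<close> and the curves are interlaced. Otherwise the germ of \<open>(x, \<gamma>, \<delta>\<^sub>1)\<close> decides every
  definable set. A definable function \<open>g(x, \<gamma>, \<delta>\<^sub>1)\<close> is then differentiable, and at the zeros of
  \<open>\<delta>\<^sub>2 - g\<close> the derivative of this difference is a definable function of \<open>(x, \<gamma>, \<delta>\<^sub>1)\<close>. Hence \<open>\<delta>\<^sub>2 - g\<close>
  has constant sign or vanishes identically, so \<open>(x, \<gamma>, \<delta>)\<close> decides every definable set as well, and
  this makes the germs a Hardy field.

  No cell decomposition is needed. A definable set is either \<open>small\<close> or contains a cube, where
  smallness is a countably additive notion, and countable additivity gives generic smoothness of
  definable functions. A curve whose coordinates are definably independent avoids every small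
  definable set, hence definable functions are smooth along it, and finite definable fibres over
  it have a constant number of points by connectedness of \<open>(0, a)\<close>.
\<close>


section \<open>Definable predicates and terms\<close>

abbreviation eventually_at_0 :: "(real \<Rightarrow> bool) \<Rightarrow> bool" (binder "\<forall>\<^sub>0" 10) where
  "eventually_at_0 P \<equiv> eventually P (at_right 0)"

context real_field_structure
begin

lemma definable_UNIV: "{xs. length xs = n} \<in> D n"
  using compl[OF empty[of n]] by simp

lemma definable_Int:
  assumes "A \<in> D n" "B \<in> D n"
  shows "A \<inter> B \<in> D n"
proof -
  have "A \<inter> B = {xs. length xs = n} - (({xs. length xs = n} - A) \<union> ({xs. length xs = n} - B))"
    using carrier assms by blast
  then show ?thesis
    using assms by (simp add: compl union)
qed

lemma definable_finite_INT:
  assumes "finite I" "\<And>i. i \<in> I \<Longrightarrow> A i \<in> D n"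
  shows "{xs. length xs = n \<and> (\<forall>i\<in>I. xs \<in> A i)} \<in> D n"
  using assms
proof (induction I)
  case empty
  then show ?case by (simp add: definable_UNIV)
next
  case (insert j I)
  have "{xs. length xs = n \<and> (\<forall>i\<in>insert j I. xs \<in> A i)}
      = {xs. length xs = n \<and> (\<forall>i\<in>I. xs \<in> A i)} \<inter> A j"
    by auto
  then show ?case
    using insert by (simp add: definable_Int)
qed

lemma definable_prepend:
  assumes "A \<in> D n"
  shows "{ys @ xs |ys xs. length ys = m \<and> xs \<in> A} \<in> D (m + n)"
proof (induction m)
  case 0
  then show ?case using assms by simp
next
  case (Suc m)
  have "{ys @ xs |ys xs. length ys = Suc m \<and> xs \<in> A}
     = {y # xs |y xs. xs \<in> {ys @ xs |ys xs. length ys = m \<and> xs \<in> A}}"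
    (is "?L = ?R")
  proof (intro equalityI subsetI)
    fix zs assume "zs \<in> ?L"
    then obtain y ys xs where "zs = y # (ys @ xs)" "length ys = m" "xs \<in> A"
      by (auto simp: length_Suc_conv)
    then show "zs \<in> ?R" by blast
  next
    fix zs assume "zs \<in> ?R"
    then obtain y ys xs where "zs = (y # ys) @ xs" "length ys = m" "xs \<in> A"
      by auto
    then show "zs \<in> ?L" by (metis (mono_tags, lifting) length_Cons mem_Collect_eq)
  qed
  then show ?case using cylinder_left[OF Suc] by simp
qed

lemma definable_projections:
  assumes "A \<in> D (n + m)"
  shows "{xs. length xs = n \<and> (\<exists>ys. length ys = m \<and> xs @ ys \<in> A)} \<in> D n"
  using assms
proof (induction m arbitrary: A)
  case 0
  then show ?case using carrier[OF 0] by (auto intro: back_subst[of "\<lambda>A. A \<in> D n"])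
next
  case (Suc m)
  have car: "A \<subseteq> {xs. length xs = Suc (n + m)}"
    using carrier[OF Suc.prems] by simp
  have "butlast ` A \<in> D (n + m)"
    using Suc.prems projection by simp
  note * = Suc.IH[OF this]
  have "(\<exists>ys. length ys = Suc m \<and> xs @ ys \<in> A) \<longleftrightarrow> (\<exists>ys. length ys = m \<and> xs @ ys \<in> butlast ` A)"
    if "length xs = n" for xs
  proof
    assume "\<exists>ys. length ys = Suc m \<and> xs @ ys \<in> A"
    then obtain ys where ys: "length ys = Suc m" "xs @ ys \<in> A" by blast
    then have "butlast (xs @ ys) = xs @ butlast ys"
      by (metis butlast_append length_0_conv nat.distinct(1))
    then show "\<exists>ys. length ys = m \<and> xs @ ys \<in> butlast ` A"
      using ys by (metis diff_Suc_1 image_eqI length_butlast)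
  next
    assume "\<exists>ys. length ys = m \<and> xs @ ys \<in> butlast ` A"
    then obtain ys a where ys: "length ys = m" "a \<in> A" "xs @ ys = butlast a" by blast
    then have "a \<noteq> []" using car by auto
    then have "a = xs @ ys @ [last a]"
      using ys by (metis append_butlast_last_id append_assoc)
    then show "\<exists>ys. length ys = Suc m \<and> xs @ ys \<in> A"
      using ys by (metis length_append_singleton)
  qed
  then have "{xs. length xs = n \<and> (\<exists>ys. length ys = Suc m \<and> xs @ ys \<in> A)}
    = {xs. length xs = n \<and> (\<exists>ys. length ys = m \<and> xs @ ys \<in> butlast ` A)}"
    by blast
  then show ?case using * by simp
qed

lemma definable_reindex:
  assumes A: "A \<in> D n" and \<sigma>: "\<And>i. i < n \<Longrightarrow> \<sigma> i < m"
  shows "{xs. length xs = m \<and> map (\<lambda>i. xs ! \<sigma> i) [0..<n] \<in> A} \<in> D m"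
proof -
  define B where "B = {ys @ xs |ys xs. length ys = m \<and> xs \<in> A}"
  define C where "C = B \<inter> {xs. length xs = m + n \<and>
    (\<forall>i\<in>{..<n}. xs \<in> {xs. length xs = m + n \<and> xs ! \<sigma> i = xs ! (m + i)})}"
  have "C \<in> D (m + n)"
    unfolding C_def B_def using \<sigma>
    by (intro definable_Int definable_prepend A definable_finite_INT diagonal)
      (auto intro: trans_less_add1)
  note * = definable_projections[OF this]
  have "(map (\<lambda>i. xs ! \<sigma> i) [0..<n] \<in> A) = (\<exists>ys. length ys = n \<and> xs @ ys \<in> C)"
    if xs: "length xs = m" for xs
  proof
    assume *: "map (\<lambda>i. xs ! \<sigma> i) [0..<n] \<in> A"
    have "xs @ map (\<lambda>i. xs ! \<sigma> i) [0..<n] \<in> C"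
      unfolding C_def B_def using * xs \<sigma> by (auto simp: nth_append)
    then show "\<exists>ys. length ys = n \<and> xs @ ys \<in> C"
      by (metis length_map map_nth length_upt diff_zero)
  next
    assume "\<exists>ys. length ys = n \<and> xs @ ys \<in> C"
    then obtain ys where ys: "length ys = n" "xs @ ys \<in> C" by blast
    then have "ys \<in> A" using xs by (auto simp: C_def B_def)
    moreover have "ys = map (\<lambda>i. xs ! \<sigma> i) [0..<n]"
      using ys xs \<sigma> by (intro nth_equalityI) (auto simp: C_def nth_append)
    ultimately show "map (\<lambda>i. xs ! \<sigma> i) [0..<n] \<in> A" by simp
  qed
  then have "{xs. length xs = m \<and> map (\<lambda>i. xs ! \<sigma> i) [0..<n] \<in> A}
     = {xs. length xs = m \<and> (\<exists>ys. length ys = n \<and> xs @ ys \<in> C)}"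
    by blast
  then show ?thesis using * by simp
qed

text \<open>Predicates and real functions of an environment \<open>e :: nat \<Rightarrow> real\<close> that depend on finitely
  many of the variables. Under a quantifier the bound variable becomes \<open>e 0\<close> and the other variables
  are shifted by one, as with de Bruijn indices.\<close>

definition definable_pred :: "((nat \<Rightarrow> real) \<Rightarrow> bool) \<Rightarrow> bool" where
  "definable_pred P \<longleftrightarrow> (\<exists>n. \<exists>A\<in>D n. \<forall>e. P e \<longleftrightarrow> map e [0..<n] \<in> A)"

definition definable_term :: "((nat \<Rightarrow> real) \<Rightarrow> real) \<Rightarrow> bool" where
  "definable_term u \<longleftrightarrow> definable_pred (\<lambda>e. e 0 = u (\<lambda>i. e (Suc i)))"

definition definable_vec :: "nat \<Rightarrow> ((nat \<Rightarrow> real) \<Rightarrow> real list) \<Rightarrow> bool" where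
  "definable_vec n v \<longleftrightarrow> (\<forall>e. length (v e) = n) \<and> (\<forall>i<n. definable_term (\<lambda>e. v e ! i))"

lemma definable_predI: "A \<in> D n \<Longrightarrow> (\<And>e. P e \<longleftrightarrow> map e [0..<n] \<in> A) \<Longrightarrow> definable_pred P"
  unfolding definable_pred_def by blast

lemma definable_pred_atom:
  assumes A: "A \<in> D n"
  shows "definable_pred (\<lambda>e. map (\<lambda>i. e (\<sigma> i)) [0..<n] \<in> A)"
proof -
  obtain m where m: "\<And>i. i < n \<Longrightarrow> \<sigma> i < m"
  proof
    show "\<sigma> i < Suc (Max (\<sigma> ` {..<n}))" if "i < n" for i
      using that by (auto simp: less_Suc_eq_le intro!: Max_ge)
  qed
  have "map (\<lambda>i. e (\<sigma> i)) [0..<n] \<in> A \<longleftrightarrow>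
      map e [0..<m] \<in> {xs. length xs = m \<and> map (\<lambda>i. xs ! \<sigma> i) [0..<n] \<in> A}" for e
  proof -
    have "map (\<lambda>i. map e [0..<m] ! \<sigma> i) [0..<n] = map (\<lambda>i. e (\<sigma> i)) [0..<n]"
      using m by simp
    then show ?thesis by (simp only: mem_Collect_eq length_map length_upt) simp
  qed
  then show ?thesis
    by - (rule definable_predI[OF definable_reindex[of A n \<sigma> m, OF A m]])
qed

lemma definable_pred_reindex:
  assumes "definable_pred P"
  shows "definable_pred (\<lambda>e. P (\<lambda>i. e (\<sigma> i)))"
proof -
  obtain n A where A: "A \<in> D n" "\<And>e. P e \<longleftrightarrow> map e [0..<n] \<in> A"
    using assms by (auto simp: definable_pred_def)
  then show ?thesis using definable_pred_atom[OF A(1)] by simp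
qed

lemma definable_pred_large_arity:
  assumes "definable_pred P"
  obtains n0 where "\<And>n. n \<ge> n0 \<Longrightarrow> \<exists>A\<in>D n. \<forall>e. P e \<longleftrightarrow> map e [0..<n] \<in> A"
proof -
  obtain n0 A where A: "A \<in> D n0" "\<And>e. P e \<longleftrightarrow> map e [0..<n0] \<in> A"
    using assms by (auto simp: definable_pred_def)
  show thesis
  proof
    fix n assume n: "n \<ge> n0"
    define B where "B = {xs. length xs = n \<and> map (\<lambda>i. xs ! i) [0..<n0] \<in> A}"
    have "B \<in> D n" unfolding B_def
      by (rule definable_reindex[OF A(1)]) (use n in auto)
    moreover have "map e [0..<n] \<in> B \<longleftrightarrow> map e [0..<n0] \<in> A" for e
    proof -
      have "map (\<lambda>i. map e [0..<n] ! i) [0..<n0] = map e [0..<n0]"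
        using n by simp
      then show ?thesis by (simp only: B_def mem_Collect_eq length_map length_upt) simp
    qed
    ultimately show "\<exists>A\<in>D n. \<forall>e. P e \<longleftrightarrow> map e [0..<n] \<in> A"
      using A(2) by blast
  qed
qed

lemma definable_pred_not: "definable_pred P \<Longrightarrow> definable_pred (\<lambda>e. \<not> P e)"
proof -
  assume "definable_pred P"
  then obtain n A where A: "A \<in> D n" "\<And>e. P e \<longleftrightarrow> map e [0..<n] \<in> A"
    by (auto simp: definable_pred_def)
  show ?thesis
    by (rule definable_predI[OF compl[OF A(1)]]) (simp add: A(2))
qed

lemma definable_pred_conj:
  assumes "definable_pred P" "definable_pred Q"
  shows "definable_pred (\<lambda>e. P e \<and> Q e)"
proof -
  obtain n1 n2 where
    n1: "\<And>n. n \<ge> n1 \<Longrightarrow> \<exists>A\<in>D n. \<forall>e. P e \<longleftrightarrow> map e [0..<n] \<in> A" and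
    n2: "\<And>n. n \<ge> n2 \<Longrightarrow> \<exists>A\<in>D n. \<forall>e. Q e \<longleftrightarrow> map e [0..<n] \<in> A"
    using definable_pred_large_arity assms by metis
  obtain A B where A: "A \<in> D (max n1 n2)" "\<And>e. P e \<longleftrightarrow> map e [0..<max n1 n2] \<in> A"
    and B: "B \<in> D (max n1 n2)" "\<And>e. Q e \<longleftrightarrow> map e [0..<max n1 n2] \<in> B"
    using n1[of "max n1 n2"] n2[of "max n1 n2"] by auto
  show ?thesis unfolding definable_pred_def
    by (rule exI[of _ "max n1 n2"], rule bexI[OF _ definable_Int[OF A(1) B(1)]])
      (simp add: A(2) B(2))
qed

lemma definable_pred_disj: "definable_pred P \<Longrightarrow> definable_pred Q \<Longrightarrow> definable_pred (\<lambda>e. P e \<or> Q e)"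
  using definable_pred_not[OF definable_pred_conj[OF definable_pred_not definable_pred_not]] by simp

lemma definable_pred_imp: "definable_pred P \<Longrightarrow> definable_pred Q \<Longrightarrow> definable_pred (\<lambda>e. P e \<longrightarrow> Q e)"
  using definable_pred_not[OF definable_pred_conj[OF _ definable_pred_not]] by simp

lemma definable_pred_iff: "definable_pred P \<Longrightarrow> definable_pred Q \<Longrightarrow> definable_pred (\<lambda>e. P e \<longleftrightarrow> Q e)"
  unfolding iff_conv_conj_imp by (intro definable_pred_conj definable_pred_imp)

lemma definable_pred_const: "definable_pred (\<lambda>e. b)"
proof (cases b)
  case True
  then show ?thesis unfolding definable_pred_def using definable_UNIV[of 0] by force
next
  case False
  then show ?thesis unfolding definable_pred_def using empty by force
qed

lemma definable_pred_exv:
  assumes "definable_pred (\<lambda>e. P (\<lambda>i. e (i + m)) (map e [0..<m]))"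
  shows "definable_pred (\<lambda>e. \<exists>q. length q = m \<and> P e q)"
proof -
  obtain n0 where n0: "\<And>n. n \<ge> n0 \<Longrightarrow>
     \<exists>A\<in>D n. \<forall>e. P (\<lambda>i. e (i + m)) (map e [0..<m]) \<longleftrightarrow> map e [0..<n] \<in> A"
    using definable_pred_large_arity[OF assms] by blast
  obtain A where A: "A \<in> D (m + n0)"
      "\<And>e. P (\<lambda>i. e (i + m)) (map e [0..<m]) \<longleftrightarrow> map e [0..<m + n0] \<in> A"
    using n0[of "m + n0"] by auto
  define \<sigma> where "\<sigma> i = (if i < m then n0 + i else i - m)" for i
  define B where "B = {xs. length xs = n0 + m \<and> map (\<lambda>i. xs ! \<sigma> i) [0..<m + n0] \<in> A}"
  have B: "B \<in> D (n0 + m)"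
    unfolding B_def by (rule definable_reindex[OF A(1)]) (auto simp: \<sigma>_def)
  have "P e q \<longleftrightarrow> map e [0..<n0] @ q \<in> B" if "length q = m" for e q
  proof -
    define e' where "e' i = (if i < m then q ! i else e (i - m))" for i
    have 1: "map e' [0..<m] = q" using that
      by (intro nth_equalityI) (auto simp: e'_def)
    have 2: "(\<lambda>i. e' (i + m)) = e" by (auto simp: e'_def)
    have "map (\<lambda>i. (map e [0..<n0] @ q) ! \<sigma> i) [0..<m + n0] = map e' [0..<m + n0]"
      using that by (auto simp: \<sigma>_def nth_append e'_def simp del: upt_Suc)
    then show ?thesis
      using A(2)[of e'] that
      by (simp only: 1 2 B_def mem_Collect_eq length_map length_upt length_append) simp
  qed
  then have "(\<exists>q. length q = m \<and> P e q) \<longleftrightarrow>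
     map e [0..<n0] \<in> {xs. length xs = n0 \<and> (\<exists>ys. length ys = m \<and> xs @ ys \<in> B)}" for e
    by auto
  then show ?thesis
    by - (rule definable_predI[OF definable_projections[OF B]])
qed

lemma definable_pred_allv:
  assumes "definable_pred (\<lambda>e. P (\<lambda>i. e (i + m)) (map e [0..<m]))"
  shows "definable_pred (\<lambda>e. \<forall>q. length q = m \<longrightarrow> P e q)"
  using definable_pred_not[OF definable_pred_exv[of "\<lambda>e q. \<not> P e q", OF definable_pred_not[OF assms]]] by simp

lemma definable_pred_ex:
  assumes "definable_pred (\<lambda>e. P (\<lambda>i. e (Suc i)) (e 0))"
  shows "definable_pred (\<lambda>e. \<exists>t. P e t)"
proof -
  have "definable_pred (\<lambda>e. \<exists>q. length q = 1 \<and> P e (q ! 0))"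
    by (rule definable_pred_exv) (use assms in simp)
  moreover have "(\<exists>q::real list. length q = 1 \<and> R (q ! 0)) \<longleftrightarrow> (\<exists>t. R t)" for R
    by (metis length_Cons list.size(3) nth_Cons_0 One_nat_def)
  ultimately show ?thesis by simp
qed

lemma definable_pred_all:
  assumes "definable_pred (\<lambda>e. P (\<lambda>i. e (Suc i)) (e 0))"
  shows "definable_pred (\<lambda>e. \<forall>t::real. P e t)"
  using definable_pred_not[OF definable_pred_ex[of "\<lambda>e q. \<not> P e q", OF definable_pred_not[OF assms]]] by simp

lemma definable_pred_finite_all:
  fixes m :: nat
  assumes "\<And>i. i < m \<Longrightarrow> definable_pred (\<lambda>e. P e i)"
  shows "definable_pred (\<lambda>e. \<forall>i<m. P e i)"
  using assms
proof (induction m)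
  case 0
  then show ?case by (simp add: definable_pred_const)
next
  case (Suc m)
  have "definable_pred (\<lambda>e. (\<forall>i<m. P e i) \<and> P e m)"
    using Suc by (intro definable_pred_conj) auto
  then show ?case by (simp add: less_Suc_eq imp_disjL all_conj_distrib conj_commute)
qed

lemma definable_pred_finite_ex:
  fixes m :: nat
  assumes "\<And>i. i < m \<Longrightarrow> definable_pred (\<lambda>e. P e i)"
  shows "definable_pred (\<lambda>e. \<exists>i<m. P e i)"
  using definable_pred_not[OF definable_pred_finite_all[of m "\<lambda>e i. \<not> P e i"]] assms definable_pred_not by simp

lemma definable_term_shift:
  assumes "definable_term u"
  shows "definable_term (\<lambda>e. u (\<lambda>i. e (\<sigma> i)))"
  using definable_pred_reindex[OF assms[unfolded definable_term_def], of "\<lambda>i. case i of 0 \<Rightarrow> 0 | Suc i \<Rightarrow> Suc (\<sigma> i)"]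
  by (simp add: definable_term_def)

lemma definable_pred_mem_map:
  assumes A: "A \<in> D n" and u: "\<And>i. i < n \<Longrightarrow> definable_term (u i)"
  shows "definable_pred (\<lambda>e. map (\<lambda>i. u i e) [0..<n] \<in> A)"
proof -
  have "definable_pred (\<lambda>e. \<exists>q. length q = n \<and> (q \<in> A \<and> (\<forall>i<n. q ! i = u i e)))"
  proof (rule definable_pred_exv, rule definable_pred_conj)
    show "definable_pred (\<lambda>e. map e [0..<n] \<in> A)"
      unfolding definable_pred_def using A by blast
    have "definable_pred (\<lambda>e. e i = u i (\<lambda>j. e (j + n)))" if "i < n" for i
      using definable_pred_reindex[OF u[OF that, unfolded definable_term_def], of "\<lambda>j. if j = 0 then i else j - 1 + n"]
      by simp
    then show "definable_pred (\<lambda>e. \<forall>i<n. map e [0..<n] ! i = u i (\<lambda>i. e (i + n)))"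
      by (intro definable_pred_finite_all) simp
  qed
  moreover have "(\<exists>q. length q = n \<and> (q \<in> A \<and> (\<forall>i<n. q ! i = u i e))) \<longleftrightarrow> map (\<lambda>i. u i e) [0..<n] \<in> A" for e
  proof
    assume "\<exists>q. length q = n \<and> (q \<in> A \<and> (\<forall>i<n. q ! i = u i e))"
    then obtain q where q: "length q = n" "q \<in> A" "\<And>i. i < n \<Longrightarrow> q ! i = u i e" by blast
    then have "q = map (\<lambda>i. u i e) [0..<n]" by (intro nth_equalityI) auto
    then show "map (\<lambda>i. u i e) [0..<n] \<in> A" using q by simp
  next
    assume "map (\<lambda>i. u i e) [0..<n] \<in> A"
    then show "\<exists>q. length q = n \<and> (q \<in> A \<and> (\<forall>i<n. q ! i = u i e))"
      by (intro exI[of _ "map (\<lambda>i. u i e) [0..<n]"]) simp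
  qed
  ultimately show ?thesis by simp
qed

lemma definable_pred_mem:
  assumes A: "A \<in> D n" and v: "definable_vec n v"
  shows "definable_pred (\<lambda>e. v e \<in> A)"
proof -
  have "map (\<lambda>i. v e ! i) [0..<n] = v e" for e
    using v by (metis definable_vec_def map_nth)
  then show ?thesis
    using definable_pred_mem_map[OF A, of "\<lambda>i e. v e ! i"] v by (simp add: definable_vec_def)
qed

lemma definable_vec_Nil: "definable_vec 0 (\<lambda>e. [])"
  by (simp add: definable_vec_def)

lemma definable_vec_Cons:
  assumes "definable_term u" "definable_vec n v"
  shows "definable_vec (Suc n) (\<lambda>e. u e # v e)"
proof -
  have "definable_term (\<lambda>e. (u e # v e) ! i)" if "i < Suc n" for i
    using that assms by (cases i) (simp_all add: definable_vec_def)
  then show ?thesis using assms by (simp add: definable_vec_def)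
qed

lemma definable_vec_map:
  assumes "\<And>i. i < n \<Longrightarrow> definable_term (\<lambda>e. u e i)"
  shows "definable_vec n (\<lambda>e. map (u e) [0..<n])"
proof -
  have "(\<lambda>e. map (u e) [0..<n] ! i) = (\<lambda>e. u e i)" if "i < n" for i
    using that by (intro ext) simp
  then show ?thesis unfolding definable_vec_def using assms by (metis length_map length_upt diff_zero)
qed

lemma definable_vec_const: "length q = n \<Longrightarrow> (\<And>x. definable_term (\<lambda>_. x)) \<Longrightarrow> definable_vec n (\<lambda>e. q)"
  by (auto simp: definable_vec_def)

lemma definable_vec_snoc:
  assumes "definable_vec n v" "definable_term u"
  shows "definable_vec (Suc n) (\<lambda>e. v e @ [u e])"
proof -
  have "definable_term (\<lambda>e. (v e @ [u e]) ! i)" if "i < Suc n" for i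
  proof (cases "i < n")
    case True
    then show ?thesis using assms by (simp add: definable_vec_def nth_append)
  next
    case False
    then have "i = n" using that by simp
    then show ?thesis using assms by (simp add: definable_vec_def nth_append)
  qed
  then show ?thesis using assms by (auto simp: definable_vec_def)
qed

lemma definable_vec_update:
  assumes "definable_vec n v" "definable_term u"
  shows "definable_vec n (\<lambda>e. (v e)[j := u e])"
proof -
  have "definable_term (\<lambda>e. (v e)[j := u e] ! i)" if "i < n" for i
  proof (cases "i = j")
    case True
    then have "(\<lambda>e. (v e)[j := u e] ! i) = u"
      using that assms by (auto simp: definable_vec_def)
    then show ?thesis using assms by simp
  next
    case False
    then show ?thesis using that assms by (simp add: definable_vec_def)
  qed
  then show ?thesis using assms by (simp add: definable_vec_def)
qed

lemma definable_term_nth: "definable_vec n v \<Longrightarrow> i < n \<Longrightarrow> definable_term (\<lambda>e. v e ! i)"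
  by (simp add: definable_vec_def)

lemma definable_term_nth_map: "i < n \<Longrightarrow> definable_term (\<lambda>e. u e i) \<Longrightarrow> definable_term (\<lambda>e. map (u e) [0..<n] ! i)"
  by simp

lemma definable_term_var: "definable_term (\<lambda>e. e i)"
proof -
  have "definable_pred (\<lambda>e. map (\<lambda>k. e (if k = 0 then 0 else Suc i)) [0..<2] \<in> {xs. length xs = 2 \<and> xs ! 0 = xs ! 1})"
    by (rule definable_pred_atom) (use diagonal[of 0 1 2] in auto)
  then show ?thesis by (simp add: definable_term_def upt_rec)
qed

lemma definable_term_const: "definable_term (\<lambda>e. r)"
proof -
  have "definable_pred (\<lambda>e. map e [0..<1] \<in> {[r]})"
    by (rule definable_pred_atom) (rule parameter)
  then show ?thesis by (simp add: definable_term_def)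
qed

lemma definable_term_binary:
  assumes G: "{[x, y, g x y] |x y. True} \<in> D 3" and "definable_term u" "definable_term v"
  shows "definable_term (\<lambda>e. g (u e) (v e))"
proof -
  have "definable_pred (\<lambda>e. [u (\<lambda>i. e (Suc i)), v (\<lambda>i. e (Suc i)), e 0] \<in> {[x, y, g x y] |x y. True})"
    by (rule definable_pred_mem[OF G[unfolded numeral_3_eq_3]]) (intro definable_vec_Cons definable_vec_Nil definable_term_var definable_term_shift[OF assms(2)] definable_term_shift[OF assms(3)])
  then show ?thesis by (simp add: definable_term_def)
qed

lemmas definable_term_add = definable_term_binary[OF plus]
lemmas definable_term_mult = definable_term_binary[OF times]

lemma definable_term_minus: "definable_term u \<Longrightarrow> definable_term (\<lambda>e. - u e)"
  using definable_term_mult[OF definable_term_const[of "-1"]] by simp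

lemma definable_term_diff: "definable_term u \<Longrightarrow> definable_term v \<Longrightarrow> definable_term (\<lambda>e. u e - v e)"
  using definable_term_add[OF _ definable_term_minus] by simp

lemma definable_pred_less:
  assumes "definable_term u" "definable_term v"
  shows "definable_pred (\<lambda>e. u e < v e)"
proof -
  have "definable_pred (\<lambda>e. [u e, v e] \<in> {[x, y] |x y. x < y})"
    by (rule definable_pred_mem[OF less[unfolded numeral_2_eq_2]]) (intro definable_vec_Cons definable_vec_Nil assms)
  then show ?thesis by simp
qed

lemma definable_pred_le:
  assumes "definable_term u" "definable_term v"
  shows "definable_pred (\<lambda>e. u e \<le> v e)"
  using definable_pred_not[OF definable_pred_less[OF assms(2,1)]] by (simp add: not_less)

lemma definable_pred_eq:
  assumes "definable_term u" "definable_term v"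
  shows "definable_pred (\<lambda>e. u e = v e)"
  using definable_pred_conj[OF definable_pred_le[OF assms] definable_pred_le[OF assms(2,1)]] by (simp add: eq_iff)

lemma definable_term_graph:
  assumes "definable_pred (\<lambda>e. P (\<lambda>i. e (Suc i)) (e 0))" "\<And>e t. t = u e \<longleftrightarrow> P e t"
  shows "definable_term u"
  using assms by (simp add: definable_term_def)

lemma definable_term_if:
  assumes "definable_pred P" "definable_term u" "definable_term v"
  shows "definable_term (\<lambda>e. if P e then u e else v e)"
proof (rule definable_term_graph)
  show "definable_pred (\<lambda>e. (P (\<lambda>i. e (Suc i)) \<longrightarrow> e 0 = u (\<lambda>i. e (Suc i))) \<and>
      (\<not> P (\<lambda>i. e (Suc i)) \<longrightarrow> e 0 = v (\<lambda>i. e (Suc i))))"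
    by (intro definable_pred_conj definable_pred_imp definable_pred_not definable_pred_eq definable_term_var definable_term_shift[OF assms(2)] definable_term_shift[OF assms(3)]
        definable_pred_reindex[OF assms(1)])
qed auto

lemma definable_term_abs: "definable_term u \<Longrightarrow> definable_term (\<lambda>e. \<bar>u e\<bar>)"
  unfolding abs_if by (intro definable_term_if definable_pred_less definable_term_const definable_term_minus)

lemma definable_term_inverse:
  assumes "definable_term u"
  shows "definable_term (\<lambda>e. inverse (u e))"
proof (rule definable_term_graph)
  show "definable_pred (\<lambda>e. (u (\<lambda>i. e (Suc i)) = 0 \<and> e 0 = 0) \<or> u (\<lambda>i. e (Suc i)) * e 0 = 1)"
    by (intro definable_pred_conj definable_pred_disj definable_pred_eq definable_term_var definable_term_const definable_term_mult definable_term_shift[OF assms])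
  show "(t = inverse (u e)) = ((u e = 0 \<and> t = 0) \<or> u e * t = 1)" for t e
    by (metis inverse_unique inverse_zero mult_zero_left right_inverse zero_neq_one)
qed

lemma definable_term_divide: "definable_term u \<Longrightarrow> definable_term v \<Longrightarrow> definable_term (\<lambda>e. u e / v e)"
  unfolding divide_inverse by (intro definable_term_mult definable_term_inverse)

lemma definable_vec_shift: "definable_vec n v \<Longrightarrow> definable_vec n (\<lambda>e. v (\<lambda>i. e (\<sigma> i)))"
  using definable_term_shift by (auto simp: definable_vec_def)

lemma definable_term_sum:
  fixes n :: nat
  assumes "\<And>i. i < n \<Longrightarrow> definable_term (\<lambda>e. u e i)"
  shows "definable_term (\<lambda>e. \<Sum>i<n. u e i)"
  using assms by (induction n) (auto intro: definable_term_add definable_term_const)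

lemma definable_term_from_less:
  assumes "definable_pred (\<lambda>e. e 0 < u (\<lambda>i. e (Suc i)))"
  shows "definable_term u"
proof (rule definable_term_graph)
  have *: "definable_pred (\<lambda>e. e 0 < u (\<lambda>i. e (Suc (Suc i))))"
    using definable_pred_reindex[OF assms, of "\<lambda>i. case i of 0 \<Rightarrow> 0 | Suc i \<Rightarrow> Suc (Suc i)"] by simp
  show "definable_pred (\<lambda>e. \<not> e 0 < u (\<lambda>i. e (Suc i)) \<and> (\<forall>s. s < e 0 \<longrightarrow> s < u (\<lambda>i. e (Suc i))))"
    by (intro definable_pred_conj definable_pred_not assms definable_pred_all definable_pred_imp definable_pred_less definable_term_var *)
  show "(t = u e) = (\<not> t < u e \<and> (\<forall>s. s < t \<longrightarrow> s < u e))" for t e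
    by (metis less_irrefl linorder_neqE_linordered_idom)
qed

lemma definable_pred_Collect: "definable_pred (\<lambda>e. P (map e [0..<m])) \<Longrightarrow> {xs. length xs = m \<and> P xs} \<in> D m"
proof -
  assume P: "definable_pred (\<lambda>e. P (map e [0..<m]))"
  obtain n0 where n0: "\<And>n. n \<ge> n0 \<Longrightarrow> \<exists>A\<in>D n. \<forall>e. P (map e [0..<m]) \<longleftrightarrow> map e [0..<n] \<in> A"
    using definable_pred_large_arity[OF P] by blast
  obtain A where A: "A \<in> D (m + n0)" "\<And>e. P (map e [0..<m]) \<longleftrightarrow> map e [0..<m + n0] \<in> A"
    using n0[of "m + n0"] by auto
  have "P xs \<longleftrightarrow> (\<exists>ys. length ys = n0 \<and> xs @ ys \<in> A)" if "length xs = m" for xs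
  proof -
    have *: "P xs \<longleftrightarrow> xs @ ys \<in> A" if ys: "length ys = n0" for ys
    proof -
      have "map (\<lambda>i. (xs @ ys) ! i) [0..<m] = xs"
        using that \<open>length xs = m\<close> by (intro nth_equalityI) (auto simp: nth_append)
      moreover have "map (\<lambda>i. (xs @ ys) ! i) [0..<m + n0] = xs @ ys"
        using map_nth[of "xs @ ys"] ys \<open>length xs = m\<close> by simp
      ultimately show ?thesis using A(2)[of "\<lambda>i. (xs @ ys) ! i"] by (simp only:)
    qed
    show ?thesis
    proof
      assume "P xs"
      then have "xs @ replicate n0 0 \<in> A" using * by simp
      then show "\<exists>ys. length ys = n0 \<and> xs @ ys \<in> A"
        by (intro exI[of _ "replicate n0 0"]) simp
    next
      assume "\<exists>ys. length ys = n0 \<and> xs @ ys \<in> A"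
      then show "P xs" using * by auto
    qed
  qed
  then have "{xs. length xs = m \<and> P xs} = {xs. length xs = m \<and> (\<exists>ys. length ys = n0 \<and> xs @ ys \<in> A)}"
    by (intro Collect_cong conj_cong refl)
  then show ?thesis using definable_projections[OF A(1)] by (simp only:)
qed

definition definable_op :: "nat \<Rightarrow> (real list \<Rightarrow> real) \<Rightarrow> bool" where
  "definable_op m f \<longleftrightarrow> definable_term (\<lambda>e. f (map e [0..<m]))"

lemma definable_op_graph:
  assumes "definable_op m f"
  shows "{xs @ [f xs] |xs. length xs = m} \<in> D (Suc m)"
proof -
  have "{ys. length ys = Suc m \<and> ys ! m = f (map (\<lambda>i. ys ! i) [0..<m])} \<in> D (Suc m)"
  proof (rule definable_pred_Collect)
    have "map (\<lambda>i. map e [0..<Suc m] ! i) [0..<m] = map e [0..<m]" "map e [0..<Suc m] ! m = e m"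
      for e :: "nat \<Rightarrow> real"
      by (simp_all del: upt_Suc)
    then show "definable_pred (\<lambda>e. map e [0..<Suc m] ! m = f (map (\<lambda>i. map e [0..<Suc m] ! i) [0..<m]))"
      using definable_pred_eq[OF definable_term_var assms[unfolded definable_op_def]] by (simp only:)
  qed
  also have "{ys. length ys = Suc m \<and> ys ! m = f (map (\<lambda>i. ys ! i) [0..<m])}
     = {xs @ [f xs] |xs. length xs = m}"
  proof (intro equalityI subsetI; clarsimp)
    fix ys :: "real list" assume ys: "length ys = Suc m" "ys ! m = f (map ((!) ys) [0..<m])"
    have "ys = map ((!) ys) [0..<m] @ [ys ! m]"
      using ys by (intro nth_equalityI) (auto simp: nth_append less_Suc_eq)
    then show "\<exists>xs. ys = xs @ [f xs] \<and> length xs = m"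
      using ys by (intro exI[of _ "map ((!) ys) [0..<m]"]) simp
  next
    fix xs :: "real list" assume "m = length xs"
    then have "map ((!) (xs @ [f xs])) [0..<length xs] = xs"
      by (intro nth_equalityI) (auto simp: nth_append)
    then show "f xs = f (map ((!) (xs @ [f xs])) [0..<length xs])" by simp
  qed
  finally show ?thesis .
qed

lemma definable_op_total:
  assumes "definable_op m f"
  shows "definable_fun D m {xs. length xs = m} f"
  using definable_op_graph[OF assms] by (auto simp: definable_fun_def)

lemma definable_fun_dom:
  assumes "definable_fun D m A f"
  shows "A \<in> D m"
proof -
  have "butlast ` {xs @ [f xs] |xs. xs \<in> A} \<in> D m"
    using assms projection by (auto simp: definable_fun_def)
  also have "butlast ` {xs @ [f xs] |xs. xs \<in> A} = A"
    by (auto simp: image_iff) (metis butlast_snoc)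
  finally show ?thesis .
qed

lemma definable_term_app:
  assumes f: "definable_op m f" and v: "definable_vec m v"
  shows "definable_term (\<lambda>e. f (v e))"
proof (rule definable_term_graph)
  have "definable_vec m (\<lambda>e. v (\<lambda>i. e (Suc i)))"
    by (rule definable_vec_shift[OF v])
  then show "definable_pred (\<lambda>e. v (\<lambda>i. e (Suc i)) @ [e 0] \<in> {xs @ [f xs] |xs. length xs = m})"
    by (intro definable_pred_mem[OF definable_op_graph[OF f]] definable_vec_snoc definable_term_var)
  show "(t = f (v e)) = (v e @ [t] \<in> {xs @ [f xs] |xs. length xs = m})" for e t
    using v by (auto simp: definable_vec_def)
qed

lemma definable_fun_total:
  assumes "definable_fun D m A f"
  shows "definable_op m (\<lambda>xs. if xs \<in> A then f xs else 0)"
  unfolding definable_op_def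
proof (rule definable_term_graph)
  have G: "{xs @ [f xs] |xs. xs \<in> A} \<in> D (Suc m)" using assms by (auto simp: definable_fun_def)
  show "definable_pred (\<lambda>e. map (\<lambda>i. e (Suc i)) [0..<m] @ [e 0] \<in> {xs @ [f xs] |xs. xs \<in> A} \<or>
     map (\<lambda>i. e (Suc i)) [0..<m] \<notin> A \<and> e 0 = 0)"
    by (intro definable_pred_disj definable_pred_conj definable_pred_not definable_pred_eq definable_pred_mem[OF G] definable_pred_mem[OF definable_fun_dom[OF assms]]
        definable_vec_snoc definable_vec_map definable_term_var definable_term_const)
qed auto

lemmas definable_vec_const' = definable_vec_const[OF _ definable_term_const]

lemmas definable_intros = definable_pred_not definable_pred_conj definable_pred_disj definable_pred_imp definable_pred_iff definable_pred_const definable_pred_less definable_pred_le definable_pred_eq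
  definable_pred_exv definable_pred_allv definable_pred_ex definable_pred_all definable_pred_finite_all definable_pred_finite_ex
  definable_vec_Nil definable_vec_Cons definable_vec_snoc definable_vec_map definable_vec_update definable_vec_const'
  definable_term_nth_map definable_term_var definable_term_const definable_term_add definable_term_mult definable_term_minus definable_term_diff definable_term_if definable_term_abs definable_term_inverse definable_term_divide definable_term_sum

end

section \<open>Small sets and generic smoothness\<close>

definition cube :: "real list \<Rightarrow> real \<Rightarrow> real list set" where
  "cube p r = {q. length q = length p \<and> (\<forall>i<length p. \<bar>q ! i - p ! i\<bar> < r)}"

lemma cube_length: "q \<in> cube p r \<Longrightarrow> length q = length p"
  by (simp add: cube_def)

lemma cube_self: "r > 0 \<Longrightarrow> p \<in> cube p r"
  by (simp add: cube_def)

lemma cube_mono: "r \<le> s \<Longrightarrow> cube p r \<subseteq> cube p s"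
  by (force simp: cube_def)

lemma cube_open:
  assumes "q \<in> cube p r"
  obtains s where "s > 0" "cube q s \<subseteq> cube p r"
proof -
  define S where "S = insert 1 ((\<lambda>i. r - \<bar>q ! i - p ! i\<bar>) ` {..<length p})"
  have S: "finite S" "S \<noteq> {}" by (auto simp: S_def)
  have pos: "Min S > 0"
    using S assms by (auto simp: cube_def S_def)
  have "cube q (Min S) \<subseteq> cube p r"
  proof
    fix z assume z: "z \<in> cube q (Min S)"
    have "\<bar>z ! i - p ! i\<bar> < r" if "i < length p" for i
    proof -
      have "Min S \<le> r - \<bar>q ! i - p ! i\<bar>" using that S by (intro Min_le) (auto simp: S_def)
      moreover have "\<bar>z ! i - q ! i\<bar> < Min S" using z assms that by (auto simp: cube_def)
      ultimately show ?thesis by linarith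
    qed
    then show "z \<in> cube p r" using z assms by (simp add: cube_def)
  qed
  then show thesis using pos that by blast
qed

lemma cube_snoc: "q \<in> cube p r \<Longrightarrow> \<bar>t - s\<bar> < r \<Longrightarrow> q @ [t] \<in> cube (p @ [s]) r"
  by (auto simp: cube_def nth_append less_Suc_eq)

lemma cube_snocD: "q @ [t] \<in> cube (p @ [s]) r \<Longrightarrow> q \<in> cube p r \<and> \<bar>t - s\<bar> < r"
  by (auto simp: cube_def nth_append less_Suc_eq split: if_splits)

text \<open>A \<open>\<sigma>\<close>-ideal that satisfies Fubini's theorem by definition. A definable set belongs to it if and
  only if it has empty interior, so a countable union of definable sets with empty interior contains no
  cube.\<close>

primrec small :: "nat \<Rightarrow> real list set \<Rightarrow> bool" where
  "small 0 A \<longleftrightarrow> [] \<notin> A"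
| "small (Suc m) A \<longleftrightarrow> small m {p. length p = m \<and> uncountable {t. p @ [t] \<in> A}}"

lemma small_mono: "small m B \<Longrightarrow> A \<subseteq> B \<Longrightarrow> small m A"
proof (induction m arbitrary: A B)
  case (Suc m)
  have "{p. length p = m \<and> uncountable {t. p @ [t] \<in> A}} \<subseteq> {p. length p = m \<and> uncountable {t. p @ [t] \<in> B}}"
    using Suc.prems(2) by (auto dest: countable_subset[rotated, of _ "{t. _ @ [t] \<in> A}"])
  then show ?case using Suc by auto
qed auto

lemma small_UN:
  assumes "countable I" "\<And>i. i \<in> I \<Longrightarrow> small m (A i)"
  shows "small m (\<Union>i\<in>I. A i)"
  using assms(2)
proof (induction m arbitrary: A)
  case (Suc m)
  have "{p. length p = m \<and> uncountable {t. p @ [t] \<in> (\<Union>i\<in>I. A i)}}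
     \<subseteq> (\<Union>i\<in>I. {p. length p = m \<and> uncountable {t. p @ [t] \<in> A i}})"
  proof
    fix p assume p: "p \<in> {p. length p = m \<and> uncountable {t. p @ [t] \<in> (\<Union>i\<in>I. A i)}}"
    have "{t. p @ [t] \<in> (\<Union>i\<in>I. A i)} = (\<Union>i\<in>I. {t. p @ [t] \<in> A i})" by auto
    then show "p \<in> (\<Union>i\<in>I. {p. length p = m \<and> uncountable {t. p @ [t] \<in> A i}})"
      using p countable_UN[OF assms(1)] by force
  qed
  moreover have "small m (\<Union>i\<in>I. {p. length p = m \<and> uncountable {t. p @ [t] \<in> A i}})"
    using Suc by auto
  ultimately show ?case by (auto intro: small_mono)
qed auto

lemma not_small_rational_cover:
  assumes "\<not> small m A" "A \<subseteq> (\<Union>i\<in>{(u,v)\<in>\<rat>\<times>\<rat>. u < v}. B i)"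
  obtains u v :: real where "u < v" "\<not> small m (B (u, v))"
proof -
  have "countable {(u,v)\<in>\<rat>\<times>\<rat>. u < (v::real)}"
    using countable_rat by (intro countable_subset[OF _ countable_SIGMA[of \<rat> "\<lambda>_. \<rat>"]]) auto
  then show thesis
    using assms small_UN[of "{(u,v)\<in>\<rat>\<times>\<rat>. u < (v::real)}" m B] that by (auto dest: small_mono)
qed

lemma small_Un: "small m A \<Longrightarrow> small m B \<Longrightarrow> small m (A \<union> B)"
  using small_UN[of UNIV m "\<lambda>b. if b then A else B"] by (simp add: UNIV_bool Un_commute)

lemma not_small_cube: "r > 0 \<Longrightarrow> length p = m \<Longrightarrow> \<not> small m (cube p r)"
proof (induction m arbitrary: p)
  case 0
  then show ?case by (simp add: cube_def)
next
  case (Suc m)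
  obtain p' s where p: "p = p' @ [s]" "length p' = m"
    using Suc.prems by (metis length_Suc_conv_rev)
  have "cube p' r \<subseteq> {q. length q = m \<and> uncountable {t. q @ [t] \<in> cube p r}}"
  proof
    fix q assume q: "q \<in> cube p' r"
    have "{s - r<..<s + r} \<subseteq> {t. q @ [t] \<in> cube p r}"
      using q by (auto simp: p intro!: cube_snoc)
    moreover have "uncountable {s - r<..<s + r}"
      using Suc.prems by (simp add: uncountable_open_interval)
    ultimately show "q \<in> {q. length q = m \<and> uncountable {t. q @ [t] \<in> cube p r}}"
      using cube_length[OF q] p countable_subset by auto
  qed
  then show ?case
    using Suc.IH[OF Suc.prems(1) p(2)] by (auto dest: small_mono)
qed

lemma small_Diff: "\<not> small m A \<Longrightarrow> small m B \<Longrightarrow> \<not> small m (A - B)"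
  by (metis Diff_partition Un_Diff_cancel Un_commute Un_upper2 small_Un small_mono sup_ge1)

text \<open>The notions of analysis needed below are spelled out so that their definability can be read off.\<close>

definition continuous_at_point :: "(real list \<Rightarrow> real) \<Rightarrow> real list \<Rightarrow> bool" where
  "continuous_at_point f p \<longleftrightarrow> (\<forall>\<eta>>0. \<exists>r>0. \<forall>q. length q = length p \<longrightarrow> q \<in> cube p r \<longrightarrow> \<bar>f q - f p\<bar> < \<eta>)"

definition has_partial_derivative :: "(real list \<Rightarrow> real) \<Rightarrow> nat \<Rightarrow> real list \<Rightarrow> real \<Rightarrow> bool" where
  "has_partial_derivative f j p d \<longleftrightarrow> (\<forall>\<eta>>0. \<exists>r>0. \<forall>s. 0 < \<bar>s\<bar> \<and> \<bar>s\<bar> < r \<longrightarrow>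
     \<bar>f (p[j := p ! j + s]) - f p - d * s\<bar> \<le> \<eta> * \<bar>s\<bar>)"

definition partial_derivative :: "(real list \<Rightarrow> real) \<Rightarrow> nat \<Rightarrow> real list \<Rightarrow> real" where
  "partial_derivative f j p = (if \<exists>d. has_partial_derivative f j p d then THE d. has_partial_derivative f j p d else 0)"

lemma has_partial_derivative_iff:
  "has_partial_derivative f j p d \<longleftrightarrow> ((\<lambda>t. f (p[j := t])) has_real_derivative d) (at (p ! j))"
proof -
  have [simp]: "f (p[j := p ! j]) = f p" by simp
  have "((\<lambda>t. f (p[j := t])) has_real_derivative d) (at (p ! j)) \<longleftrightarrow>
     ((\<lambda>s. (f (p[j := p ! j + s]) - f p) / s - d) \<longlongrightarrow> 0) (at 0)"
    unfolding DERIV_def by (simp add: LIM_zero_iff)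
  also have "\<dots> \<longleftrightarrow> (\<forall>\<eta>>0. \<exists>r>0. \<forall>s. s \<noteq> 0 \<and> \<bar>s\<bar> < r \<longrightarrow> \<bar>(f (p[j := p ! j + s]) - f p) / s - d\<bar> < \<eta>)"
    by (simp add: LIM_def)
  also have "\<dots> \<longleftrightarrow> has_partial_derivative f j p d"
  proof -
    have eq: "\<bar>(f (p[j := p ! j + s]) - f p) / s - d\<bar> * \<bar>s\<bar> = \<bar>f (p[j := p ! j + s]) - f p - d * s\<bar>"
      if "s \<noteq> 0" for s
      using that by (simp add: abs_mult[symmetric] field_simps)
    have lt: "\<bar>(f (p[j := p ! j + s]) - f p) / s - d\<bar> < \<eta> \<Longrightarrow>
       \<bar>f (p[j := p ! j + s]) - f p - d * s\<bar> \<le> \<eta> * \<bar>s\<bar>" if "s \<noteq> 0" for s \<eta>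
      unfolding eq[OF that, symmetric] by (intro mult_right_mono) auto
    have le: "\<bar>f (p[j := p ! j + s]) - f p - d * s\<bar> \<le> \<eta> / 2 * \<bar>s\<bar> \<Longrightarrow> \<eta> > 0 \<Longrightarrow>
       \<bar>(f (p[j := p ! j + s]) - f p) / s - d\<bar> < \<eta>" if "s \<noteq> 0" for s \<eta>
      unfolding eq[OF that, symmetric] using that by (subst (asm) mult_le_cancel_right) auto
    show ?thesis
      unfolding has_partial_derivative_def
    proof (intro iffI allI impI)
      fix \<eta> :: real assume "\<eta> > 0" and
        *: "\<forall>\<eta>>0. \<exists>r>0. \<forall>s. s \<noteq> 0 \<and> \<bar>s\<bar> < r \<longrightarrow> \<bar>(f (p[j := p ! j + s]) - f p) / s - d\<bar> < \<eta>"
      then show "\<exists>r>0. \<forall>s. 0 < \<bar>s\<bar> \<and> \<bar>s\<bar> < r \<longrightarrow> \<bar>f (p[j := p ! j + s]) - f p - d * s\<bar> \<le> \<eta> * \<bar>s\<bar>"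
        using lt by (metis zero_less_abs_iff)
    next
      fix \<eta> :: real assume \<eta>: "\<eta> > 0" and
        *: "\<forall>\<eta>>0. \<exists>r>0. \<forall>s. 0 < \<bar>s\<bar> \<and> \<bar>s\<bar> < r \<longrightarrow> \<bar>f (p[j := p ! j + s]) - f p - d * s\<bar> \<le> \<eta> * \<bar>s\<bar>"
      have "\<eta> / 2 > 0" using \<eta> by simp
      with * obtain r where "r > 0"
        "\<forall>s. 0 < \<bar>s\<bar> \<and> \<bar>s\<bar> < r \<longrightarrow> \<bar>f (p[j := p ! j + s]) - f p - d * s\<bar> \<le> \<eta> / 2 * \<bar>s\<bar>" by blast
      then show "\<exists>r>0. \<forall>s. s \<noteq> 0 \<and> \<bar>s\<bar> < r \<longrightarrow> \<bar>(f (p[j := p ! j + s]) - f p) / s - d\<bar> < \<eta>"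
        using le \<eta> by (metis zero_less_abs_iff)
    qed
  qed
  finally show ?thesis by simp
qed

lemma partial_derivative_eqI: "has_partial_derivative f j p d \<Longrightarrow> partial_derivative f j p = d"
proof -
  assume d: "has_partial_derivative f j p d"
  then have "(THE d. has_partial_derivative f j p d) = d"
    by (rule the_equality) (use d in \<open>auto simp: has_partial_derivative_iff intro: DERIV_unique\<close>)
  then show ?thesis using d by (auto simp: partial_derivative_def)
qed

lemma has_partial_derivative_partial_derivative: "has_partial_derivative f j p d \<Longrightarrow> has_partial_derivative f j p (partial_derivative f j p)"
  using partial_derivative_eqI by fastforce

lemma partial_derivative_graph: "t = partial_derivative f j p \<longleftrightarrow> has_partial_derivative f j p t \<or> (\<not> (\<exists>d. has_partial_derivative f j p d) \<and> t = 0)"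
  by (metis partial_derivative_def partial_derivative_eqI)

definition C1_at :: "(real list \<Rightarrow> real) \<Rightarrow> real list \<Rightarrow> bool" where
  "C1_at f p \<longleftrightarrow> (\<exists>r>0. \<forall>q. length q = length p \<longrightarrow> q \<in> cube p r \<longrightarrow> (\<forall>j<length p. \<exists>d. has_partial_derivative f j q d)) \<and>
     (\<forall>j<length p. continuous_at_point (partial_derivative f j) p)"

lemma eventually_cube:
  assumes len: "\<And>x. length (c x) = m"
    and cont: "\<And>j. j < m \<Longrightarrow> isCont (\<lambda>x. c x ! j) x0" and "r > 0"
  shows "\<forall>\<^sub>F x in nhds x0. c x \<in> cube (c x0) r"
proof -
  have "\<forall>\<^sub>F x in nhds x0. \<forall>j\<in>{..<m}. \<bar>c x ! j - c x0 ! j\<bar> < r"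
  proof (rule eventually_ball_finite)
    show "\<forall>j\<in>{..<m}. \<forall>\<^sub>F x in nhds x0. \<bar>c x ! j - c x0 ! j\<bar> < r"
    proof
      fix j assume "j \<in> {..<m}"
      then have "((\<lambda>x. c x ! j) \<longlongrightarrow> c x0 ! j) (nhds x0)"
        using cont[of j] by (simp add: continuous_at tendsto_nhds_iff)
      then show "\<forall>\<^sub>F x in nhds x0. \<bar>c x ! j - c x0 ! j\<bar> < r"
        using \<open>r > 0\<close> by (auto simp: tendsto_iff dist_real_def)
    qed
  qed simp
  then show ?thesis
    by eventually_elim (simp add: cube_def len)
qed

lemma chain_rule_C1_at:
  assumes f: "C1_at f (c x0)"
    and len: "\<And>x. length (c x) = m"
    and deriv: "\<And>j. j < m \<Longrightarrow> ((\<lambda>x. c x ! j) has_real_derivative c' j) (at x0)"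
  shows "((\<lambda>x. f (c x)) has_real_derivative (\<Sum>j<m. partial_derivative f j (c x0) * c' j)) (at x0)"
proof -
  define p where "p = c x0"
  have lp: "length p = m" by (simp add: p_def len)
  obtain r where r: "r > 0" "\<And>q j. q \<in> cube p r \<Longrightarrow> j < m \<Longrightarrow> \<exists>d. has_partial_derivative f j q d"
    using f by (auto simp: C1_at_def p_def len cube_length)
  have der: "((\<lambda>t. f (q[j := t])) has_real_derivative partial_derivative f j q) (at (q ! j))" if "q \<in> cube p r" "j < m" for q j
    using r(2)[OF that] has_partial_derivative_partial_derivative unfolding has_partial_derivative_iff by blast
  have lc: "\<exists>s>0. \<forall>q\<in>cube p s. \<bar>partial_derivative f j q - partial_derivative f j p\<bar> < \<eta>" if j: "j < m" and \<eta>: "\<eta> > 0" for j \<eta>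
  proof -
    obtain s where "s > 0" "\<forall>q. length q = m \<longrightarrow> q \<in> cube p s \<longrightarrow> \<bar>partial_derivative f j q - partial_derivative f j p\<bar> < \<eta>"
      using f j \<eta> unfolding C1_at_def p_def[symmetric] lp continuous_at_point_def by blast
    then show ?thesis using cube_length[of _ p s] lp by auto
  qed
  define z where "z k x = take k (c x) @ drop k p" for k x
  have z0: "z 0 x = p" and zm: "z m x = c x" for x
    by (simp_all add: z_def lp len)
  have zlen: "length (z k x) = m" if "k \<le> m" for k x
    using that by (simp add: z_def lp len)
  have znth: "z k x ! i = (if i < k then c x ! i else p ! i)" if "k \<le> m" "i < m" for k x i
    using that by (auto simp: z_def nth_append len lp)
  have zSuc: "z (Suc k) x = (z k x)[k := c x ! k]" if "k < m" for k x
    using that by (intro nth_equalityI) (auto simp: zlen znth nth_list_update)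
  have zx0: "z k x0 = p" for k
    by (simp add: z_def p_def)
  have step: "((\<lambda>x. f (z (Suc k) x) - f (z k x)) has_real_derivative partial_derivative f k p * c' k) (at x0)"
    if k: "k < m" for k
  proof -
    define T where "T x = f (z (Suc k) x) - f (z k x)" for x
    define G where "G x = (if c x ! k = p ! k then partial_derivative f k p else T x / (c x ! k - p ! k))" for x
    obtain w where w: "\<And>x. c x ! k - c x0 ! k = w x * (x - x0)" "isCont w x0" "w x0 = c' k"
      using deriv[OF k] unfolding CARAT_DERIV by blast
    have T: "T x - T x0 = G x * w x * (x - x0)" for x
    proof -
      have "T x0 = 0" by (simp add: T_def zx0)
      moreover have "T x = G x * (c x ! k - p ! k)"
      proof (cases "c x ! k = p ! k")
        case True
        then have "z (Suc k) x = z k x"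
          using k by (simp add: zSuc) (metis list_update_id znth less_imp_le_nat less_irrefl_nat)
        then show ?thesis using True by (simp add: T_def)
      qed (simp add: G_def)
      ultimately show ?thesis using w(1)[of x] by (simp add: p_def)
    qed
    have "(G \<longlongrightarrow> G x0) (nhds x0)"
      unfolding tendsto_iff
    proof (intro allI impI)
      fix \<eta> :: real assume "\<eta> > 0"
      then obtain s where s: "s > 0" "\<And>q. q \<in> cube p s \<Longrightarrow> \<bar>partial_derivative f k q - partial_derivative f k p\<bar> < \<eta>"
        using lc[OF k] by blast
      have "\<forall>\<^sub>F x in nhds x0. c x \<in> cube p (min r s)"
        unfolding p_def using r(1) s(1)
        by (intro eventually_cube[OF len] DERIV_isCont[OF deriv]) auto
      then show "\<forall>\<^sub>F x in nhds x0. dist (G x) (G x0) < \<eta>"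
      proof eventually_elim
        case (elim x)
        have *: "(z k x)[k := t] \<in> cube p (min r s)" if t: "t = p ! k \<or> t = c x ! k \<or> t \<in> {p ! k<..<c x ! k} \<or> t \<in> {c x ! k<..<p ! k}" for t
        proof -
          have "\<bar>(z k x)[k := t] ! i - p ! i\<bar> < min r s" if i: "i < m" for i
          proof (cases "i = k")
            case True
            have "\<bar>c x ! k - p ! k\<bar> < min r s" using elim k by (simp add: cube_def lp)
            moreover have "min r s > 0" using r s by simp
            ultimately have "\<bar>t - p ! k\<bar> < min r s" using t by (elim disjE) (auto simp: abs_if split: if_splits)
            then show ?thesis using True k by (simp add: zlen)
          next
            case False
            have "\<bar>c x ! i - p ! i\<bar> < min r s" using elim i by (simp add: cube_def lp)
            then show ?thesis using False i k r(1) s(1) by (auto simp: zlen znth)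
          qed
          then show ?thesis by (simp add: cube_def lp zlen k less_imp_le)
        qed
        have d: "((\<lambda>t. f ((z k x)[k := t])) has_real_derivative partial_derivative f k ((z k x)[k := t])) (at t)"
          if "t = p ! k \<or> t = c x ! k \<or> t \<in> {p ! k<..<c x ! k} \<or> t \<in> {c x ! k<..<p ! k}" for t
        proof -
          have "(z k x)[k := t] \<in> cube p r" using *[OF that] cube_mono[of "min r s" r p] by auto
          from der[OF this k] show ?thesis using k by (simp add: zlen)
        qed
        have b: "\<bar>partial_derivative f k ((z k x)[k := t]) - partial_derivative f k p\<bar> < \<eta>"
          if "t \<in> {p ! k<..<c x ! k} \<or> t \<in> {c x ! k<..<p ! k}" for t
          using *[of t] that s(2) cube_mono[of "min r s" s p] by auto
        have T: "T x = f ((z k x)[k := c x ! k]) - f ((z k x)[k := p ! k])"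
          using k by (simp add: T_def zSuc) (metis list_update_id znth less_imp_le_nat less_irrefl_nat)
        have G0: "G x0 = partial_derivative f k p" by (simp add: G_def p_def)
        consider "c x ! k = p ! k" | "p ! k < c x ! k" | "c x ! k < p ! k" by linarith
        then show ?case
        proof cases
          case 1
          then show ?thesis using \<open>\<eta> > 0\<close> by (simp add: G_def p_def)
        next
          case 2
          have "\<exists>t. t > p ! k \<and> t < c x ! k \<and> f ((z k x)[k := c x ! k]) - f ((z k x)[k := p ! k])
             = (c x ! k - p ! k) * partial_derivative f k ((z k x)[k := t])"
            by (rule MVT2[OF 2]) (rule d, auto)
          then obtain t where "t > p ! k" "t < c x ! k" "T x = (c x ! k - p ! k) * partial_derivative f k ((z k x)[k := t])"
            using T by auto
          then show ?thesis using 2 b[of t] by (simp add: G0 dist_real_def) (simp add: G_def)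
        next
          case 3
          have "\<exists>t. t > c x ! k \<and> t < p ! k \<and> f ((z k x)[k := p ! k]) - f ((z k x)[k := c x ! k])
             = (p ! k - c x ! k) * partial_derivative f k ((z k x)[k := t])"
            by (rule MVT2[OF 3]) (rule d, auto)
          then obtain t where "t > c x ! k" "t < p ! k" "- T x = (p ! k - c x ! k) * partial_derivative f k ((z k x)[k := t])"
            using T by auto
          then have "T x = (c x ! k - p ! k) * partial_derivative f k ((z k x)[k := t])"
            by (simp add: algebra_simps)
          then show ?thesis using 3 \<open>t > c x ! k\<close> \<open>t < p ! k\<close> b[of t] by (simp add: G0 dist_real_def) (simp add: G_def)
        qed
      qed
    qed
    then have "isCont G x0" by (simp add: continuous_at tendsto_nhds_iff)
    then have "isCont (\<lambda>x. G x * w x) x0" using w by (intro isCont_mult)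
    moreover have "G x0 * w x0 = partial_derivative f k p * c' k"
      using w by (simp add: G_def p_def)
    ultimately show ?thesis
      unfolding CARAT_DERIV T_def[symmetric] using T by (intro exI[of _ "\<lambda>x. G x * w x"]) auto
  qed
  have "f (c x) = f p + (\<Sum>k<m. f (z (Suc k) x) - f (z k x))" for x
    by (subst sum_lessThan_telescope) (simp add: z0 zm)
  moreover have "((\<lambda>x. f p + (\<Sum>k<m. f (z (Suc k) x) - f (z k x))) has_real_derivative 0 + (\<Sum>k<m. partial_derivative f k p * c' k)) (at x0)"
    by (rule DERIV_add[OF DERIV_const DERIV_sum]) (simp add: step)
  ultimately show ?thesis by (simp only: p_def[symmetric] add_0)
qed

context real_field_structure
begin

lemma definable_pred_cube:
  assumes "definable_vec m v" "definable_vec m w" "definable_term u"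
  shows "definable_pred (\<lambda>e. w e \<in> cube (v e) (u e))"
proof -
  have "w e \<in> cube (v e) (u e) \<longleftrightarrow> (\<forall>i<m. \<bar>w e ! i - v e ! i\<bar> < u e)" for e
    using assms by (simp add: cube_def definable_vec_def)
  then show ?thesis
    by (simp only:) (intro definable_intros definable_term_nth[OF assms(1)] definable_term_nth[OF assms(2)] assms(3); assumption)
qed

lemma definable_pred_continuous_at_point: "definable_op m f \<Longrightarrow> definable_vec m (\<lambda>e. v e) \<Longrightarrow> definable_pred (\<lambda>e. continuous_at_point f (v e))"
proof -
  assume f: "definable_op m f" and v: "definable_vec m v"
  have "definable_pred (\<lambda>e. continuous_at_point f (map e [0..<m]))"
    unfolding continuous_at_point_def length_map length_upt diff_zero
    by (intro definable_intros definable_term_app[OF f] definable_pred_cube[of m]; assumption?)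
  then have "{xs. length xs = m \<and> continuous_at_point f xs} \<in> D m" by (rule definable_pred_Collect)
  from definable_pred_mem[OF this v] show ?thesis using v by (simp add: definable_vec_def)
qed

lemma definable_pred_has_partial_derivative: "definable_op m f \<Longrightarrow> definable_vec m v \<Longrightarrow> definable_term u \<Longrightarrow> j < m \<Longrightarrow> definable_pred (\<lambda>e. has_partial_derivative f j (v e) (u e))"
proof -
  assume f: "definable_op m f" and v: "definable_vec m v" and u: "definable_term u" and j: "j < m"
  have "definable_pred (\<lambda>e. has_partial_derivative f j (butlast (map e [0..<Suc m])) (last (map e [0..<Suc m])))"
    unfolding has_partial_derivative_def using j
    by (simp) (intro definable_intros definable_term_app[OF f]; assumption?)
  then have A: "{xs. length xs = Suc m \<and> has_partial_derivative f j (butlast xs) (last xs)} \<in> D (Suc m)"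
    by (rule definable_pred_Collect)
  from definable_pred_mem[OF this definable_vec_snoc[OF v u]] show ?thesis using v by (simp add: definable_vec_def)
qed

lemma definable_op_partial_derivative: "definable_op m f \<Longrightarrow> j < m \<Longrightarrow> definable_op m (partial_derivative f j)"
  unfolding definable_op_def[of m "partial_derivative f j"]
proof (rule definable_term_graph)
  assume f: "definable_op m f" and j: "j < m"
  show "definable_pred (\<lambda>e. has_partial_derivative f j (map (\<lambda>i. e (Suc i)) [0..<m]) (e 0) \<or>
     (\<not> (\<exists>d. has_partial_derivative f j (map (\<lambda>i. e (Suc i)) [0..<m]) d) \<and> e 0 = 0))"
    by (intro definable_intros definable_pred_has_partial_derivative[OF f _ _ j])
qed (rule partial_derivative_graph)

end

context ominimal_structure
begin

lemma ominimal_predicate: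
  assumes "definable_pred (\<lambda>e. P (e 0))"
  shows "\<exists>I. finite I \<and> (\<forall>J\<in>I. is_interval J) \<and> {t. P t} = \<Union>I"
proof -
  have "{xs. length xs = 1 \<and> P (xs ! 0)} \<in> D 1"
    by (rule definable_pred_Collect) (use assms in simp)
  from ominimal[OF this] show ?thesis by simp
qed

lemma infinite_contains_interval:
  assumes "definable_pred (\<lambda>e. P (e 0))" "infinite {t. P t}"
  obtains u v where "u \<in> \<rat>" "v \<in> \<rat>" "u < v" "\<And>t. u \<le> t \<Longrightarrow> t \<le> v \<Longrightarrow> P t"
proof -
  obtain I where I: "finite I" "\<And>J. J \<in> I \<Longrightarrow> is_interval J" "{t. P t} = \<Union>I"
    using ominimal_predicate[OF assms(1)] by blast
  then obtain J where J: "J \<in> I" "infinite J" using assms(2) by (metis finite_Union)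
  then obtain a where "a \<in> J" by fastforce
  moreover obtain b where "b \<in> J - {a}" using J(2) by (metis all_not_in_conv finite.emptyI finite_Diff_insert infinite_remove)
  ultimately obtain a b where ab: "a \<in> J" "b \<in> J" "a < b"
    by (metis Diff_iff insertI1 linorder_neqE_linordered_idom)
  obtain u where u: "u \<in> \<rat>" "a < u" "u < b" using Rats_dense_in_real[OF ab(3)] by blast
  obtain v where v: "v \<in> \<rat>" "u < v" "v < b" using Rats_dense_in_real[OF u(3)] by blast
  have "P t" if "u \<le> t" "t \<le> v" for t
  proof -
    have "a \<le> t" "t \<le> b" using that u v by auto
    then have "t \<in> J" using I(2)[OF J(1)] ab(1,2) unfolding is_interval_1 by blast
    then show ?thesis using I(3) J(1) by auto
  qed
  then show thesis using u v that by blast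
qed

lemma eventually_right_dichotomy:
  assumes "definable_pred (\<lambda>e. P (e 0))"
  shows "eventually P (at_right t0) \<or> eventually (\<lambda>t. \<not> P t) (at_right t0)"
proof (rule disjCI)
  assume *: "\<not> (\<forall>\<^sub>F t in at_right t0. \<not> P t)"
  obtain I where I: "finite I" "\<And>J. J \<in> I \<Longrightarrow> is_interval J" "{t. P t} = \<Union>I"
    using ominimal_predicate[OF assms] by blast
  have "\<exists>J\<in>I. \<not> (\<forall>\<^sub>F t in at_right t0. t \<notin> J)"
  proof (rule ccontr)
    assume "\<not> ?thesis"
    then have "\<forall>\<^sub>F t in at_right t0. \<forall>J\<in>I. t \<notin> J"
      using I(1) by (intro eventually_ball_finite) auto
    then have "\<forall>\<^sub>F t in at_right t0. \<not> P t"
      by eventually_elim (use I(3) in auto)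
    then show False using * by blast
  qed
  then obtain J where J: "J \<in> I" "\<not> (\<forall>\<^sub>F t in at_right t0. t \<notin> J)" by blast
  have near: "\<exists>t\<in>J. t0 < t \<and> t < s" if "s > t0" for s
    using J(2) that unfolding eventually_at_right_field by blast
  obtain b where b: "b \<in> J" "t0 < b" using near[of "t0 + 1"] by auto
  have "P t" if t: "t0 < t" "t < b" for t
  proof -
    obtain a where "a \<in> J" "t0 < a" "a < t" using near[OF t(1)] by blast
    moreover have "a \<le> t" "t \<le> b" using \<open>a < t\<close> t by auto
    ultimately have "t \<in> J" using I(2)[OF J(1)] b(1) unfolding is_interval_1 by blast
    then show ?thesis using I(3) J(1) by auto
  qed
  then show "\<forall>\<^sub>F t in at_right t0. P t"
    using b unfolding eventually_at_right_field by blast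
qed

lemma fibre_interval:
  assumes A: "A \<in> D (Suc m)" and p: "length p = m" and inf: "infinite {t. p @ [t] \<in> A}"
  obtains u v where "u \<in> \<rat>" "v \<in> \<rat>" "u < v" "\<And>t. u \<le> t \<Longrightarrow> t \<le> v \<Longrightarrow> p @ [t] \<in> A"
proof -
  have "definable_pred (\<lambda>e. p @ [e 0] \<in> A)"
    by (rule definable_pred_mem[OF A]) (intro definable_intros p)
  from infinite_contains_interval[OF this inf] that show thesis by blast
qed

lemma not_small_contains_cube:
  assumes "A \<in> D m" "\<not> small m A"
  obtains p r where "length p = m" "r > 0" "cube p r \<subseteq> A"
proof -
  have "\<exists>p r. length p = m \<and> r > 0 \<and> cube p r \<subseteq> A" using assms
  proof (induction m arbitrary: A)
    case 0
    then show ?case by (auto simp: cube_def intro!: exI[of _ 1])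
  next
    case (Suc m)
    define B where "B = (\<lambda>(u,v). {p. length p = m \<and> (\<forall>t. u \<le> t \<longrightarrow> t \<le> v \<longrightarrow> p @ [t] \<in> A)})"
    have "{p. length p = m \<and> uncountable {t. p @ [t] \<in> A}} \<subseteq> (\<Union>i\<in>{(u,v)\<in>\<rat>\<times>\<rat>. u < v}. B i)"
    proof
      fix p assume "p \<in> {p. length p = m \<and> uncountable {t. p @ [t] \<in> A}}"
      then have p: "length p = m" "infinite {t. p @ [t] \<in> A}"
        using uncountable_infinite by auto
      obtain u v where uv: "u \<in> \<rat>" "v \<in> \<rat>" "u < v" "\<And>t. u \<le> t \<Longrightarrow> t \<le> v \<Longrightarrow> p @ [t] \<in> A"
        using fibre_interval[OF Suc.prems(1) p] by blast
      then have "p \<in> B (u, v)" using p by (simp add: B_def)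
      moreover have "(u, v) \<in> {(u,v)\<in>\<rat>\<times>\<rat>. u < v}" using uv by simp
      ultimately show "p \<in> (\<Union>i\<in>{(u,v)\<in>\<rat>\<times>\<rat>. u < v}. B i)" by blast
    qed
    moreover have "\<not> small m {p. length p = m \<and> uncountable {t. p @ [t] \<in> A}}"
      using Suc.prems(2) by simp
    ultimately obtain u v where uv: "u < v" "\<not> small m (B (u,v))"
      using not_small_rational_cover by blast
    have "B (u,v) \<in> D m"
      unfolding B_def prod.case by (rule definable_pred_Collect) (intro definable_intros definable_pred_mem[OF Suc.prems(1)])
    then obtain p r where p: "length p = m" "r > 0" "cube p r \<subseteq> B (u,v)"
      using Suc.IH uv(2) by blast
    have "cube (p @ [(u + v) / 2]) (min r ((v - u) / 2)) \<subseteq> A"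
    proof
      fix z assume z: "z \<in> cube (p @ [(u + v) / 2]) (min r ((v - u) / 2))"
      then obtain q t where qt: "z = q @ [t]" "length q = m"
        using cube_length[OF z] p(1) by (metis length_Suc_conv_rev length_append_singleton)
      then have "q \<in> cube p (min r ((v - u) / 2))" "\<bar>t - (u + v) / 2\<bar> < min r ((v - u) / 2)"
        using cube_snocD z by blast+
      then have "q \<in> cube p r" "u \<le> t" "t \<le> v"
        using cube_mono[of "min r ((v - u) / 2)" r p] by (auto simp: abs_if field_simps split: if_splits)
      then show "z \<in> A" using p(3) qt by (auto simp: B_def)
    qed
    then show ?case using p uv(1) by (intro exI[of _ "p @ [(u + v) / 2]"] exI[of _ "min r ((v - u) / 2)"]) simp
  qed
  then show thesis using that by blast
qed

lemma definable_cube: "cube p r \<in> D (length p)"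
proof -
  have "{xs. length xs = length p \<and> xs \<in> cube p r} \<in> D (length p)"
    by (rule definable_pred_Collect) (intro definable_pred_cube[of "length p"] definable_intros refl)
  moreover have "{xs. length xs = length p \<and> xs \<in> cube p r} = cube p r"
    by (auto simp: cube_def)
  ultimately show ?thesis by simp
qed

lemma definable_Diff: "A \<in> D m \<Longrightarrow> B \<in> D m \<Longrightarrow> A - B \<in> D m"
proof -
  assume A: "A \<in> D m" and B: "B \<in> D m"
  have "A - B = A \<inter> ({xs. length xs = m} - B)" using carrier[OF A] by auto
  then show ?thesis using definable_Int[OF A compl[OF B]] by simp
qed

lemma generic_cube:
  assumes S: "S \<in> D m" "small m S" and p: "length p = m" "r > 0"
  obtains q s where "length q = m" "s > 0" "cube q s \<subseteq> cube p r" "cube q s \<inter> S = {}"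
proof -
  have "cube p r - S \<in> D m" using definable_Diff definable_cube[of p r] p S by auto
  moreover have "\<not> small m (cube p r - S)" using p S by (intro small_Diff not_small_cube)
  ultimately show thesis using not_small_contains_cube that by blast
qed

lemma small_discontinuities:
  assumes f: "definable_op m f"
  shows "small m {p. length p = m \<and> \<not> continuous_at_point f p}"
proof (rule ccontr)
  assume ns: "\<not> small m {p. length p = m \<and> \<not> continuous_at_point f p}"
  define B where "B = (\<lambda>(u,v). {p. length p = m \<and> (\<forall>r>0. (\<exists>q. length q = m \<and> q \<in> cube p r \<and> f q \<le> u)
      \<and> (\<exists>q. length q = m \<and> q \<in> cube p r \<and> f q \<ge> v))})"
  have "{p. length p = m \<and> \<not> continuous_at_point f p} \<subseteq> (\<Union>i\<in>{(u,v)\<in>\<rat>\<times>\<rat>. u < v}. B i)"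
  proof
    fix p assume "p \<in> {p. length p = m \<and> \<not> continuous_at_point f p}"
    then have p: "length p = m" and "\<not> continuous_at_point f p" by auto
    then obtain \<eta> where \<eta>0: "\<eta> > 0"
      and "\<not> (\<exists>r>0. \<forall>q. length q = m \<longrightarrow> q \<in> cube p r \<longrightarrow> \<bar>f q - f p\<bar> < \<eta>)"
      unfolding continuous_at_point_def by blast
    then have "\<forall>r>0. \<exists>q. length q = m \<and> q \<in> cube p r \<and> \<bar>f q - f p\<bar> \<ge> \<eta>"
      by (meson not_less)
    note \<eta> = \<eta>0 this[rule_format]
    show "p \<in> (\<Union>i\<in>{(u,v)\<in>\<rat>\<times>\<rat>. u < v}. B i)"
    proof (cases "\<forall>r>0. \<exists>q. length q = m \<and> q \<in> cube p r \<and> f q \<ge> f p + \<eta>")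
      case True
      obtain u where u: "u \<in> \<rat>" "f p < u" "u < f p + \<eta>" using Rats_dense_in_real[of "f p" "f p + \<eta>"] \<eta> by auto
      obtain v where v: "v \<in> \<rat>" "u < v" "v < f p + \<eta>" using Rats_dense_in_real[OF u(3)] by blast
      have "\<exists>q. length q = m \<and> q \<in> cube p r \<and> f q \<ge> v" if "r > 0" for r
        using True that v by force
      moreover have "\<exists>q. length q = m \<and> q \<in> cube p r \<and> f q \<le> u" if "r > 0" for r
        using p u cube_self[OF that, of p] by force
      ultimately have "p \<in> B (u,v)"
        unfolding B_def using p by blast
      then show ?thesis using u v by auto
    next
      case False
      then obtain r0 where r0: "r0 > 0" "\<And>q. length q = m \<Longrightarrow> q \<in> cube p r0 \<Longrightarrow> f q < f p + \<eta>"
        by (auto simp: not_le)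
      have low: "\<exists>q. length q = m \<and> q \<in> cube p r \<and> f q \<le> f p - \<eta>" if r: "r > 0" for r
      proof -
        obtain q where q: "length q = m" "q \<in> cube p (min r r0)" "\<bar>f q - f p\<bar> \<ge> \<eta>"
          using \<eta>(2)[of "min r r0"] r r0(1) by auto
        then have "q \<in> cube p r" "q \<in> cube p r0"
          using cube_mono[of "min r r0" r p] cube_mono[of "min r r0" r0 p] by auto
        then show ?thesis using r0(2)[of q] q by (auto intro!: exI[of _ q])
      qed
      obtain u where u: "u \<in> \<rat>" "f p - \<eta> < u" "u < f p" using Rats_dense_in_real[of "f p - \<eta>" "f p"] \<eta> by auto
      obtain v where v: "v \<in> \<rat>" "u < v" "v < f p" using Rats_dense_in_real[OF u(3)] by blast
      have "\<exists>q. length q = m \<and> q \<in> cube p r \<and> f q \<le> u" if "r > 0" for r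
        using low[OF that] u by force
      moreover have "\<exists>q. length q = m \<and> q \<in> cube p r \<and> f q \<ge> v" if "r > 0" for r
        using p v cube_self[OF that, of p] by force
      ultimately have "p \<in> B (u,v)"
        unfolding B_def using p by blast
      then show ?thesis using u v by auto
    qed
  qed
  then obtain u v where uv: "u < v" "\<not> small m (B (u,v))"
    by (rule not_small_rational_cover[OF ns])
  have BD: "B (u,v) \<in> D m"
    unfolding B_def prod.case by (rule definable_pred_Collect) (intro definable_intros definable_pred_cube[of m] definable_term_app[OF f])
  obtain p r where p: "length p = m" "r > 0" "cube p r \<subseteq> B (u,v)"
    using not_small_contains_cube[OF BD uv(2)] by blast
  define C where "C = {q. length q = m \<and> f q \<le> u}"
  have C: "C \<in> D m"
    unfolding C_def by (rule definable_pred_Collect) (intro definable_intros definable_term_app[OF f])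
  have dense: "(\<exists>z\<in>cube q s. f z \<le> u) \<and> (\<exists>z\<in>cube q s. f z \<ge> v)"
    if "length q = m" "s > 0" "cube q s \<subseteq> cube p r" for q s
  proof -
    have "q \<in> B (u,v)" using that p cube_self by blast
    then show ?thesis using that(2) by (auto simp: B_def)
  qed
  show False
  proof (cases "small m (C \<inter> cube p r)")
    case True
    have "C \<inter> cube p r \<in> D m" using definable_Int[OF C] definable_cube[of p r] p by simp
    from generic_cube[OF this True p(1,2)] obtain q s where
      q: "length q = m" "s > 0" "cube q s \<subseteq> cube p r" "cube q s \<inter> (C \<inter> cube p r) = {}" by metis
    then obtain z where "z \<in> cube q s" "f z \<le> u" using dense by blast
    then show False using q cube_length[of z q s] by (auto simp: C_def)
  next
    case False
    have "C \<inter> cube p r \<in> D m" using definable_Int[OF C] definable_cube[of p r] p by simp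
    from not_small_contains_cube[OF this False] obtain q s where
      q: "length q = m" "s > 0" "cube q s \<subseteq> C \<inter> cube p r" by metis
    then obtain z where "z \<in> cube q s" "f z \<ge> v" using dense by blast
    then show False using q uv(1) by (auto simp: C_def)
  qed
qed

end

lemma ereal_limit_of_dichotomy:
  assumes "\<And>c. eventually (\<lambda>s. f s > c) F \<or> eventually (\<lambda>s. \<not> f s > c) F"
  shows "\<exists>l. ((\<lambda>s. ereal (f s)) \<longlongrightarrow> l) F"
proof
  define l where "l = Sup {ereal c |c. eventually (\<lambda>s. f s > c) F}"
  show "((\<lambda>s. ereal (f s)) \<longlongrightarrow> l) F"
  proof (rule order_tendstoI)
    fix a assume "a < l"
    then obtain c where c: "eventually (\<lambda>s. f s > c) F" "a < ereal c"
      by (auto simp: l_def less_Sup_iff)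
    show "eventually (\<lambda>s. a < ereal (f s)) F"
      using c(1) by eventually_elim (use c(2) less_trans ereal_less(2) in force)
  next
    fix a assume "l < a"
    then obtain c where c: "l < ereal c" "ereal c < a" using ereal_dense2 by blast
    have "\<not> eventually (\<lambda>s. f s > c) F"
    proof
      assume "eventually (\<lambda>s. f s > c) F"
      then have "ereal c \<le> l" unfolding l_def by (intro Sup_upper) blast
      then show False using c(1) by simp
    qed
    then have "eventually (\<lambda>s. \<not> f s > c) F" using assms by blast
    then show "eventually (\<lambda>s. ereal (f s) < a) F"
      by eventually_elim (use c(2) in \<open>auto simp: not_less intro: le_less_trans[OF _ c(2)]\<close>)
  qed
qed

lemma eventually_at_right_0: "eventually P (at_right (0::real)) \<longleftrightarrow> (\<exists>a>0. \<forall>x. 0 < x \<and> x < a \<longrightarrow> P x)"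
  by (auto simp: eventually_at_right_field)

lemma eventually_at_right_0_inverse_Suc:
  assumes "eventually P (at_right (0::real))"
  obtains n where "\<And>s. 0 < s \<Longrightarrow> s < 1 / real (Suc n) \<Longrightarrow> P s"
proof -
  obtain a where a: "a > 0" "\<And>x. 0 < x \<Longrightarrow> x < a \<Longrightarrow> P x"
    using assms unfolding eventually_at_right_0 by blast
  obtain n where "1 / real (Suc n) < a"
    using reals_Archimedean[OF a(1)] by (auto simp: inverse_eq_divide)
  then show thesis using a that by (meson less_trans)
qed

context ominimal_structure
begin

lemma finite_corners:
  assumes h: "\<And>u. definable_term u \<Longrightarrow> definable_term (\<lambda>e. h (u e))" and "r > 0"
  shows "finite {t. \<forall>s. 0 < s \<and> s < r \<longrightarrow> h (t + s) - h t > c * s \<and> h t - h (t - s) < c * s}"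
    (is "finite {t. ?P t}")
proof (rule ccontr)
  define P where "P t \<longleftrightarrow> ?P t" for t
  have "definable_pred (\<lambda>e. P (e 0))" unfolding P_def by (intro definable_intros h)
  moreover assume "infinite {t. ?P t}"
  ultimately obtain u v where uv: "u < v" "\<And>t. u \<le> t \<Longrightarrow> t \<le> v \<Longrightarrow> P t"
    using infinite_contains_interval[of P] unfolding P_def[symmetric] by blast
  note uv = uv[unfolded P_def]
  define s where "s = min (v - u) (r / 2)"
  have "0 < s" "s < r" "u + s \<le> v" using uv(1) \<open>r > 0\<close> by (auto simp: s_def)
  then have "h (u + s) - h u > c * s" "h (u + s) - h (u + s - s) < c * s"
    using uv(2)[of u] uv(2)[of "u + s"] uv(1) by auto
  then show False by simp
qed

lemma finite_infinite_slopes: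
  assumes h: "\<And>u. definable_term u \<Longrightarrow> definable_term (\<lambda>e. h (u e))"
  shows "finite {t. \<forall>c. \<exists>r. 0 < r \<and> (\<forall>s. 0 < s \<and> s < r \<longrightarrow> h (t + s) - h t > c * s \<and> h t - h (t - s) > c * s)}"
    (is "finite {t. ?P t}")
proof (rule ccontr)
  define P where "P t \<longleftrightarrow> ?P t" for t
  have "definable_pred (\<lambda>e. P (e 0))" unfolding P_def by (intro definable_intros h)
  moreover assume "infinite {t. ?P t}"
  ultimately obtain u v where uv: "u < v" "\<And>t. u \<le> t \<Longrightarrow> t \<le> v \<Longrightarrow> P t"
    using infinite_contains_interval[of P] unfolding P_def[symmetric] by blast
  note uv = uv[unfolded P_def]
  define c where "c = (h v - h u) / (v - u) + 1"
  have "u \<le> v" using uv by simp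
  then have "h v - h u \<ge> c * (v - u)"
  proof (induction rule: Bolzano)
    case (trans x y z)
    then show ?case by (simp add: algebra_simps)
  next
    case (local t)
    obtain r where r: "r > 0" "\<And>s. 0 < s \<Longrightarrow> s < r \<Longrightarrow> h (t + s) - h t > c * s \<and> h t - h (t - s) > c * s"
      using uv(2)[of t] local by blast
    have *: "h z - h t \<ge> c * (z - t)" if "t \<le> z" "z < t + r" for z
      using r(2)[of "z - t"] that by (cases "t = z") auto
    have **: "h t - h z \<ge> c * (t - z)" if "z \<le> t" "t - r < z" for z
      using r(2)[of "t - z"] that by (cases "t = z") auto
    have "h y - h x \<ge> c * (y - x)" if "x \<le> t \<and> t \<le> y \<and> y - x < r" for x y
      using *[of y] **[of x] that by (simp add: algebra_simps)
    then show ?case using r(1) by blast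
  qed
  also have "c * (v - u) = h v - h u + (v - u)"
    using uv(1) by (simp add: c_def field_simps)
  finally show False using uv(1) by simp
qed

lemma differentiable_somewhere:
  assumes h: "\<And>u. definable_term u \<Longrightarrow> definable_term (\<lambda>e. h (u e))" and "a < b"
  shows "\<exists>t d. a < t \<and> t < b \<and> (h has_real_derivative d) (at t)"
proof (rule ccontr)
  assume nd: "\<not> ?thesis"
  define k where "k x = - h x" for x
  have k: "definable_term u \<Longrightarrow> definable_term (\<lambda>e. k (u e))" for u unfolding k_def by (intro definable_intros h)
  define M where "M h = (\<lambda>(q, n). {t. \<forall>s. 0 < s \<and> s < 1 / real (Suc n) \<longrightarrow>
    h (t + s) - h t > real_of_rat q * s \<and> h t - h (t - s) < real_of_rat q * s})" for h
  define X where "X h = {t. \<forall>c. \<exists>r. 0 < r \<and> (\<forall>s. 0 < s \<and> s < r \<longrightarrow>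
    h (t + s) - h t > c * s \<and> h t - h (t - s) > c * s)}" for h :: "real \<Rightarrow> real"
  have "{a<..<b} \<subseteq> (\<Union>i\<in>UNIV. M h i) \<union> (\<Union>i\<in>UNIV. M k i) \<union> X h \<union> X k"
  proof
    fix t assume t: "t \<in> {a<..<b}"
    define R where "R s = (h (t + s) - h t) / s" for s
    define L where "L s = (h t - h (t - s)) / s" for s
    have "\<exists>l. ((\<lambda>s. ereal (R s)) \<longlongrightarrow> l) (at_right 0)"
      unfolding R_def by (intro ereal_limit_of_dichotomy eventually_right_dichotomy) (intro definable_intros h)
    then obtain l1 where l1: "((\<lambda>s. ereal (R s)) \<longlongrightarrow> l1) (at_right 0)" ..
    have "\<exists>l. ((\<lambda>s. ereal (L s)) \<longlongrightarrow> l) (at_right 0)"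
      unfolding L_def by (intro ereal_limit_of_dichotomy eventually_right_dichotomy) (intro definable_intros h)
    then obtain l2 where l2: "((\<lambda>s. ereal (L s)) \<longlongrightarrow> l2) (at_right 0)" ..
    consider "l2 < l1" | "l1 < l2" | "l1 = l2" by force
    then show "t \<in> (\<Union>i\<in>UNIV. M h i) \<union> (\<Union>i\<in>UNIV. M k i) \<union> X h \<union> X k"
    proof cases
      case 1
      then obtain q :: rat where q: "l2 < real_of_rat q" "real_of_rat q < l1" using ereal_dense3 by blast
      have "\<forall>\<^sub>0 s. L s < real_of_rat q \<and> R s > real_of_rat q"
        using order_tendstoD(2)[OF l2 q(1)] order_tendstoD(1)[OF l1 q(2)] by eventually_elim simp
      then obtain n where n: "\<And>s. 0 < s \<Longrightarrow> s < 1 / real (Suc n) \<Longrightarrow> L s < real_of_rat q \<and> R s > real_of_rat q"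
        using eventually_at_right_0_inverse_Suc by blast
      have "t \<in> M h (q, n)"
        unfolding M_def using n by (auto simp: L_def R_def field_simps)
      then show ?thesis by blast
    next
      case 2
      then obtain q :: rat where q: "l1 < real_of_rat q" "real_of_rat q < l2" using ereal_dense3 by blast
      have "\<forall>\<^sub>0 s. R s < real_of_rat q \<and> L s > real_of_rat q"
        using order_tendstoD(2)[OF l1 q(1)] order_tendstoD(1)[OF l2 q(2)] by eventually_elim simp
      then obtain n where n: "\<And>s. 0 < s \<Longrightarrow> s < 1 / real (Suc n) \<Longrightarrow> R s < real_of_rat q \<and> L s > real_of_rat q"
        using eventually_at_right_0_inverse_Suc by blast
      have "t \<in> M k (- q, n)"
        unfolding M_def using n by (auto simp: L_def R_def k_def of_rat_minus field_simps)
      then show ?thesis by blast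
    next
      case 3
      show ?thesis
      proof (cases l1)
        case (real d)
        have "l2 = ereal d" using 3 real by simp
        then have "(R \<longlongrightarrow> d) (at_right 0)" "(L \<longlongrightarrow> d) (at_right 0)"
          using l1 l2 real by simp_all
        moreover have "L = (\<lambda>s. R (- s))" by (auto simp: L_def R_def divide_simps)
        ultimately have "(R \<longlongrightarrow> d) (at 0)"
          by (simp add: filterlim_split_at filterlim_at_left_to_right)
        then have "(h has_real_derivative d) (at t)"
          unfolding DERIV_def R_def[abs_def] .
        then show ?thesis using nd t by auto
      next
        case PInf
        have "t \<in> X h" unfolding X_def
        proof (clarify)
          fix c
          have "\<forall>\<^sub>0 s. R s > c \<and> L s > c"
            using order_tendstoD(1)[OF l1, of c] order_tendstoD(1)[OF l2, of c] 3 PInf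
            by (auto elim: eventually_elim2)
          then show "\<exists>r. 0 < r \<and> (\<forall>s. 0 < s \<and> s < r \<longrightarrow> h (t + s) - h t > c * s \<and> h t - h (t - s) > c * s)"
            unfolding eventually_at_right_0 by (auto simp: L_def R_def field_simps)
        qed
        then show ?thesis by blast
      next
        case MInf
        have "t \<in> X k" unfolding X_def
        proof (clarify)
          fix c
          have "\<forall>\<^sub>0 s. R s < - c \<and> L s < - c"
            using order_tendstoD(2)[OF l1, of "-c"] order_tendstoD(2)[OF l2, of "-c"] 3 MInf
            by (auto elim: eventually_elim2)
          then show "\<exists>r. 0 < r \<and> (\<forall>s. 0 < s \<and> s < r \<longrightarrow> k (t + s) - k t > c * s \<and> k t - k (t - s) > c * s)"
            unfolding eventually_at_right_0 by (auto simp: L_def R_def k_def field_simps)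
        qed
        then show ?thesis by blast
      qed
    qed
  qed
  moreover have "countable ((\<Union>i\<in>UNIV. M h i) \<union> (\<Union>i\<in>UNIV. M k i) \<union> X h \<union> X k)"
  proof -
    have "finite (M h i)" for i
      unfolding M_def by (cases i) (simp only: prod.case, rule finite_corners, erule h, simp)
    moreover have "finite (M k i)" for i
      unfolding M_def by (cases i) (simp only: prod.case, rule finite_corners, erule k, simp)
    moreover have "finite (X h)"
      unfolding X_def by (rule finite_infinite_slopes) (erule h)
    moreover have "finite (X k)"
      unfolding X_def by (rule finite_infinite_slopes) (erule k)
    ultimately show ?thesis by (intro countable_Un countable_UN countableI_type) (auto intro: countable_finite)
  qed
  ultimately show False
    using countable_subset uncountable_open_interval[of a b] \<open>a < b\<close> by blast
qed

lemma small_no_has_partial_derivative: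
  assumes f: "definable_op m f" and j: "j < m"
  shows "{p. length p = m \<and> \<not> (\<exists>d. has_partial_derivative f j p d)} \<in> D m"
    and "small m {p. length p = m \<and> \<not> (\<exists>d. has_partial_derivative f j p d)}"
proof -
  show def: "{p. length p = m \<and> \<not> (\<exists>d. has_partial_derivative f j p d)} \<in> D m"
    by (rule definable_pred_Collect) (intro definable_intros definable_pred_has_partial_derivative[OF f _ _ j])
  show "small m {p. length p = m \<and> \<not> (\<exists>d. has_partial_derivative f j p d)}"
  proof (rule ccontr)
    assume "\<not> ?thesis"
    then obtain p r where p: "length p = m" "r > 0" "cube p r \<subseteq> {p. length p = m \<and> \<not> (\<exists>d. has_partial_derivative f j p d)}"
      using not_small_contains_cube[OF def] by blast
    have "definable_term u \<Longrightarrow> definable_term (\<lambda>e. f (p[j := u e]))" for u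
      by (intro definable_term_app[OF f] definable_intros p(1))
    then obtain t d where t: "p ! j - r < t" "t < p ! j + r"
      and d: "((\<lambda>t. f (p[j := t])) has_real_derivative d) (at t)"
      using differentiable_somewhere[of "\<lambda>t. f (p[j := t])" "p ! j - r" "p ! j + r"] p(2) by auto
    have "has_partial_derivative f j (p[j := t]) d"
      unfolding has_partial_derivative_iff using d j p by simp
    moreover have "p[j := t] \<in> cube p r"
      using t p j by (auto simp: cube_def nth_list_update abs_if)
    ultimately show False using p(3) by blast
  qed
qed

lemma definable_not_C1_at:
  assumes f: "definable_op m f"
  shows "{p. length p = m \<and> \<not> C1_at f p} \<in> D m"
proof -
  have "{p. length p = m \<and> \<not> ((\<exists>r>0. \<forall>q. length q = m \<longrightarrow> q \<in> cube p r \<longrightarrow> (\<forall>j<m. \<exists>d. has_partial_derivative f j q d)) \<and>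
     (\<forall>j<m. continuous_at_point (partial_derivative f j) p))} \<in> D m"
    by (rule definable_pred_Collect) (intro definable_intros definable_pred_cube[of m] definable_pred_has_partial_derivative[OF f] definable_pred_continuous_at_point[OF definable_op_partial_derivative[OF f]]; assumption)
  also have "{p. length p = m \<and> \<not> ((\<exists>r>0. \<forall>q. length q = m \<longrightarrow> q \<in> cube p r \<longrightarrow> (\<forall>j<m. \<exists>d. has_partial_derivative f j q d)) \<and>
     (\<forall>j<m. continuous_at_point (partial_derivative f j) p))} = {p. length p = m \<and> \<not> C1_at f p}"
    unfolding C1_at_def by (intro Collect_cong conj_cong refl) auto
  finally show ?thesis .
qed

lemma small_not_C1_at:
  assumes f: "definable_op m f"
  shows "small m {p. length p = m \<and> \<not> C1_at f p}"
proof (rule ccontr)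
  assume "\<not> ?thesis"
  then obtain p r where p: "length p = m" "r > 0" "cube p r \<subseteq> {p. length p = m \<and> \<not> C1_at f p}"
    using not_small_contains_cube[OF definable_not_C1_at[OF f]] by blast
  define S where "S = {p. length p = m \<and> (\<exists>j<m. \<not> (\<exists>d. has_partial_derivative f j p d) \<or> \<not> continuous_at_point (partial_derivative f j) p)}"
  have "S \<in> D m" unfolding S_def
    by (rule definable_pred_Collect) (intro definable_intros definable_pred_has_partial_derivative[OF f] definable_pred_continuous_at_point[OF definable_op_partial_derivative[OF f]]; assumption)
  moreover have "small m S"
  proof -
    have "S = (\<Union>j\<in>{..<m}. {p. length p = m \<and> \<not> (\<exists>d. has_partial_derivative f j p d)} \<union> {p. length p = m \<and> \<not> continuous_at_point (partial_derivative f j) p})"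
      by (auto simp: S_def)
    also have "small m \<dots>"
      by (intro small_UN small_Un small_no_has_partial_derivative(2)[OF f] small_discontinuities definable_op_partial_derivative[OF f]) auto
    finally show ?thesis .
  qed
  ultimately obtain q s where q: "length q = m" "s > 0" "cube q s \<subseteq> cube p r" "cube q s \<inter> S = {}"
    using generic_cube p(1,2) by metis
  have "C1_at f q"
    unfolding C1_at_def
  proof (intro conjI)
    have "\<forall>z. length z = length q \<longrightarrow> z \<in> cube q s \<longrightarrow> (\<forall>j<length q. \<exists>d. has_partial_derivative f j z d)"
    proof (intro allI impI)
      fix z j assume z: "length z = length q" "z \<in> cube q s" "j < length q"
      then have "z \<notin> S" using q(4) by blast
      then show "\<exists>d. has_partial_derivative f j z d" using z q(1) by (simp add: S_def)
    qed
    then show "\<exists>r>0. \<forall>z. length z = length q \<longrightarrow> z \<in> cube q r \<longrightarrow> (\<forall>j<length q. \<exists>d. has_partial_derivative f j z d)"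
      using q(2) by blast
    have "q \<notin> S" using cube_self[OF q(2)] q(4) by blast
    then show "\<forall>j<length q. continuous_at_point (partial_derivative f j) q"
      using q(1) by (auto simp: S_def)
  qed
  then show False using p(3) q(3) cube_self[OF q(2), of q] by blast
qed

end

section \<open>Definable functions along a curve\<close>

lemma eventually_at_right_nhds:
  assumes "\<forall>\<^sub>0 x. P x"
  shows "\<forall>\<^sub>0 x. \<forall>\<^sub>F y in nhds x. P y"
proof -
  obtain a where a: "a > 0" "\<And>x. 0 < x \<Longrightarrow> x < a \<Longrightarrow> P x"
    using assms unfolding eventually_at_right_0 by blast
  have "\<forall>\<^sub>F y in nhds x. P y" if "0 < x" "x < a" for x
    using eventually_nhds_in_open[of "{0<..<a}" x] that a(2) by (auto elim: eventually_mono)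
  then show ?thesis using a(1) unfolding eventually_at_right_0 by blast
qed

lemma eventually_all_less:
  fixes n :: nat
  assumes "\<And>i. i < n \<Longrightarrow> eventually (P i) F"
  shows "eventually (\<lambda>x. \<forall>i<n. P i x) F"
proof -
  have "eventually (\<lambda>x. \<forall>i\<in>{..<n}. P i x) F"
    using assms by (intro eventually_ball_finite) auto
  then show ?thesis by eventually_elim simp
qed

lemma constant_if_locally_constant:
  assumes "connected S" and "\<And>x. x \<in> S \<Longrightarrow> \<forall>\<^sub>F y in nhds x. N y = N x"
  shows "\<exists>n. \<forall>x\<in>S. N x = n"
proof -
  have "N constant_on S"
  proof (rule locally_constant_imp_constant[OF assms(1)])
    fix x assume x: "x \<in> S"
    then obtain T where T: "open T" "x \<in> T" "\<forall>y\<in>T. N y = N x"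
      using assms(2) unfolding eventually_nhds by blast
    then show "\<exists>T. openin (top_of_set S) T \<and> x \<in> T \<and> (\<forall>y\<in>T. N y = N x)"
      using openin_open_Int[OF T(1), of S] x T(2,3) by blast
  qed
  then show ?thesis by (auto simp: constant_on_def)
qed

lemma card_eq_if_matching:
  assumes "\<And>a. a \<in> A \<Longrightarrow> \<exists>!b. b \<in> B \<and> R a b" "\<And>b. b \<in> B \<Longrightarrow> \<exists>!a. a \<in> A \<and> R a b"
  shows "card A = card B"
proof -
  define h where "h a = (THE b. b \<in> B \<and> R a b)" for a
  have h: "h a \<in> B \<and> R a (h a)" if "a \<in> A" for a
    unfolding h_def using theI'[OF assms(1)[OF that]] .
  have "bij_betw h A B"
  proof (rule bij_betw_imageI)
    show "inj_on h A" using h assms(2) by (intro inj_onI) metis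
    show "h ` A = B"
    proof
      show "B \<subseteq> h ` A"
      proof
        fix b assume b: "b \<in> B"
        then obtain a where "a \<in> A" "R a b" using assms(2) by blast
        moreover then have "h a = b" using h[of a] assms(1)[of a] b by blast
        ultimately show "b \<in> h ` A" by blast
      qed
    qed (use h in auto)
  qed
  then show ?thesis by (rule bij_betw_same_card)
qed

context real_field_structure
begin

text \<open>Model-theoretically, the germ of \<open>c\<close> is a complete type over the structure, and independence means
  that no coordinate is in the definable closure of the preceding ones.\<close>

definition complete_germ :: "nat \<Rightarrow> (real \<Rightarrow> real list) \<Rightarrow> bool" where
  "complete_germ m c \<longleftrightarrow> (\<forall>x. length (c x) = m) \<and>
     (\<forall>A\<in>D m. (\<forall>\<^sub>0 x. c x \<in> A) \<or> (\<forall>\<^sub>0 x. c x \<notin> A))"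

definition independent_germ :: "nat \<Rightarrow> (real \<Rightarrow> real list) \<Rightarrow> bool" where
  "independent_germ m c \<longleftrightarrow> (\<forall>i<m. \<not> (\<exists>g. definable_op i g \<and> (\<forall>\<^sub>0 x. c x ! i = g (take i (c x)))))"

definition eventually_continuous :: "nat \<Rightarrow> (real \<Rightarrow> real list) \<Rightarrow> bool" where
  "eventually_continuous m c \<longleftrightarrow> (\<forall>j<m. \<forall>\<^sub>0 x. isCont (\<lambda>x. c x ! j) x)"

lemma complete_germ_length: "complete_germ m c \<Longrightarrow> length (c x) = m"
  by (simp add: complete_germ_def)

lemma complete_germD: "complete_germ m c \<Longrightarrow> A \<in> D m \<Longrightarrow>
    (\<forall>\<^sub>0 x. c x \<in> A) \<or> (\<forall>\<^sub>0 x. c x \<notin> A)"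
  by (simp add: complete_germ_def)

lemma complete_germ_predicate:
  assumes c: "complete_germ m c" and "definable_pred (\<lambda>e. P (map e [0..<m]))"
  shows "(\<forall>\<^sub>0 x. P (c x)) \<or> (\<forall>\<^sub>0 x. \<not> P (c x))"
  using complete_germD[OF c definable_pred_Collect[OF assms(2)]] complete_germ_length[OF c] by simp

lemma complete_germ_map:
  assumes c: "complete_germ m c" and G: "definable_vec n (\<lambda>e. G (map e [0..<m]))"
    and len: "\<And>x. length (c' x) = n" and eq: "\<forall>\<^sub>0 x. c' x = G (c x)"
  shows "complete_germ n c'"
  unfolding complete_germ_def
proof (intro conjI allI ballI len)
  fix A assume A: "A \<in> D n"
  from complete_germ_predicate[OF c definable_pred_mem[OF A G]]
  show "(\<forall>\<^sub>0 x. c' x \<in> A) \<or> (\<forall>\<^sub>0 x. c' x \<notin> A)"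
  proof
    assume "\<forall>\<^sub>0 x. G (c x) \<in> A"
    then have "\<forall>\<^sub>0 x. c' x \<in> A" using eq by eventually_elim simp
    then show ?thesis ..
  next
    assume "\<forall>\<^sub>0 x. G (c x) \<notin> A"
    then have "\<forall>\<^sub>0 x. c' x \<notin> A" using eq by eventually_elim simp
    then show ?thesis ..
  qed
qed

lemma complete_germ_image:
  assumes c: "complete_germ m c" and g: "\<And>j. j < n \<Longrightarrow> definable_op m (g j)"
    and len: "\<And>x. length (c' x) = n" and eq: "\<And>j. j < n \<Longrightarrow> \<forall>\<^sub>0 x. c' x ! j = g j (c x)"
  shows "complete_germ n c'"
proof (rule complete_germ_map[OF c _ len])
  show "definable_vec n (\<lambda>e. (\<lambda>p. map (\<lambda>j. g j p) [0..<n]) (map e [0..<m]))"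
    using g by (auto simp: definable_op_def intro!: definable_vec_map)
  have "\<forall>\<^sub>0 x. \<forall>j<n. c' x ! j = g j (c x)"
    by (intro eventually_all_less eq)
  then show "\<forall>\<^sub>0 x. c' x = (\<lambda>p. map (\<lambda>j. g j p) [0..<n]) (c x)"
    by eventually_elim (auto intro!: nth_equalityI simp: len)
qed

lemma definable_op_nth: "i < m \<Longrightarrow> definable_op m (\<lambda>p. p ! i)"
  unfolding definable_op_def by (intro definable_term_nth_map definable_term_var)

lemma definable_op_comp:
  assumes "definable_op k f" "\<And>j. j < k \<Longrightarrow> definable_op m (g j)"
  shows "definable_op m (\<lambda>p. f (map (\<lambda>j. g j p) [0..<k]))"
  unfolding definable_op_def by (rule definable_term_app[OF assms(1)]) (intro definable_vec_map assms(2)[unfolded definable_op_def])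

lemma definable_op_map_nth:
  assumes "definable_op (length ks) f" "set ks \<subseteq> {..<m}"
  shows "definable_op m (\<lambda>p. f (map ((!) p) ks))"
proof -
  have "definable_op m (\<lambda>p. f (map (\<lambda>j. p ! (ks ! j)) [0..<length ks]))"
    using assms by (intro definable_op_comp definable_op_nth) (auto simp: subset_iff)
  moreover have "map (\<lambda>j. p ! (ks ! j)) [0..<length ks] = map ((!) p) ks" for p :: "real list"
    by (intro nth_equalityI) auto
  ultimately show ?thesis by (simp only:)
qed

lemma definable_op_take:
  assumes "definable_op k f" "k \<le> m"
  shows "definable_op m (\<lambda>p. f (take k p))"
proof -
  have "definable_op m (\<lambda>p. f (map (\<lambda>j. p ! j) [0..<k]))"
    using assms by (intro definable_op_comp definable_op_nth) auto
  moreover have "map (\<lambda>j. map e [0..<m] ! j) [0..<k] = take k (map e [0..<m])" for e :: "nat \<Rightarrow> real"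
    using assms(2) by (intro nth_equalityI) auto
  ultimately show ?thesis by (simp add: definable_op_def)
qed

lemma complete_germ_take:
  assumes c: "complete_germ m c" and "k \<le> m"
  shows "complete_germ k (\<lambda>x. take k (c x))"
  by (rule complete_germ_image[OF c, of k "\<lambda>j p. p ! j"]) (use assms complete_germ_length[OF c] in \<open>auto intro: definable_op_nth\<close>)

end

context ominimal_structure
begin

lemma uniform_finiteness_generic:
  assumes b: "complete_germ m b" and cont: "eventually_continuous m b"
    and gen: "\<And>A. A \<in> D m \<Longrightarrow> small m A \<Longrightarrow> \<forall>\<^sub>0 x. b x \<notin> A"
    and Y: "Y \<in> D (Suc m)" and fin: "\<And>p. length p = m \<Longrightarrow> finite {t. p @ [t] \<in> Y}"
  shows "\<exists>(n::nat) f. (\<forall>i<n. definable_op m (f i)) \<and> (\<forall>\<^sub>0 x.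
     (\<forall>i<n. \<forall>j<n. i < j \<longrightarrow> f i (b x) < f j (b x)) \<and> {t. b x @ [t] \<in> Y} = (\<lambda>i. f i (b x)) ` {..<n})"
proof -
  define E where "E n p q \<longleftrightarrow> (\<forall>i<n. \<forall>j<n. i < j \<longrightarrow> q ! i < q ! j) \<and>
     (\<forall>t. p @ [t] \<in> Y \<longleftrightarrow> (\<exists>i<n. t = q ! i))" for n p q
  define F where "F n i p = (if card {t. p @ [t] \<in> Y} = n then sorted_list_of_set {t. p @ [t] \<in> Y} ! i else 0)" for n i p
  have E_iff: "length q = n \<and> E n p q \<longleftrightarrow> card {t. p @ [t] \<in> Y} = n \<and> q = sorted_list_of_set {t. p @ [t] \<in> Y}"
    if p: "length p = m" for n p q
  proof -
    have "(\<forall>t. p @ [t] \<in> Y \<longleftrightarrow> (\<exists>i<length q. t = q ! i)) \<longleftrightarrow> set q = {t. p @ [t] \<in> Y}"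
      unfolding set_eq_iff in_set_conv_nth mem_Collect_eq by metis
    moreover have "(\<forall>i<length q. \<forall>j<length q. i < j \<longrightarrow> q ! i < q ! j) \<longleftrightarrow> sorted_wrt (<) q"
      unfolding sorted_wrt_iff_nth_less by auto
    ultimately have "length q = n \<and> E n p q \<longleftrightarrow> length q = n \<and> sorted_wrt (<) q \<and> set q = {t. p @ [t] \<in> Y}"
      unfolding E_def by blast
    also have "\<dots> \<longleftrightarrow> card {t. p @ [t] \<in> Y} = n \<and> q = sorted_list_of_set {t. p @ [t] \<in> Y}"
      using fin[OF p] by (metis distinct_card sorted_list_of_set.length_sorted_key_list_of_set
        sorted_list_of_set.sorted_key_list_of_set_unique strict_sorted_iff list.map_id0 id_apply map_idI)
    finally show ?thesis .
  qed
  have dE: "definable_pred (\<lambda>e. E n (v e) (w e))" if "definable_vec m v" "definable_vec n w" for n v w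
    unfolding E_def
    by (intro definable_intros definable_pred_mem[OF Y] definable_vec_shift[OF that(1)] definable_term_nth[OF definable_vec_shift[OF that(2)]] definable_term_nth[OF that(2)])
  have definable_op: "definable_op m (F n i)" if "i < n" for n i
    unfolding definable_op_def
  proof (rule definable_term_graph)
    show "definable_pred (\<lambda>e. (\<exists>q. length q = n \<and> (E n (map (\<lambda>i. e (Suc i)) [0..<m]) q \<and> e 0 = q ! i)) \<or>
      (\<not> (\<exists>q. length q = n \<and> E n (map (\<lambda>i. e (Suc i)) [0..<m]) q) \<and> e 0 = 0))"
      using that by (intro definable_intros dE)
    show "(t = F n i (map e [0..<m])) \<longleftrightarrow> (\<exists>q. length q = n \<and> (E n (map e [0..<m]) q \<and> t = q ! i)) \<or>
      (\<not> (\<exists>q. length q = n \<and> E n (map e [0..<m]) q) \<and> t = 0)" for e t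
      unfolding conj_assoc[symmetric] F_def by (subst (1 2) E_iff) auto
  qed
  have F: "(\<forall>i<n. \<forall>j<n. i < j \<longrightarrow> F n i p < F n j p)" "{t. p @ [t] \<in> Y} = (\<lambda>i. F n i p) ` {..<n}"
    if p: "length p = m" and n: "card {t. p @ [t] \<in> Y} = n" for n p
  proof -
    define L where "L = sorted_list_of_set {t. p @ [t] \<in> Y}"
    have "E n p L" unfolding L_def using E_iff[OF p] n by blast
    then have L: "\<forall>i<n. \<forall>j<n. i < j \<longrightarrow> L ! i < L ! j" "\<And>t. p @ [t] \<in> Y \<longleftrightarrow> (\<exists>i<n. t = L ! i)"
      unfolding E_def by blast+
    have FL: "F n i p = L ! i" for i
      using n by (simp add: F_def L_def)
    show "\<forall>i<n. \<forall>j<n. i < j \<longrightarrow> F n i p < F n j p"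
      using L(1) by (simp only: FL)
    show "{t. p @ [t] \<in> Y} = (\<lambda>i. F n i p) ` {..<n}"
      unfolding FL L(2) by auto
  qed
  (* A first-order condition forcing the fibres over p and q to have equally many points. *)
  define matched where "matched p q r \<longleftrightarrow>
     (\<forall>t. p @ [t] \<in> Y \<longrightarrow> (\<exists>s. (q @ [s] \<in> Y \<and> \<bar>t - s\<bar> < r) \<and> (\<forall>s'. q @ [s'] \<in> Y \<and> \<bar>t - s'\<bar> < r \<longrightarrow> s' = s))) \<and>
     (\<forall>t. q @ [t] \<in> Y \<longrightarrow> (\<exists>s. (p @ [s] \<in> Y \<and> \<bar>s - t\<bar> < r) \<and> (\<forall>s'. p @ [s'] \<in> Y \<and> \<bar>s' - t\<bar> < r \<longrightarrow> s' = s)))"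
    for p q r
  define bad where "bad = {p. length p = m \<and> \<not> (\<exists>r>0. \<exists>s>0. \<forall>q. length q = m \<longrightarrow> q \<in> cube p s \<longrightarrow> matched p q r)}"
  have card_matched: "card {t. q @ [t] \<in> Y} = card {t. p @ [t] \<in> Y}" if "matched p q r" for p q r
    by (rule card_eq_if_matching[of _ _ "\<lambda>t s. \<bar>s - t\<bar> < r"])
      (use that in \<open>auto simp: matched_def Ex1_def\<close>)
  have "bad \<in> D m"
    unfolding bad_def matched_def
    by (rule definable_pred_Collect) (intro definable_intros definable_pred_cube[of m] definable_pred_mem[OF Y])
  moreover have "small m bad"
  proof (rule ccontr)
    assume "\<not> small m bad"
    then obtain p r where p: "length p = m" "r > 0" "cube p r \<subseteq> bad"
      using not_small_contains_cube \<open>bad \<in> D m\<close> by blast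
    define N where "N n = {p. length p = m \<and> (\<exists>q. length q = n \<and> E n p q)}" for n
    have ND: "N n \<in> D m" for n
      unfolding N_def by (rule definable_pred_Collect) (intro definable_intros dE)
    have N: "q \<in> N n \<longleftrightarrow> length q = m \<and> card {t. q @ [t] \<in> Y} = n" for n q
      unfolding N_def using E_iff[of q] by blast
    have "cube p r \<subseteq> (\<Union>n\<in>UNIV. cube p r \<inter> N n)"
      using p(1) by (auto simp: N cube_length)
    then have "\<exists>n. \<not> small m (cube p r \<inter> N n)"
      using small_UN[of UNIV m "\<lambda>n. cube p r \<inter> N n"] not_small_cube[OF p(2,1)] small_mono by blast
    then obtain n where "\<not> small m (cube p r \<inter> N n)" ..
    moreover have "cube p r \<inter> N n \<in> D m"
      using definable_Int[OF _ ND] definable_cube[of p r] p(1) by simp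
    ultimately obtain p1 r1 where p1: "length p1 = m" "r1 > 0" "cube p1 r1 \<subseteq> cube p r \<inter> N n"
      using not_small_contains_cube by blast
    define S where "S = {p. length p = m \<and> (\<exists>i<n. \<not> continuous_at_point (F n i) p)}"
    have "S = (\<Union>i\<in>{..<n}. {p. length p = m \<and> \<not> continuous_at_point (F n i) p})"
      by (auto simp: S_def)
    moreover have "small m \<dots>"
      by (intro small_UN small_discontinuities definable_op) auto
    ultimately have "small m S" by simp
    then have "\<not> cube p1 r1 \<subseteq> S"
      using not_small_cube[OF p1(2,1)] small_mono by blast
    then obtain z where z: "z \<in> cube p1 r1" "z \<notin> S" by blast
    then have zl: "length z = m" using p1(1) cube_length by blast
    obtain r2 where r2: "r2 > 0" "cube z r2 \<subseteq> cube p1 r1" using cube_open[OF z(1)] by blast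
    have card: "card {t. q @ [t] \<in> Y} = n" if "q \<in> cube z r2" for q
      using that r2 p1(3) N by blast
    define Z where "Z = {t. z @ [t] \<in> Y}"
    have Zeq: "Z = (\<lambda>i. F n i z) ` {..<n}"
      unfolding Z_def using F(2)[OF zl card] cube_self[OF r2(1)] by blast
    obtain g where g: "g > 0" "\<And>i j. i < n \<Longrightarrow> j < n \<Longrightarrow> i < j \<Longrightarrow> F n j z - F n i z \<ge> g"
    proof -
      define G where "G = insert 1 ((\<lambda>(i,j). F n j z - F n i z) ` {(i,j). i < n \<and> j < n \<and> i < j})"
      have "finite {(i,j). i < n \<and> j < n \<and> i < (j::nat)}"
        by (rule finite_subset[of _ "{..<n} \<times> {..<n}"]) auto
      then have fG: "finite G" "G \<noteq> {}" by (auto simp: G_def)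
      moreover have "\<forall>d\<in>G. d > 0"
        using F(1)[OF zl card] cube_self[OF r2(1)] by (auto simp: G_def)
      ultimately have "Min G > 0" by simp
      moreover have "F n j z - F n i z \<ge> Min G" if "i < n" "j < n" "i < j" for i j
        using fG that by (intro Min_le) (auto simp: G_def)
      ultimately show thesis using that by blast
    qed
    define \<rho> where "\<rho> = min (g / 4) r2"
    have \<rho>: "\<rho> > 0" "\<rho> \<le> g / 4" "\<rho> \<le> r2" using g(1) r2(1) by (auto simp: \<rho>_def)
    have "\<exists>s>0. \<forall>q. length q = m \<longrightarrow> q \<in> cube z s \<longrightarrow> \<bar>F n i q - F n i z\<bar> < \<rho>" if "i < n" for i
      using z(2) zl that \<rho>(1) unfolding S_def continuous_at_point_def by blast
    then obtain s where s: "\<And>i. i < n \<Longrightarrow> s i > 0"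
      "\<And>i q. i < n \<Longrightarrow> length q = m \<Longrightarrow> q \<in> cube z (s i) \<Longrightarrow> \<bar>F n i q - F n i z\<bar> < \<rho>"
      by metis
    define \<sigma> where "\<sigma> = Min (insert \<rho> (s ` {..<n}))"
    have \<sigma>: "\<sigma> > 0" "\<sigma> \<le> \<rho>" "\<And>i. i < n \<Longrightarrow> \<sigma> \<le> s i"
      unfolding \<sigma>_def using s(1) \<rho>(1) by auto
    have idx: "i = j" if "i < n" "j < n" "\<bar>F n i z - F n j z\<bar> < 2 * \<rho>" for i j
      using g(2)[of i j] g(2)[of j i] that \<rho>(2) g(1) by (cases i j rule: linorder_cases) auto
    have "matched z q \<rho>" if q: "length q = m" "q \<in> cube z \<sigma>" for q
    proof -
      have "q \<in> cube z r2" using q(2) cube_mono[of \<sigma> r2 z] \<sigma>(2) \<rho>(3) by auto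
      then have Yq: "{t. q @ [t] \<in> Y} = (\<lambda>i. F n i q) ` {..<n}"
        using F(2)[OF q(1) card] by blast
      have d: "\<bar>F n i q - F n i z\<bar> < \<rho>" if "i < n" for i
        using s(2)[OF that q(1)] q(2) cube_mono[OF \<sigma>(3)[OF that], of z] by blast
      have mq: "q @ [t] \<in> Y \<longleftrightarrow> (\<exists>i<n. t = F n i q)" for t using Yq by (auto simp: set_eq_iff)
      have mz: "z @ [t] \<in> Y \<longleftrightarrow> (\<exists>i<n. t = F n i z)" for t using Zeq by (auto simp: set_eq_iff Z_def)
      have 1: "\<exists>s. (q @ [s] \<in> Y \<and> \<bar>t - s\<bar> < \<rho>) \<and> (\<forall>s'. q @ [s'] \<in> Y \<and> \<bar>t - s'\<bar> < \<rho> \<longrightarrow> s' = s)"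
        if t: "z @ [t] \<in> Y" for t
      proof -
        obtain i where i: "i < n" "t = F n i z" using t mz by blast
        have *: "F n j q = F n i q" if "j < n" "\<bar>t - F n j q\<bar> < \<rho>" for j
        proof -
          have "\<bar>F n i z - F n j z\<bar> < 2 * \<rho>"
            using that(2) d[OF that(1)] unfolding i(2) by linarith
          then show ?thesis using idx[OF i(1) that(1)] by simp
        qed
        show ?thesis
        proof (intro exI conjI allI impI)
          show "q @ [F n i q] \<in> Y" using mq i(1) by blast
          show "\<bar>t - F n i q\<bar> < \<rho>" using d[OF i(1)] i(2) by linarith
          show "s' = F n i q" if "q @ [s'] \<in> Y \<and> \<bar>t - s'\<bar> < \<rho>" for s'
            using that mq[of s'] * by blast
        qed
      qed
      have 2: "\<exists>s. (z @ [s] \<in> Y \<and> \<bar>s - t\<bar> < \<rho>) \<and> (\<forall>s'. z @ [s'] \<in> Y \<and> \<bar>s' - t\<bar> < \<rho> \<longrightarrow> s' = s)"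
        if t: "q @ [t] \<in> Y" for t
      proof -
        obtain i where i: "i < n" "t = F n i q" using t mq by blast
        have *: "F n j z = F n i z" if "j < n" "\<bar>F n j z - t\<bar> < \<rho>" for j
        proof -
          have "\<bar>F n i z - F n j z\<bar> < 2 * \<rho>"
            using that(2) d[OF i(1)] unfolding i(2) by linarith
          then show ?thesis using idx[OF i(1) that(1)] by simp
        qed
        show ?thesis
        proof (intro exI conjI allI impI)
          show "z @ [F n i z] \<in> Y" using mz i(1) by blast
          show "\<bar>F n i z - t\<bar> < \<rho>" using d[OF i(1)] i(2) by linarith
          show "s' = F n i z" if "z @ [s'] \<in> Y \<and> \<bar>s' - t\<bar> < \<rho>" for s'
            using that mz[of s'] * by blast
        qed
      qed
      show ?thesis unfolding matched_def using 1 2 by blast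
    qed
    then have "z \<notin> bad" unfolding bad_def using \<rho>(1) \<sigma>(1) by blast
    moreover have "z \<in> bad" using z(1) p1(3) p(3) by blast
    ultimately show False by blast
  qed
  ultimately have "\<forall>\<^sub>0 x. b x \<notin> bad" by (rule gen)
  moreover have "\<forall>\<^sub>0 x. \<forall>j<m. isCont (\<lambda>x. b x ! j) x"
    using cont unfolding eventually_continuous_def by (intro eventually_all_less) auto
  ultimately have "\<forall>\<^sub>0 x. b x \<notin> bad \<and> (\<forall>j<m. isCont (\<lambda>x. b x ! j) x)"
    by (rule eventually_conj)
  then obtain a where a: "a > 0" "\<And>x. 0 < x \<Longrightarrow> x < a \<Longrightarrow> b x \<notin> bad"
    "\<And>x j. 0 < x \<Longrightarrow> x < a \<Longrightarrow> j < m \<Longrightarrow> isCont (\<lambda>x. b x ! j) x"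
    unfolding eventually_at_right_0 by blast
  have "\<exists>n. \<forall>x\<in>{0<..<a}. card {t. b x @ [t] \<in> Y} = n"
  proof (rule constant_if_locally_constant[OF connected_Ioo])
    fix x assume x: "x \<in> {0<..<a}"
    then obtain r s where r: "s > 0" "\<And>q. length q = m \<Longrightarrow> q \<in> cube (b x) s \<Longrightarrow> matched (b x) q r"
      using a(2)[of x] complete_germ_length[OF b] by (auto simp: bad_def)
    have "\<forall>\<^sub>F y in nhds x. b y \<in> cube (b x) s"
      using x a(3) r(1) by (intro eventually_cube[OF complete_germ_length[OF b]]) auto
    then show "\<forall>\<^sub>F y in nhds x. card {t. b y @ [t] \<in> Y} = card {t. b x @ [t] \<in> Y}"
      by eventually_elim (use card_matched r(2) complete_germ_length[OF b] in blast)
  qed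
  then obtain n where n: "\<And>x. x \<in> {0<..<a} \<Longrightarrow> card {t. b x @ [t] \<in> Y} = n" by blast
  have "\<forall>\<^sub>0 x. (\<forall>i<n. \<forall>j<n. i < j \<longrightarrow> F n i (b x) < F n j (b x)) \<and>
     {t. b x @ [t] \<in> Y} = (\<lambda>i. F n i (b x)) ` {..<n}"
    unfolding eventually_at_right_0
    using a(1) F[OF complete_germ_length[OF b]] n by (metis greaterThanLessThan_iff)
  moreover have "\<forall>i<n. definable_op m (F n i)" using definable_op by blast
  ultimately show ?thesis by - (rule exI[of _ n], rule exI[of _ "F n"], rule conjI)
qed

lemma independent_germ_take: "independent_germ m c \<Longrightarrow> k \<le> m \<Longrightarrow> independent_germ k (\<lambda>x. take k (c x))"
  by (auto simp: independent_germ_def min_def)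

lemma eventually_continuous_take: "eventually_continuous m c \<Longrightarrow> k \<le> m \<Longrightarrow> eventually_continuous k (\<lambda>x. take k (c x))"
  by (auto simp: eventually_continuous_def)

lemma infinite_fibre_definable:
  assumes Y: "Y \<in> D (Suc m)"
  shows "{p. length p = m \<and> infinite {t. p @ [t] \<in> Y}} \<in> D m"
proof -
  have "infinite {t. p @ [t] \<in> Y} \<longleftrightarrow> (\<exists>u v. u < v \<and> (\<forall>t. u \<le> t \<and> t \<le> v \<longrightarrow> p @ [t] \<in> Y))"
    if p: "length p = m" for p
  proof
    assume "infinite {t. p @ [t] \<in> Y}"
    then show "\<exists>u v. u < v \<and> (\<forall>t. u \<le> t \<and> t \<le> v \<longrightarrow> p @ [t] \<in> Y)"
      using fibre_interval[OF Y p] by metis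
  next
    assume "\<exists>u v. u < v \<and> (\<forall>t. u \<le> t \<and> t \<le> v \<longrightarrow> p @ [t] \<in> Y)"
    then obtain u v where "u < v" "\<forall>t. u \<le> t \<and> t \<le> v \<longrightarrow> p @ [t] \<in> Y" by blast
    then have "u < v" "{u..v} \<subseteq> {t. p @ [t] \<in> Y}" by auto
    then show "infinite {t. p @ [t] \<in> Y}"
      using finite_subset infinite_Icc by blast
  qed
  then have "{p. length p = m \<and> infinite {t. p @ [t] \<in> Y}} =
     {p. length p = m \<and> (\<exists>u v. u < v \<and> (\<forall>t. u \<le> t \<and> t \<le> v \<longrightarrow> p @ [t] \<in> Y))}" by blast
  moreover have "{p. length p = m \<and> (\<exists>u v. u < v \<and> (\<forall>t. u \<le> t \<and> t \<le> v \<longrightarrow> p @ [t] \<in> Y))} \<in> D m"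
    by (rule definable_pred_Collect) (intro definable_intros definable_pred_mem[OF Y])
  ultimately show ?thesis by simp
qed

lemma independent_germ_avoids_small:
  assumes "complete_germ m c" "independent_germ m c" "eventually_continuous m c" "A \<in> D m" "small m A"
  shows "\<forall>\<^sub>0 x. c x \<notin> A"
  using assms
proof (induction m arbitrary: c A)
  case 0
  then have "c x = []" for x using complete_germ_length[OF 0(1)] by simp
  then show ?case using 0 by simp
next
  case (Suc m)
  note c = \<open>complete_germ (Suc m) c\<close> and A = \<open>A \<in> D (Suc m)\<close>
  show ?case
  proof (rule ccontr)
    assume "\<not> ?thesis"
    then have inA: "\<forall>\<^sub>0 x. c x \<in> A" using complete_germD[OF c A] by blast
    define b where "b x = take m (c x)" for x
    define y where "y x = c x ! m" for x
    have split: "c x = b x @ [y x]" for x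
      using complete_germ_length[OF c, of x] by (simp add: b_def y_def take_Suc_conv_app_nth[symmetric])
    have b: "complete_germ m b" "independent_germ m b" "eventually_continuous m b"
      unfolding b_def[abs_def] using complete_germ_take[OF c] independent_germ_take[OF Suc.prems(2)] eventually_continuous_take[OF Suc.prems(3)] by auto
    define U where "U = {p. length p = m \<and> infinite {t. p @ [t] \<in> A}}"
    have U: "U \<in> D m" unfolding U_def by (rule infinite_fibre_definable[OF A])
    have "U \<subseteq> {p. length p = m \<and> uncountable {t. p @ [t] \<in> A}}"
    proof
      fix p assume "p \<in> U"
      then have p: "length p = m" "infinite {t. p @ [t] \<in> A}" by (auto simp: U_def)
      obtain u v where uv: "u < v" "\<And>t. u \<le> t \<Longrightarrow> t \<le> v \<Longrightarrow> p @ [t] \<in> A"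
        using fibre_interval[OF A p] by metis
      then have "{u<..<v} \<subseteq> {t. p @ [t] \<in> A}" by auto
      then have "uncountable {t. p @ [t] \<in> A}"
        using uncountable_open_interval[of u v] uv(1) countable_subset by blast
      then show "p \<in> {p. length p = m \<and> uncountable {t. p @ [t] \<in> A}}" using p(1) by simp
    qed
    then have "small m U" using Suc.prems(5) by (auto intro: small_mono)
    then have notU: "\<forall>\<^sub>0 x. b x \<notin> U" by (rule Suc.IH[OF b U])
    define Y where "Y = {xs. length xs = Suc m \<and> (xs \<in> A \<and> take m xs \<notin> U)}"
    have tk: "take m (map e [0..<Suc m]) = map e [0..<m]" for e :: "nat \<Rightarrow> real"
      by (intro nth_equalityI) (auto simp del: upt_Suc)
    have Y: "Y \<in> D (Suc m)"
      unfolding Y_def by (rule definable_pred_Collect, unfold tk) (intro definable_intros definable_pred_mem[OF A] definable_pred_mem[OF U])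
    have Yfib: "{t. p @ [t] \<in> Y} = (if p \<in> U then {} else {t. p @ [t] \<in> A})" if "length p = m" for p
      using that by (auto simp: Y_def)
    have "finite {t. p @ [t] \<in> Y}" if "length p = m" for p
      unfolding Yfib[OF that] using that by (auto simp: U_def)
    from uniform_finiteness_generic[OF b(1,3) Suc.IH[OF b] Y this]
    obtain n :: nat and f where f': "\<forall>i<n. definable_op m (f i)" and
      ev': "\<forall>\<^sub>0 x. (\<forall>i<n. \<forall>j<n. i < j \<longrightarrow> f i (b x) < f j (b x)) \<and>
        {t. b x @ [t] \<in> Y} = (\<lambda>i. f i (b x)) ` {..<n}"
      by blast
    note f = f'[rule_format]
    have ev: "\<forall>\<^sub>0 x. {t. b x @ [t] \<in> Y} = (\<lambda>i. f i (b x)) ` {..<n}"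
      using ev' by eventually_elim blast
    have "\<forall>\<^sub>0 x. y x \<noteq> f i (b x)" if i: "i < n" for i
    proof -
      have "definable_pred (\<lambda>e. map e [0..<Suc m] ! m = f i (take m (map e [0..<Suc m])))"
        unfolding tk using f[OF i] by (intro definable_intros definable_term_app[OF f[OF i]]) auto
      from complete_germ_predicate[OF c this] show ?thesis
        using Suc.prems(2) f[OF i] unfolding independent_germ_def y_def b_def by blast
    qed
    then have "\<forall>\<^sub>0 x. \<forall>i<n. y x \<noteq> f i (b x)"
      by (rule eventually_all_less)
    with inA notU ev have "\<forall>\<^sub>0 x. y x \<noteq> y x"
    proof eventually_elim
      case (elim x)
      have "length (b x) = m" using complete_germ_length[OF b(1)] .
      then have "b x @ [y x] \<in> Y" using elim(1,2) split[of x] by (simp add: Y_def)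
      then show ?case using elim(3,4) by blast
    qed
    then show False by (simp add: trivial_limit_at_right_real)
  qed
qed

lemma basis:
  assumes c: "complete_germ m c"
  obtains ks where "set ks \<subseteq> {..<m}" "independent_germ (length ks) (\<lambda>x. map ((!) (c x)) ks)"
    "\<And>j. j < m \<Longrightarrow> \<exists>g. definable_op (length ks) g \<and> (\<forall>\<^sub>0 x. c x ! j = g (map ((!) (c x)) ks))"
proof -
  have "\<exists>ks. set ks \<subseteq> {..<n} \<and> independent_germ (length ks) (\<lambda>x. map ((!) (c x)) ks) \<and>
    (\<forall>j<n. \<exists>g. definable_op (length ks) g \<and> (\<forall>\<^sub>0 x. c x ! j = g (map ((!) (c x)) ks)))" if "n \<le> m" for n
    using that
  proof (induction n)
    case 0
    then show ?case by (intro exI[of _ "[]"]) (simp add: independent_germ_def)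
  next
    case (Suc n)
    then obtain ks where ks: "set ks \<subseteq> {..<n}" "independent_germ (length ks) (\<lambda>x. map ((!) (c x)) ks)"
      "\<And>j. j < n \<Longrightarrow> \<exists>g. definable_op (length ks) g \<and> (\<forall>\<^sub>0 x. c x ! j = g (map ((!) (c x)) ks))"
      by auto
    show ?case
    proof (cases "\<exists>g. definable_op (length ks) g \<and> (\<forall>\<^sub>0 x. c x ! n = g (map ((!) (c x)) ks))")
      case True
      then show ?thesis using ks by (intro exI[of _ ks]) (auto simp: less_Suc_eq)
    next
      case False
      define js where "js = ks @ [n]"
      have len: "length js = Suc (length ks)" by (simp add: js_def)
      have tk: "take i (map ((!) (c x)) js) = take i (map ((!) (c x)) ks)" if "i \<le> length ks" for i x
        using that by (simp add: js_def)
      have 1: "independent_germ (length js) (\<lambda>x. map ((!) (c x)) js)"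
        unfolding independent_germ_def
      proof (intro allI impI)
        fix i assume "i < length js"
        then consider "i < length ks" | "i = length ks" using len by linarith
        then show "\<not> (\<exists>g. definable_op i g \<and> (\<forall>\<^sub>0 x. map ((!) (c x)) js ! i = g (take i (map ((!) (c x)) js))))"
        proof cases
          case 1
          then have "map ((!) (c x)) js ! i = map ((!) (c x)) ks ! i" for x by (simp add: js_def nth_append)
          then show ?thesis using ks(2) 1 tk[of i] unfolding independent_germ_def by simp
        next
          case 2
          then have "map ((!) (c x)) js ! i = c x ! n" for x by (simp add: js_def nth_append)
          then show ?thesis using False 2 tk[of i] by simp
        qed
      qed
      have 2: "\<exists>g. definable_op (length js) g \<and> (\<forall>\<^sub>0 x. c x ! j = g (map ((!) (c x)) js))" if j: "j < Suc n" for j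
      proof (cases "j = n")
        case True
        have "definable_op (length js) (\<lambda>p. p ! length ks)" by (rule definable_op_nth) (simp add: len)
        moreover have "c x ! j = map ((!) (c x)) js ! length ks" for x by (simp add: js_def nth_append True)
        ultimately show ?thesis by (intro exI[of _ "\<lambda>p. p ! length ks"]) simp
      next
        case False
        then obtain g where g: "definable_op (length ks) g" "\<forall>\<^sub>0 x. c x ! j = g (map ((!) (c x)) ks)"
          using ks(3)[of j] j by auto
        have "definable_op (length js) (\<lambda>p. g (take (length ks) p))" by (rule definable_op_take[OF g(1)]) (simp add: len)
        then show ?thesis using g(2) tk[of "length ks"] by (intro exI[of _ "\<lambda>p. g (take (length ks) p)"]) simp
      qed
      have "set js \<subseteq> {..<Suc n}" using ks(1) by (auto simp: js_def)
      then show ?thesis using 1 2 by blast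
    qed
  qed
  then show thesis using that by blast
qed

lemma basis_map:
  assumes c: "complete_germ m c" and cont: "eventually_continuous m c"
  obtains ks G where "set ks \<subseteq> {..<m}" "complete_germ (length ks) (\<lambda>x. map ((!) (c x)) ks)"
    "\<forall>A\<in>D (length ks). small (length ks) A \<longrightarrow> (\<forall>\<^sub>0 x. map ((!) (c x)) ks \<notin> A)"
    "eventually_continuous (length ks) (\<lambda>x. map ((!) (c x)) ks)"
    "\<forall>j<m. definable_op (length ks) (G j)"
    "\<forall>\<^sub>0 x. c x = map (\<lambda>j. G j (map ((!) (c x)) ks)) [0..<m]"
proof -
  obtain ks where ks: "set ks \<subseteq> {..<m}" and ind: "independent_germ (length ks) (\<lambda>x. map ((!) (c x)) ks)"
    and ex: "\<And>j. j < m \<Longrightarrow> \<exists>g. definable_op (length ks) g \<and> (\<forall>\<^sub>0 x. c x ! j = g (map ((!) (c x)) ks))"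
    using basis[OF c] by blast
  obtain G where G: "\<And>j. j < m \<Longrightarrow> definable_op (length ks) (G j)"
    "\<And>j. j < m \<Longrightarrow> \<forall>\<^sub>0 x. c x ! j = G j (map ((!) (c x)) ks)"
    using ex by metis
  have lt: "ks ! i < m" if "i < length ks" for i using ks that by (auto simp: subset_iff)
  have complete_germ: "complete_germ (length ks) (\<lambda>x. map ((!) (c x)) ks)"
    by (rule complete_germ_image[OF c, of _ "\<lambda>i p. p ! (ks ! i)"]) (auto intro!: definable_op_nth lt)
  have cc: "eventually_continuous (length ks) (\<lambda>x. map ((!) (c x)) ks)"
    using cont lt by (auto simp: eventually_continuous_def)
  have "\<forall>\<^sub>0 x. \<forall>j<m. c x ! j = G j (map ((!) (c x)) ks)"
    by (intro eventually_all_less G(2))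
  then have "\<forall>\<^sub>0 x. c x = map (\<lambda>j. G j (map ((!) (c x)) ks)) [0..<m]"
    by eventually_elim (auto intro!: nth_equalityI simp: complete_germ_length[OF c])
  then show thesis
    using that[of ks G] ks complete_germ cc G(1) independent_germ_avoids_small[OF complete_germ ind cc] by blast
qed

lemma definable_along_curve_has_derivative:
  assumes c: "complete_germ m c" and f: "definable_op m f"
    and deriv: "\<And>j. j < m \<Longrightarrow> \<forall>\<^sub>0 x. ((\<lambda>x. c x ! j) has_real_derivative c' j x) (at x)"
  obtains k ks Dl where "\<forall>l<k. ks l < m" "\<forall>l<k. definable_op m (Dl l)"
    "\<forall>\<^sub>0 x. ((\<lambda>x. f (c x)) has_real_derivative (\<Sum>l<(k::nat). Dl l (c x) * c' (ks l) x)) (at x)"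
proof -
  have cont: "eventually_continuous m c" unfolding eventually_continuous_def
    by (intro allI impI eventually_mono[OF deriv] DERIV_isCont)
  obtain ks G where ks: "set ks \<subseteq> {..<m}" and b: "complete_germ (length ks) (\<lambda>x. map ((!) (c x)) ks)"
    and gen': "\<forall>A\<in>D (length ks). small (length ks) A \<longrightarrow> (\<forall>\<^sub>0 x. map ((!) (c x)) ks \<notin> A)"
    and cc: "eventually_continuous (length ks) (\<lambda>x. map ((!) (c x)) ks)"
    and G': "\<forall>j<m. definable_op (length ks) (G j)"
    and eq: "\<forall>\<^sub>0 x. c x = map (\<lambda>j. G j (map ((!) (c x)) ks)) [0..<m]"
    by (rule basis_map[OF c cont]) (rule that)
  note gen = gen'[rule_format] and G = G'[rule_format]
  define k where "k = length ks"
  define h where "h p = f (map (\<lambda>j. G j p) [0..<m])" for p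
  have h: "definable_op k h" unfolding h_def[abs_def] k_def by (rule definable_op_comp[OF f G])
  have lt: "ks ! i < m" if "i < k" for i using ks that by (auto simp: subset_iff k_def)
  define Dl where "Dl l p = partial_derivative h l (map ((!) p) ks)" for l p
  have Dl: "definable_op m (Dl l)" if "l < k" for l
    unfolding Dl_def[abs_def] by (rule definable_op_map_nth[OF _ ks]) (use definable_op_partial_derivative[OF h that] k_def in simp)
  have "\<forall>\<^sub>0 x. map ((!) (c x)) ks \<notin> {p. length p = k \<and> \<not> C1_at h p}"
    using gen[folded k_def, OF definable_not_C1_at[OF h] small_not_C1_at[OF h]] .
  moreover have "\<forall>\<^sub>0 x. \<forall>l<k. ((\<lambda>x. c x ! (ks ! l)) has_real_derivative c' (ks ! l) x) (at x)"
    by (intro eventually_all_less deriv lt)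
  moreover have "\<forall>\<^sub>0 x. \<forall>\<^sub>F y in nhds x. c y = map (\<lambda>j. G j (map ((!) (c y)) ks)) [0..<m]"
    by (rule eventually_at_right_nhds[OF eq])
  ultimately have "\<forall>\<^sub>0 x. ((\<lambda>x. f (c x)) has_real_derivative (\<Sum>l<k. Dl l (c x) * c' (ks ! l) x)) (at x)"
  proof eventually_elim
    case (elim x)
    have "((\<lambda>x. h (map ((!) (c x)) ks)) has_real_derivative (\<Sum>l<k. partial_derivative h l (map ((!) (c x)) ks) * c' (ks ! l) x)) (at x)"
      by (rule chain_rule_C1_at) (use elim in \<open>auto simp: k_def\<close>)
    moreover have "\<forall>\<^sub>F y in nhds x. f (c y) = h (map ((!) (c y)) ks)"
      using elim(3) by eventually_elim (simp add: h_def)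
    ultimately show ?case unfolding Dl_def by (subst DERIV_cong_ev[OF refl _ refl])
  qed
  then show thesis using that[of k "(!) ks" Dl] lt Dl by blast
qed

lemma uniform_finiteness_along_curve:
  assumes c: "complete_germ m c" and cont: "eventually_continuous m c"
    and Y: "Y \<in> D (Suc m)" and fin: "\<And>p. length p = m \<Longrightarrow> finite {t. p @ [t] \<in> Y}"
  obtains n f where "\<forall>i<n. definable_op m (f i)"
    "\<forall>\<^sub>0 x. (\<forall>i<n. \<forall>j<n. i < j \<longrightarrow> f i (c x) < f j (c x)) \<and>
       {t. c x @ [t] \<in> Y} = (\<lambda>i. f i (c x)) ` {..<(n::nat)}"
proof -
  obtain ks G where ks: "set ks \<subseteq> {..<m}" and b: "complete_germ (length ks) (\<lambda>x. map ((!) (c x)) ks)"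
    and gen': "\<forall>A\<in>D (length ks). small (length ks) A \<longrightarrow> (\<forall>\<^sub>0 x. map ((!) (c x)) ks \<notin> A)"
    and cc: "eventually_continuous (length ks) (\<lambda>x. map ((!) (c x)) ks)"
    and G': "\<forall>j<m. definable_op (length ks) (G j)"
    and eq: "\<forall>\<^sub>0 x. c x = map (\<lambda>j. G j (map ((!) (c x)) ks)) [0..<m]"
    by (rule basis_map[OF c cont]) (rule that)
  note gen = gen'[rule_format] and G = G'[rule_format]
  define k where "k = length ks"
  define Y' where "Y' = {xs. length xs = Suc k \<and> map (\<lambda>j. G j (take k xs)) [0..<m] @ [xs ! k] \<in> Y}"
  have tk: "take k (map e [0..<Suc k]) = map e [0..<k]" for e :: "nat \<Rightarrow> real"
    by (intro nth_equalityI) (auto simp del: upt_Suc)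
  have Y': "Y' \<in> D (Suc k)" unfolding Y'_def
    by (rule definable_pred_Collect, unfold tk)
      (intro definable_pred_mem[OF Y] definable_intros definable_term_app[OF G[folded k_def]], auto)
  have fib: "{t. p @ [t] \<in> Y'} = {t. map (\<lambda>j. G j p) [0..<m] @ [t] \<in> Y}" if "length p = k" for p
    using that by (auto simp: Y'_def nth_append)
  have "finite {t. p @ [t] \<in> Y'}" if "length p = k" for p
    unfolding fib[OF that] by (rule fin) simp
  from uniform_finiteness_generic[OF b cc gen Y'[unfolded k_def] this[unfolded k_def]]
  obtain n :: nat and f where f: "\<forall>i<n. definable_op k (f i)" and ev: "\<forall>\<^sub>0 x.
     (\<forall>i<n. \<forall>j<n. i < j \<longrightarrow> f i (map ((!) (c x)) ks) < f j (map ((!) (c x)) ks)) \<and>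
     {t. map ((!) (c x)) ks @ [t] \<in> Y'} = (\<lambda>i. f i (map ((!) (c x)) ks)) ` {..<n}"
    unfolding k_def by blast
  have "\<forall>\<^sub>0 x. (\<forall>i<n. \<forall>j<n. i < j \<longrightarrow> f i (map ((!) (c x)) ks) < f j (map ((!) (c x)) ks)) \<and>
       {t. c x @ [t] \<in> Y} = (\<lambda>i. f i (map ((!) (c x)) ks)) ` {..<n}"
    using ev eq by eventually_elim (use fib k_def in simp)
  moreover have "definable_op m (\<lambda>p. f i (map ((!) p) ks))" if "i < n" for i
    by (rule definable_op_map_nth[OF _ ks]) (use f that k_def in simp)
  ultimately show thesis using that[of n "\<lambda>i p. f i (map ((!) p) ks)"] by blast
qed

end

section \<open>Zeros of real functions and rotation\<close>

lemma zero_spreads_locally: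
  fixes \<phi> :: "real \<Rightarrow> 'a::real_normed_vector"
  assumes deriv: "\<forall>\<^sub>F x in nhds x0. (\<phi> has_vector_derivative \<phi>' x) (at x)"
    and bound: "\<forall>\<^sub>F x in nhds x0. norm (\<phi>' x) \<le> L * norm (\<phi> x)"
    and zero: "\<phi> x0 = 0"
  shows "\<forall>\<^sub>F x in nhds x0. \<phi> x = 0"
proof -
  obtain d where d: "d > 0"
    "\<And>x. dist x x0 < d \<Longrightarrow> (\<phi> has_vector_derivative \<phi>' x) (at x) \<and> norm (\<phi>' x) \<le> L * norm (\<phi> x)"
    using eventually_conj[OF deriv bound] unfolding eventually_nhds_metric by blast
  define s where "s = min (d / 2) (1 / (2 * (\<bar>L\<bar> + 1)))"
  have s: "s > 0" "s < d" "s * (\<bar>L\<bar> + 1) \<le> 1 / 2"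
    using d(1) by (auto simp: s_def min_def field_simps)
  define I where "I = {x0 - s..x0 + s}"
  have I: "(\<phi> has_vector_derivative \<phi>' x) (at x)" "norm (\<phi>' x) \<le> L * norm (\<phi> x)" if "x \<in> I" for x
    using d(2)[of x] that s(2) by (auto simp: I_def dist_real_def abs_if split: if_splits)
  have "continuous_on I \<phi>"
    using I(1) by (intro continuous_at_imp_continuous_on ballI has_vector_derivative_continuous)
  then have "continuous_on I (\<lambda>x. norm (\<phi> x))" by (intro continuous_on_norm)
  moreover have "compact I" "I \<noteq> {}" using s(1) by (auto simp: I_def)
  ultimately obtain x1 where x1: "x1 \<in> I" "\<And>x. x \<in> I \<Longrightarrow> norm (\<phi> x) \<le> norm (\<phi> x1)"
    using continuous_attains_sup[of I "\<lambda>x. norm (\<phi> x)"] by blast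
  define M where "M = norm (\<phi> x1)"
  have "norm (\<phi> x1 - \<phi> x0) \<le> (\<bar>L\<bar> * M) * norm (x1 - x0)"
  proof (rule differentiable_bound[of I])
    show "convex I" by (simp add: I_def)
    show "(\<phi> has_derivative (\<lambda>h. h *\<^sub>R \<phi>' x)) (at x within I)" if "x \<in> I" for x
      using I(1)[OF that] by (simp add: has_vector_derivative_def has_derivative_at_withinI)
    show "onorm (\<lambda>h. h *\<^sub>R \<phi>' x) \<le> \<bar>L\<bar> * M" if "x \<in> I" for x
    proof (rule onorm_bound)
      have "norm (\<phi>' x) \<le> \<bar>L\<bar> * norm (\<phi> x)"
        using I(2)[OF that] by (smt (verit) mult_right_mono norm_ge_zero abs_ge_self)
      also have "\<dots> \<le> \<bar>L\<bar> * M" using x1(2)[OF that] by (intro mult_left_mono) (auto simp: M_def)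
      finally have "norm (\<phi>' x) \<le> \<bar>L\<bar> * M" .
      then show "norm (h *\<^sub>R \<phi>' x) \<le> \<bar>L\<bar> * M * norm h" for h
        by (simp add: mult.commute mult_left_mono)
    qed (simp add: M_def)
  qed (use x1(1) s(1) in \<open>auto simp: I_def\<close>)
  also have "\<dots> \<le> (\<bar>L\<bar> * M) * s"
    using x1(1) by (intro mult_left_mono) (auto simp: I_def M_def)
  also have "\<dots> \<le> M * (s * (\<bar>L\<bar> + 1))"
    using s(1) by (simp add: algebra_simps M_def)
  also have "\<dots> \<le> M * (1 / 2)"
    by (rule mult_left_mono[OF s(3)]) (simp add: M_def)
  finally have "M \<le> 0" by (simp add: zero M_def)
  then have "\<phi> x = 0" if "x \<in> I" for x
    using x1(2)[OF that] by (simp add: M_def)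
  then show ?thesis
    unfolding eventually_nhds_metric using s(1)
    by (intro exI[of _ s]) (auto simp: I_def dist_real_def abs_if split: if_splits)
qed

lemma zero_spreads:
  fixes \<phi> :: "real \<Rightarrow> 'a::real_normed_vector"
  assumes deriv: "\<And>x. 0 < x \<Longrightarrow> x < a \<Longrightarrow> (\<phi> has_vector_derivative \<phi>' x) (at x)"
    and bound: "\<And>x0. 0 < x0 \<Longrightarrow> x0 < a \<Longrightarrow> \<phi> x0 = 0 \<Longrightarrow>
      \<exists>L. \<forall>\<^sub>F x in nhds x0. norm (\<phi>' x) \<le> L * norm (\<phi> x)"
    and x0: "0 < x0" "x0 < a" "\<phi> x0 = 0" and x: "0 < x" "x < a"
  shows "\<phi> x = 0"
proof -
  have "\<exists>b. \<forall>x\<in>{0<..<a}. (\<phi> x = 0) = b"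
  proof (rule constant_if_locally_constant[OF connected_Ioo])
    fix z assume z: "z \<in> {0<..<a}"
    show "\<forall>\<^sub>F y in nhds z. (\<phi> y = 0) = (\<phi> z = 0)"
    proof (cases "\<phi> z = 0")
      case True
      obtain L where L: "\<forall>\<^sub>F x in nhds z. norm (\<phi>' x) \<le> L * norm (\<phi> x)"
        using bound z True by auto
      have "\<forall>\<^sub>F x in nhds z. (\<phi> has_vector_derivative \<phi>' x) (at x)"
        using eventually_nhds_in_open[of "{0<..<a}" z] z deriv by (auto elim: eventually_mono)
      from zero_spreads_locally[OF this L True] show ?thesis
        by eventually_elim (simp add: True)
    next
      case False
      have "isCont \<phi> z" using deriv[of z] z has_vector_derivative_continuous by auto
      then have "(\<phi> \<longlongrightarrow> \<phi> z) (nhds z)" by (simp add: continuous_at tendsto_nhds_iff)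
      then have "\<forall>\<^sub>F y in nhds z. \<phi> y \<noteq> 0" using False topological_tendstoD[of \<phi> _ _ "- {0}"] by auto
      then show ?thesis by eventually_elim (simp add: False)
    qed
  qed
  then show ?thesis using x0 x by auto
qed

lemma upcrossing_right:
  fixes \<phi> :: "real \<Rightarrow> real"
  assumes cont: "\<And>x. l < x \<Longrightarrow> x < u \<Longrightarrow> isCont \<phi> x"
    and left: "\<And>x. l < x \<Longrightarrow> x < u \<Longrightarrow> \<phi> x = 0 \<Longrightarrow> eventually (\<lambda>y. \<phi> y < 0) (at_left x)"
    and right: "\<And>x. l < x \<Longrightarrow> x < u \<Longrightarrow> \<phi> x = 0 \<Longrightarrow> eventually (\<lambda>y. \<phi> y > 0) (at_right x)"
    and x1: "l < x1" "x1 < u" "\<phi> x1 = 0" and x2: "x1 < x2" "x2 < u"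
  shows "\<phi> x2 > 0"
proof (rule ccontr)
  assume neg: "\<not> \<phi> x2 > 0"
  obtain b where b: "b > x1" "\<And>y. x1 < y \<Longrightarrow> y < b \<Longrightarrow> \<phi> y > 0"
    using right[OF x1] unfolding eventually_at_right_field by blast
  define x where "x = (x1 + min b x2) / 2"
  have x: "x1 < x" "x < x2" "\<phi> x > 0" using b x2 by (auto simp: x_def intro: b(2))
  define S where "S = {y \<in> {x..x2}. \<phi> y \<le> 0}"
  have "continuous_on {x..x2} \<phi>"
    using cont x1 x2 x by (intro continuous_at_imp_continuous_on) auto
  then have "closed {y \<in> {x..x2}. \<phi> y \<le> 0}"
    by (rule continuous_on_closed_Collect_le[OF _ continuous_on_const]) simp
  moreover have "{y \<in> {x..x2}. \<phi> y \<le> 0} \<subseteq> {x..x2}" by blast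
  ultimately have "compact S"
    unfolding S_def compact_eq_bounded_closed
    by (meson bounded_closed_interval bounded_subset)
  moreover have "x2 \<in> S" using neg x by (auto simp: S_def)
  ultimately obtain z where z: "z \<in> S" "\<And>y. y \<in> S \<Longrightarrow> z \<le> y"
    using compact_attains_inf[of S] by blast
  have "z \<noteq> x" using z(1) x(3) by (auto simp: S_def)
  then have zx: "x < z" "z \<le> x2" "\<phi> z \<le> 0" using z(1) by (auto simp: S_def)
  have "\<forall>\<^sub>F y in at_left z. \<phi> y < 0"
  proof (cases "\<phi> z = 0")
    case True
    then show ?thesis using left zx x1 x2 x by auto
  next
    case False
    have "(\<phi> \<longlongrightarrow> \<phi> z) (at_left z)"
      using cont[of z] zx x1 x2 x by (auto simp: isCont_def intro: filterlim_mono at_le)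
    then show ?thesis using False zx(3) by (intro order_tendstoD(2)[of _ "\<phi> z"]) auto
  qed
  then obtain b' where b': "b' < z" "\<And>y. b' < y \<Longrightarrow> y < z \<Longrightarrow> \<phi> y < 0"
    unfolding eventually_at_left_field by blast
  define y where "y = (max b' x + z) / 2"
  have y: "b' < y" "x < y" "y < z" using b'(1) zx(1) by (auto simp: y_def)
  then have "y \<in> S" using b'(2)[of y] zx by (auto simp: S_def)
  then show False using z(2) y(3) by fastforce
qed

lemma upcrossing:
  fixes \<phi> :: "real \<Rightarrow> real"
  assumes cont: "\<And>x. l < x \<Longrightarrow> x < u \<Longrightarrow> isCont \<phi> x"
    and left: "\<And>x. l < x \<Longrightarrow> x < u \<Longrightarrow> \<phi> x = 0 \<Longrightarrow> eventually (\<lambda>y. \<phi> y < 0) (at_left x)"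
    and right: "\<And>x. l < x \<Longrightarrow> x < u \<Longrightarrow> \<phi> x = 0 \<Longrightarrow> eventually (\<lambda>y. \<phi> y > 0) (at_right x)"
    and x1: "l < x1" "x1 < u" "\<phi> x1 = 0"
  shows "\<And>x. x1 < x \<Longrightarrow> x < u \<Longrightarrow> \<phi> x > 0" "\<And>x. l < x \<Longrightarrow> x < x1 \<Longrightarrow> \<phi> x < 0"
proof -
  show "\<phi> x > 0" if "x1 < x" "x < u" for x
    by (rule upcrossing_right[OF cont left right x1 that])
  define \<psi> where "\<psi> y = - \<phi> (- y)" for y
  show "\<phi> x < 0" if "l < x" "x < x1" for x
  proof -
    have "\<psi> (- x) > 0"
    proof (rule upcrossing_right[of "- u" "- l" \<psi> "- x1"])
      show "isCont \<psi> y" if "- u < y" "y < - l" for y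
        unfolding \<psi>_def[abs_def]
        by (intro continuous_minus isCont_o2[of y uminus]) (use cont[of "- y"] that in auto)
      show "eventually (\<lambda>y. \<psi> y < 0) (at_left y)" if "- u < y" "y < - l" "\<psi> y = 0" for y
        using right[of "- y"] that unfolding \<psi>_def
        by (subst at_left_minus) (simp add: eventually_filtermap)
      show "eventually (\<lambda>y. \<psi> y > 0) (at_right y)" if "- u < y" "y < - l" "\<psi> y = 0" for y
        using left[of "- y"] that unfolding \<psi>_def
        by (subst at_right_minus) (simp add: eventually_filtermap)
    qed (use x1 that in \<open>auto simp: \<psi>_def\<close>)
    then show ?thesis by (simp add: \<psi>_def)
  qed
qed

lemma positive_derivative_crossing:
  fixes \<phi> :: "real \<Rightarrow> real"
  assumes "(\<phi> has_real_derivative d) (at x)" "d > 0" "\<phi> x = 0"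
  shows "eventually (\<lambda>y. \<phi> y < 0) (at_left x)" "eventually (\<lambda>y. \<phi> y > 0) (at_right x)"
proof -
  obtain r where r: "r > 0" "\<And>h. h > 0 \<Longrightarrow> h < r \<Longrightarrow> \<phi> (x - h) < \<phi> x"
    using DERIV_pos_inc_left[OF assms(1,2)] by blast
  have "\<phi> y < 0" if "x - r < y" "y < x" for y using r(2)[of "x - y"] that assms(3) by simp
  then show "eventually (\<lambda>y. \<phi> y < 0) (at_left x)"
    unfolding eventually_at_left_field using r(1) by (intro exI[of _ "x - r"]) auto
  obtain r where r: "r > 0" "\<And>h. h > 0 \<Longrightarrow> h < r \<Longrightarrow> \<phi> x < \<phi> (x + h)"
    using DERIV_pos_inc_right[OF assms(1,2)] by blast
  have "\<phi> y > 0" if "x < y" "y < x + r" for y using r(2)[of "y - x"] that assms(3) by simp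
  then show "eventually (\<lambda>y. \<phi> y > 0) (at_right x)"
    unfolding eventually_at_right_field using r(1) by (intro exI[of _ "x + r"]) auto
qed

lemma eventually_signed:
  fixes \<phi> :: "real \<Rightarrow> real"
  assumes "\<forall>\<^sub>0 x. isCont \<phi> x" "\<forall>\<^sub>0 x. \<phi> x \<noteq> 0"
  shows "(\<forall>\<^sub>0 x. \<phi> x > 0) \<or> (\<forall>\<^sub>0 x. \<phi> x < 0)"
proof -
  obtain a where a: "a > 0" "\<And>x. 0 < x \<Longrightarrow> x < a \<Longrightarrow> isCont \<phi> x \<and> \<phi> x \<noteq> 0"
    using eventually_conj[OF assms] unfolding eventually_at_right_0 by blast
  have "\<exists>b. \<forall>x\<in>{0<..<a}. (\<phi> x > 0) = b"
  proof (rule constant_if_locally_constant[OF connected_Ioo])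
    fix x assume x: "x \<in> {0<..<a}"
    then have lim: "(\<phi> \<longlongrightarrow> \<phi> x) (nhds x)" using a(2)[of x] by (simp add: continuous_at tendsto_nhds_iff)
    show "\<forall>\<^sub>F y in nhds x. (\<phi> y > 0) = (\<phi> x > 0)"
    proof (cases "\<phi> x > 0")
      case True
      from order_tendstoD(1)[OF lim this] show ?thesis by eventually_elim (use True in simp)
    next
      case False
      then have "\<phi> x < 0" using a(2)[of x] x by (simp add: less_le)
      from order_tendstoD(2)[OF lim this] show ?thesis by eventually_elim (use False in simp)
    qed
  qed
  then obtain b where b: "\<And>x. x \<in> {0<..<a} \<Longrightarrow> (\<phi> x > 0) = b" by blast
  show ?thesis
  proof (cases b)
    case True
    then have "\<forall>\<^sub>0 x. \<phi> x > 0" unfolding eventually_at_right_0 using a(1) b by auto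
    then show ?thesis ..
  next
    case False
    then have "\<phi> x < 0" if "0 < x" "x < a" for x using b[of x] a(2)[of x] that by auto
    then have "\<forall>\<^sub>0 x. \<phi> x < 0" unfolding eventually_at_right_0 using a(1) by auto
    then show ?thesis ..
  qed
qed

lemma eventually_nonzero_if_same_crossing:
  fixes \<phi> :: "real \<Rightarrow> real"
  assumes deriv: "\<forall>\<^sub>0 x. (\<phi> has_real_derivative d x) (at x)"
    and pos: "\<forall>\<^sub>0 x. \<phi> x = 0 \<longrightarrow> d x > 0"
  shows "\<forall>\<^sub>0 x. \<phi> x \<noteq> 0"
proof -
  obtain a where a: "a > 0" "\<And>x. 0 < x \<Longrightarrow> x < a \<Longrightarrow> (\<phi> has_real_derivative d x) (at x) \<and> (\<phi> x = 0 \<longrightarrow> d x > 0)"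
    using eventually_conj[OF deriv pos] unfolding eventually_at_right_0 by blast
  show ?thesis
  proof (cases "\<exists>x1>0. x1 < a \<and> \<phi> x1 = 0")
    case True
    then obtain x1 where x1: "0 < x1" "x1 < a" "\<phi> x1 = 0" by blast
    have "\<phi> x < 0" if "0 < x" "x < x1" for x
      by (rule upcrossing(2)[of 0 a \<phi> x1])
        (use x1 that a(2) positive_derivative_crossing DERIV_isCont in blast)+
    then show ?thesis unfolding eventually_at_right_0 using x1(1) by (intro exI[of _ x1]) force
  next
    case False
    then show ?thesis unfolding eventually_at_right_0 using a(1) by blast
  qed
qed

lemma rotation_at_bot:
  fixes r \<theta> e :: "real \<Rightarrow> real"
  assumes a: "a > 0" and cont: "\<And>x. 0 < x \<Longrightarrow> x < a \<Longrightarrow> isCont \<theta> x"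
    and e: "\<And>x. 0 < x \<Longrightarrow> x < a \<Longrightarrow> r x > 0 \<and> e x = r x * cos (\<theta> x)"
    and deriv: "\<And>x. 0 < x \<Longrightarrow> x < a \<Longrightarrow> (e has_real_derivative d x) (at x)"
    and cross: "\<And>x. 0 < x \<Longrightarrow> x < a \<Longrightarrow> e x = 0 \<Longrightarrow> d x * sin (\<theta> x) < 0"
    and zeros: "\<And>b. b > 0 \<Longrightarrow> \<exists>x>0. x < b \<and> e x = 0"
  shows "filterlim \<theta> at_bot (at_right 0)"
proof -
  have e0: "e x = 0 \<longleftrightarrow> cos (\<theta> x) = 0" if "0 < x" "x < a" for x
    using e[OF that] by auto
  have down: "\<theta> x < \<theta> z" if z: "0 < z" "z < a" "e z = 0" and x: "0 < x" "x < z" for x z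
  proof -
    define l where "l = \<theta> z"
    have cl: "cos l = 0" using e0[OF z(1,2)] z(3) by (simp add: l_def)
    then have sl: "(sin l)\<^sup>2 = 1" using sin_cos_squared_add[of l] by simp
    have key: "eventually (\<lambda>y. \<theta> y - l < 0) (at_left w) \<and> eventually (\<lambda>y. \<theta> y - l > 0) (at_right w)"
      if w: "0 < w" "w < a" "\<theta> w - l = 0" for w
    proof -
      define \<psi> where "\<psi> y = - sin l * e y" for y
      have "e w = 0" using e0[OF w(1,2)] w(3) cl by simp
      have "(\<psi> has_real_derivative - sin l * d w) (at w)"
        unfolding \<psi>_def[abs_def] by (intro DERIV_cmult deriv w)
      moreover have "- sin l * d w > 0"
        using cross[OF w(1,2) \<open>e w = 0\<close>] w(3) by (simp add: mult.commute)
      moreover have "\<psi> w = 0" using \<open>e w = 0\<close> by (simp add: \<psi>_def)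
      ultimately have \<psi>: "eventually (\<lambda>y. \<psi> y < 0) (at_left w)" "eventually (\<lambda>y. \<psi> y > 0) (at_right w)"
        using positive_derivative_crossing by blast+
      have lim: "(\<theta> \<longlongrightarrow> l) (nhds w)"
        using cont[OF w(1,2)] w(3) by (simp add: continuous_at tendsto_nhds_iff)
      have near: "\<forall>\<^sub>F y in nhds w. (l - pi < \<theta> y \<and> \<theta> y < l + pi) \<and> y \<in> {0<..<a}"
        using order_tendstoD(1)[OF lim, of "l - pi"] order_tendstoD(2)[OF lim, of "l + pi"]
          eventually_nhds_in_open[of "{0<..<a}" w] w by (intro eventually_conj) auto
      have sgn: "\<psi> y = r y * sin (\<theta> y - l)" if "y \<in> {0<..<a}" for y
      proof -
        have "cos (\<theta> y) = cos ((\<theta> y - l) + l)" by simp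
        also have "\<dots> = - sin (\<theta> y - l) * sin l" unfolding cos_add cl by simp
        finally have "\<psi> y = r y * sin (\<theta> y - l) * (sin l)\<^sup>2"
          using e[of y] that by (simp add: \<psi>_def power2_eq_square)
        then show ?thesis by (simp add: sl)
      qed
      have imp: "(\<psi> y < 0 \<longrightarrow> \<theta> y - l < 0) \<and> (\<psi> y > 0 \<longrightarrow> \<theta> y - l > 0)"
        if y: "(l - pi < \<theta> y \<and> \<theta> y < l + pi) \<and> y \<in> {0<..<a}" for y
      proof -
        have ry: "r y > 0" using e y by auto
        have "\<theta> y - l \<ge> 0 \<Longrightarrow> sin (\<theta> y - l) \<ge> 0" using y by (intro sin_ge_zero) auto
        moreover have "\<theta> y - l \<le> 0 \<Longrightarrow> sin (\<theta> y - l) \<le> 0"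
          using y sin_ge_zero[of "l - \<theta> y"] sin_minus[of "l - \<theta> y"] by auto
        moreover have "\<psi> y < 0 \<longrightarrow> sin (\<theta> y - l) < 0" "\<psi> y > 0 \<longrightarrow> sin (\<theta> y - l) > 0"
          using ry sgn[of y] y by (auto simp: mult_less_0_iff zero_less_mult_iff)
        ultimately show ?thesis by linarith
      qed
      have nl: "\<forall>\<^sub>F y in at_left w. (l - pi < \<theta> y \<and> \<theta> y < l + pi) \<and> y \<in> {0<..<a}"
        and nr: "\<forall>\<^sub>F y in at_right w. (l - pi < \<theta> y \<and> \<theta> y < l + pi) \<and> y \<in> {0<..<a}"
        using near by (auto simp: eventually_at_filter elim: eventually_mono)
      have "eventually (\<lambda>y. \<theta> y - l < 0) (at_left w)"
        using \<psi>(1) nl by eventually_elim (use imp in blast)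
      moreover have "eventually (\<lambda>y. \<theta> y - l > 0) (at_right w)"
        using \<psi>(2) nr by eventually_elim (use imp in blast)
      ultimately show ?thesis ..
    qed
    have "\<theta> x - l < 0"
    proof (rule upcrossing(2)[of 0 a "\<lambda>y. \<theta> y - l" z])
      show "isCont (\<lambda>y. \<theta> y - l) y" if "0 < y" "y < a" for y
        using cont[OF that] by (intro continuous_intros)
    qed (use key z x in \<open>auto simp: l_def\<close>)
    then show ?thesis by (simp add: l_def)
  qed
  obtain z0 where z0: "0 < z0" "z0 < a" "e z0 = 0" using zeros[OF a] by blast
  have "\<exists>z>0. z < a \<and> e z = 0 \<and> \<theta> z \<le> \<theta> z0 - real n * pi" for n
  proof (induction n)
    case 0
    then show ?case using z0 by auto
  next
    case (Suc n)
    then obtain z where z: "z > 0" "z < a" "e z = 0" "\<theta> z \<le> \<theta> z0 - real n * pi" by blast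
    obtain w where w: "0 < w" "w < z" "e w = 0" using zeros[OF z(1)] by blast
    have lt: "\<theta> w < \<theta> z" by (rule down[OF z(1-3) w(1,2)])
    have "sin (\<theta> z - \<theta> w) = 0"
      using e0[of z] e0[of w] z w by (simp add: sin_diff)
    then have "\<theta> z - \<theta> w \<ge> pi"
      using sin_gt_zero[of "\<theta> z - \<theta> w"] lt by force
    then show ?case using z w by (intro exI[of _ w]) (auto simp: algebra_simps)
  qed
  note far = this
  show ?thesis
    unfolding filterlim_at_bot
  proof
    fix B
    obtain n :: nat where n: "real n > (\<theta> z0 - B) / pi" using reals_Archimedean2 by blast
    then have "\<theta> z0 - real n * pi < B" using pi_gt_zero by (simp add: field_simps)
    then obtain z where z: "z > 0" "z < a" "e z = 0" "\<theta> z < B" using far[of n] by force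
    show "\<forall>\<^sub>0 x. \<theta> x \<le> B"
      unfolding eventually_at_right_0 using z down[OF z(1-3)] by (intro exI[of _ z]) force
  qed
qed

lemma angle_measure_exists:
  assumes cont: "\<And>x. 0 < x \<Longrightarrow> x < a \<Longrightarrow> isCont \<epsilon> x" and nz: "\<And>x. 0 < x \<Longrightarrow> x < a \<Longrightarrow> \<epsilon> x \<noteq> 0"
  obtains \<theta> where "angle_measure a \<epsilon> \<theta>"
proof -
  define f where "f x = Complex (fst (\<epsilon> x)) (snd (\<epsilon> x))" for x
  have fz: "f x \<noteq> 0" if "x \<in> {0<..<a}" for x
    using nz[of x] that by (auto simp: f_def complex_eq_iff prod_eq_iff)
  have "continuous_on {0<..<a} \<epsilon>"
    using cont by (intro continuous_at_imp_continuous_on) auto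
  then have "continuous_on {0<..<a} f"
    unfolding f_def Complex_eq by (intro continuous_intros)
  then obtain g where g: "continuous_on {0<..<a} g" "\<And>x. x \<in> {0<..<a} \<Longrightarrow> f x = exp (g x)"
    using continuous_logarithm_on_contractible[of "{0<..<a}" f] fz convex_imp_contractible[of "{0<..<a}"] by auto
  have "angle_measure a \<epsilon> (\<lambda>x. Im (g x))"
    unfolding angle_measure_def
  proof (intro conjI ballI)
    show "continuous_on {0<..<a} (\<lambda>x. Im (g x))" using g(1) by (intro continuous_intros)
    fix x assume x: "x \<in> {0<..<a}"
    show "\<epsilon> x \<noteq> 0" using nz x by auto
    have n: "norm (\<epsilon> x) = cmod (f x)" by (simp add: f_def norm_prod_def cmod_def)
    also have "\<dots> = exp (Re (g x))" using g(2)[OF x] by simp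
    finally have n: "norm (\<epsilon> x) = exp (Re (g x))" .
    have "fst (\<epsilon> x) = exp (Re (g x)) * cos (Im (g x))" "snd (\<epsilon> x) = exp (Re (g x)) * sin (Im (g x))"
      using arg_cong[OF g(2)[OF x], of Re] arg_cong[OF g(2)[OF x], of Im]
      by (simp_all add: f_def Re_exp Im_exp)
    then show "\<epsilon> x /\<^sub>R norm (\<epsilon> x) = (cos (Im (g x)), sin (Im (g x)))"
      by (simp add: n prod_eq_iff field_simps)
  qed
  then show thesis by (rule that)
qed

section \<open>Flat solutions\<close>

lemma C1_on_locally_lipschitz:
  fixes f :: "'a::real_normed_vector \<Rightarrow> 'b::real_normed_vector"
  assumes "open U" "C1_on U f" "p \<in> U"
  obtains L r where "r > 0" "ball p r \<subseteq> U"
    "\<And>q q'. q \<in> ball p r \<Longrightarrow> q' \<in> ball p r \<Longrightarrow> norm (f q - f q') \<le> L * norm (q - q')"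
proof -
  obtain f' where f': "\<And>q. q \<in> U \<Longrightarrow> (f has_derivative blinfun_apply (f' q)) (at q)" "continuous_on U f'"
    using assms(2) unfolding C1_on_def by blast
  have "(f' \<longlongrightarrow> f' p) (nhds p)"
    using f'(2) assms(1,3) by (simp add: continuous_on_eq_continuous_at continuous_at tendsto_nhds_iff)
  then have "\<forall>\<^sub>F q in nhds p. dist (f' q) (f' p) < 1" by (rule tendstoD) simp
  moreover have "\<forall>\<^sub>F q in nhds p. q \<in> U" by (rule eventually_nhds_in_open[OF assms(1,3)])
  ultimately have "\<forall>\<^sub>F q in nhds p. dist (f' q) (f' p) < 1 \<and> q \<in> U" by (rule eventually_conj)
  then obtain r where r: "r > 0" "\<And>q. dist q p < r \<Longrightarrow> dist (f' q) (f' p) < 1 \<and> q \<in> U"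
    unfolding eventually_nhds_metric by blast
  show thesis
  proof
    show "r > 0" by fact
    show "ball p r \<subseteq> U" using r(2) by (auto simp: dist_commute)
    show "norm (f q - f q') \<le> (norm (f' p) + 1) * norm (q - q')" if "q \<in> ball p r" "q' \<in> ball p r" for q q'
    proof (rule differentiable_bound[OF convex_ball _ _ that])
      fix z assume "z \<in> ball p r"
      then have z: "dist (f' z) (f' p) < 1" "z \<in> U" using r(2)[of z] by (auto simp: dist_commute)
      show "(f has_derivative blinfun_apply (f' z)) (at z within ball p r)"
        using f'(1)[OF z(2)] by (rule has_derivative_at_withinI)
      have "norm (f' z) \<le> norm (f' p) + norm (f' z - f' p)" by (metis norm_triangle_sub)
      then show "onorm (blinfun_apply (f' z)) \<le> norm (f' p) + 1"
        using z(1) by (simp add: norm_blinfun.rep_eq[symmetric] dist_norm)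
    qed
  qed
qed

lemma C1_on_lipschitz_along_curves:
  fixes F :: "real \<times> 'a::real_normed_vector \<Rightarrow> 'b::real_normed_vector" and u v :: "real \<Rightarrow> 'a"
  assumes F: "open \<Omega>" "C1_on \<Omega> F" and p: "(x0, u x0) \<in> \<Omega>" "v x0 = u x0"
    and cont: "isCont u x0" "isCont v x0"
  obtains L where "L \<ge> 0" "\<forall>\<^sub>F x in nhds x0. (x, u x) \<in> \<Omega> \<and> (x, v x) \<in> \<Omega> \<and>
    norm (F (x, u x) - F (x, v x)) \<le> L * norm (u x - v x)"
proof -
  obtain L r where r: "r > 0" "ball (x0, u x0) r \<subseteq> \<Omega>"
    "\<And>q q'. q \<in> ball (x0, u x0) r \<Longrightarrow> q' \<in> ball (x0, u x0) r \<Longrightarrow> norm (F q - F q') \<le> L * norm (q - q')"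
    using C1_on_locally_lipschitz[OF F p(1)] by metis
  have near: "\<forall>\<^sub>F x in nhds x0. (x, w x) \<in> ball (x0, u x0) r" if "isCont w x0" "w x0 = u x0" for w
  proof -
    have "((\<lambda>x. (x, w x)) \<longlongrightarrow> (x0, u x0)) (nhds x0)"
      using that by (intro tendsto_Pair) (auto simp: continuous_at tendsto_nhds_iff filterlim_ident)
    then show ?thesis
      using topological_tendstoD[of _ "(x0, u x0)" _ "ball (x0, u x0) r"] r(1) by auto
  qed
  have "\<forall>\<^sub>F x in nhds x0. (x, u x) \<in> \<Omega> \<and> (x, v x) \<in> \<Omega> \<and> norm (F (x, u x) - F (x, v x)) \<le> \<bar>L\<bar> * norm (u x - v x)"
    using near[OF cont(1) refl] near[OF cont(2) p(2)]
  proof eventually_elim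
    case (elim x)
    have "norm (F (x, u x) - F (x, v x)) \<le> L * norm ((x, u x) - (x, v x))" by (rule r(3)[OF elim])
    also have "\<dots> \<le> \<bar>L\<bar> * norm (u x - v x)" by (simp add: norm_Pair mult_right_mono)
    finally show ?case using elim r(2) by blast
  qed
  then show thesis using that[of "\<bar>L\<bar>"] by simp
qed

context ominimal_structure
begin

lemma complete_germ_if_regular_separation:
  assumes "regular_separation D \<gamma>"
  shows "complete_germ 3 (\<lambda>x. [x, fst (\<gamma> x), snd (\<gamma> x)])"
  unfolding complete_germ_def
proof (intro conjI allI ballI)
  fix A assume A: "A \<in> D 3"
  let ?c = "\<lambda>x. [x, fst (\<gamma> x), snd (\<gamma> x)]"
  define f where "f p = (if p \<in> A then 1 else 0 :: real)" for p
  have "definable_op 3 f" unfolding definable_op_def f_def by (intro definable_intros definable_pred_mem[OF A])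
  then have "definable_fun D 3 {xs. length xs = 3} f" by (rule definable_op_total)
  then have "(\<forall>\<^sub>0 x. f (?c x) = 0) \<or> (\<exists>k::nat. \<forall>\<^sub>0 x. \<bar>f (?c x)\<bar> \<ge> x ^ k)"
    using assms unfolding regular_separation_def by simp
  then show "(\<forall>\<^sub>0 x. ?c x \<in> A) \<or> (\<forall>\<^sub>0 x. ?c x \<notin> A)"
  proof
    assume "\<forall>\<^sub>0 x. f (?c x) = 0"
    then have "\<forall>\<^sub>0 x. ?c x \<notin> A" by eventually_elim (auto simp: f_def split: if_splits)
    then show ?thesis ..
  next
    assume "\<exists>k::nat. \<forall>\<^sub>0 x. \<bar>f (?c x)\<bar> \<ge> x ^ k"
    then obtain k :: nat where k: "\<forall>\<^sub>0 x. \<bar>f (?c x)\<bar> \<ge> x ^ k" ..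
    have "\<forall>\<^sub>0 x. ?c x \<in> A"
      using k eventually_at_right_less[of 0]
    proof eventually_elim
      case (elim x)
      have "x ^ k > 0" using elim by simp
      then have "f (?c x) \<noteq> 0" using elim(1) by (metis abs_zero not_le)
      then show ?case by (auto simp: f_def split: if_splits)
    qed
    then show ?thesis ..
  qed
qed simp

text \<open>The germ at \<open>0\<close> of the fibre over \<open>(x, \<gamma> x)\<close> extends to a polynomially large interval, because
  the length of a suitable interval is a definable positive function.\<close>

lemma flat_dichotomy:
  assumes \<gamma>: "regular_separation D \<gamma>" and A: "A \<in> D 4"
  obtains k :: nat where
    "(\<forall>\<^sub>0 x. \<forall>t. 0 < t \<and> t < x ^ k \<longrightarrow> [x, fst (\<gamma> x), snd (\<gamma> x), t] \<in> A) \<or>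
     (\<forall>\<^sub>0 x. \<forall>t. 0 < t \<and> t < x ^ k \<longrightarrow> [x, fst (\<gamma> x), snd (\<gamma> x), t] \<notin> A)"
proof -
  let ?c = "\<lambda>x. [x, fst (\<gamma> x), snd (\<gamma> x)]"
  have A': "A \<in> D (Suc 3)" using A by simp
  define R where "R p r \<longleftrightarrow> 0 \<le> r \<and> r \<le> 1 \<and> ((\<forall>t. 0 < t \<and> t < r \<longrightarrow> p @ [t] \<in> A) \<or>
     (\<forall>t. 0 < t \<and> t < r \<longrightarrow> p @ [t] \<notin> A))" for p r
  define f where "f p = Sup {r. R p r}" for p
  have bdd: "bdd_above {r. R p r}" and ne: "0 \<in> {r. R p r}" for p
    by (auto simp: R_def bdd_above_def)
  have less: "s < f p \<longleftrightarrow> (\<exists>r. R p r \<and> s < r)" for s p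
    unfolding f_def using less_cSup_iff[OF _ bdd, of p s] ne[of p] by auto
  have "definable_op 3 f"
    unfolding definable_op_def
    by (rule definable_term_from_less, unfold less R_def) (intro definable_intros definable_pred_mem[OF A'])
  have pos: "f p > 0" if p: "length p = 3" for p
  proof -
    have "definable_pred (\<lambda>e. p @ [e 0] \<in> A)" by (rule definable_pred_mem[OF A']) (intro definable_intros p)
    from eventually_right_dichotomy[OF this, of 0]
    obtain b where b: "b > 0" "(\<forall>t. 0 < t \<and> t < b \<longrightarrow> p @ [t] \<in> A) \<or> (\<forall>t. 0 < t \<and> t < b \<longrightarrow> p @ [t] \<notin> A)"
      unfolding eventually_at_right_0 by metis
    then have "R p (min b 1)" by (auto simp: R_def)
    then show ?thesis unfolding less using b(1) by (intro exI[of _ "min b 1"]) simp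
  qed
  have alt: "(\<forall>t. 0 < t \<and> t < f p \<longrightarrow> p @ [t] \<in> A) \<or> (\<forall>t. 0 < t \<and> t < f p \<longrightarrow> p @ [t] \<notin> A)" for p
  proof (rule ccontr)
    assume "\<not> ?thesis"
    then obtain s t where st: "0 < t" "t < f p" "p @ [t] \<notin> A" "0 < s" "s < f p" "p @ [s] \<in> A" by blast
    then have "max s t < f p" by simp
    then obtain r where "R p r" "max s t < r" unfolding less by blast
    then show False using st by (auto simp: R_def)
  qed
  have "definable_fun D 3 {xs. length xs = 3} f" by (rule definable_op_total) fact
  then have "(\<forall>\<^sub>0 x. f (?c x) = 0) \<or> (\<exists>k::nat. \<forall>\<^sub>0 x. \<bar>f (?c x)\<bar> \<ge> x ^ k)"
    using \<gamma> unfolding regular_separation_def by simp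
  moreover have "\<not> (\<forall>\<^sub>0 x. f (?c x) = 0)"
    using pos[of "?c _"] by (simp add: less_imp_neq[THEN not_sym] trivial_limit_at_right_real)
  ultimately obtain k :: nat where "\<forall>\<^sub>0 x. \<bar>f (?c x)\<bar> \<ge> x ^ k" by blast
  then have k: "\<forall>\<^sub>0 x. f (?c x) \<ge> x ^ k"
    by eventually_elim (use pos[of "?c _"] in \<open>simp add: abs_of_pos\<close>)
  have "definable_pred (\<lambda>e. \<forall>t. 0 < t \<and> t < f (map e [0..<3]) \<longrightarrow> map e [0..<3] @ [t] \<in> A)"
    by (intro definable_intros definable_pred_mem[OF A'] definable_term_app[OF \<open>definable_op 3 f\<close>])
  from complete_germ_predicate[OF complete_germ_if_regular_separation[OF \<gamma>] this]
  have "(\<forall>\<^sub>0 x. \<forall>t. 0 < t \<and> t < x ^ k \<longrightarrow> ?c x @ [t] \<in> A) \<or>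
     (\<forall>\<^sub>0 x. \<forall>t. 0 < t \<and> t < x ^ k \<longrightarrow> ?c x @ [t] \<notin> A)"
  proof
    assume "\<forall>\<^sub>0 x. \<forall>t. 0 < t \<and> t < f (?c x) \<longrightarrow> ?c x @ [t] \<in> A"
    then have "\<forall>\<^sub>0 x. \<forall>t. 0 < t \<and> t < x ^ k \<longrightarrow> ?c x @ [t] \<in> A"
      using k by eventually_elim force
    then show ?thesis ..
  next
    assume "\<forall>\<^sub>0 x. \<not> (\<forall>t. 0 < t \<and> t < f (?c x) \<longrightarrow> ?c x @ [t] \<in> A)"
    then have "\<forall>\<^sub>0 x. \<forall>t. 0 < t \<and> t < x ^ k \<longrightarrow> ?c x @ [t] \<notin> A"
      using k
    proof eventually_elim
      case (elim x)
      then have "\<forall>t. 0 < t \<and> t < f (?c x) \<longrightarrow> ?c x @ [t] \<notin> A" using alt[of "?c x"] by blast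
      then show ?case using elim(2) by force
    qed
    then show ?thesis ..
  qed
  then show thesis using that[of k] by simp
qed

lemma complete_germ_flat:
  assumes \<gamma>: "regular_separation D \<gamma>" and y: "\<forall>\<^sub>0 x. 0 < y x"
    "\<And>k::nat. \<forall>\<^sub>0 x. y x < x ^ k"
  shows "complete_germ 4 (\<lambda>x. [x, fst (\<gamma> x), snd (\<gamma> x), y x])"
  unfolding complete_germ_def
proof (intro conjI allI ballI)
  fix A assume A: "A \<in> D 4"
  obtain k :: nat where "(\<forall>\<^sub>0 x. \<forall>t. 0 < t \<and> t < x ^ k \<longrightarrow> [x, fst (\<gamma> x), snd (\<gamma> x), t] \<in> A) \<or>
     (\<forall>\<^sub>0 x. \<forall>t. 0 < t \<and> t < x ^ k \<longrightarrow> [x, fst (\<gamma> x), snd (\<gamma> x), t] \<notin> A)"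
    by (rule flat_dichotomy[OF \<gamma> A])
  then show "(\<forall>\<^sub>0 x. [x, fst (\<gamma> x), snd (\<gamma> x), y x] \<in> A) \<or>
      (\<forall>\<^sub>0 x. [x, fst (\<gamma> x), snd (\<gamma> x), y x] \<notin> A)"
  proof
    assume "\<forall>\<^sub>0 x. \<forall>t. 0 < t \<and> t < x ^ k \<longrightarrow> [x, fst (\<gamma> x), snd (\<gamma> x), t] \<in> A"
    then have "\<forall>\<^sub>0 x. [x, fst (\<gamma> x), snd (\<gamma> x), y x] \<in> A"
      using y(1) y(2)[of k] by eventually_elim blast
    then show ?thesis ..
  next
    assume "\<forall>\<^sub>0 x. \<forall>t. 0 < t \<and> t < x ^ k \<longrightarrow> [x, fst (\<gamma> x), snd (\<gamma> x), t] \<notin> A"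
    then have "\<forall>\<^sub>0 x. [x, fst (\<gamma> x), snd (\<gamma> x), y x] \<notin> A"
      using y(1) y(2)[of k] by eventually_elim blast
    then show ?thesis ..
  qed
qed simp

end

locale flat_solutions = ominimal_structure D for D +
  fixes \<Omega> :: "(real \<times> real \<times> real) set"
    and F :: "real \<times> real \<times> real \<Rightarrow> real \<times> real"
    and \<gamma> \<delta> :: "real \<Rightarrow> real \<times> real"
  assumes open_domain: "open \<Omega>" and F_definable: "definable_map D \<Omega> F" and F_C1: "C1_on \<Omega> F"
    and solution_\<gamma>: "solution_at_0 \<Omega> F \<gamma>" and separation: "regular_separation D \<gamma>"
    and solution_\<delta>: "solution_at_0 \<Omega> F \<delta>" and flat: "flat_contact \<gamma> \<delta>"
begin

definition f1 :: "real \<Rightarrow> real \<Rightarrow> real \<Rightarrow> real" where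
  "f1 x y z = (if (x, y, z) \<in> \<Omega> then fst (F (x, y, z)) else 0)"

definition f2 :: "real \<Rightarrow> real \<Rightarrow> real \<Rightarrow> real" where
  "f2 x y z = (if (x, y, z) \<in> \<Omega> then snd (F (x, y, z)) else 0)"

abbreviation "\<gamma>\<^sub>1 x \<equiv> fst (\<gamma> x)"
abbreviation "\<gamma>\<^sub>2 x \<equiv> snd (\<gamma> x)"
abbreviation "\<delta>\<^sub>1 x \<equiv> fst (\<delta> x)"
abbreviation "\<delta>\<^sub>2 x \<equiv> snd (\<delta> x)"

lemma definable_term_f:
  assumes u: "definable_term u" and v: "definable_term v" and w: "definable_term w"
  shows "definable_term (\<lambda>e. f1 (u e) (v e) (w e))" "definable_term (\<lambda>e. f2 (u e) (v e) (w e))"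
proof -
  define S where "S = {[x, y\<^sub>1, y\<^sub>2, fst (F (x, y\<^sub>1, y\<^sub>2)), snd (F (x, y\<^sub>1, y\<^sub>2))] |x y\<^sub>1 y\<^sub>2. (x, y\<^sub>1, y\<^sub>2) \<in> \<Omega>}"
  have S: "S \<in> D (Suc (Suc (Suc (Suc (Suc 0)))))"
    using F_definable by (simp add: S_def definable_map_def numeral_eq_Suc)
  have mem: "[x, y, z, s, t] \<in> S \<longleftrightarrow> (x, y, z) \<in> \<Omega> \<and> s = fst (F (x, y, z)) \<and> t = snd (F (x, y, z))" for x y z s t
    by (auto simp: S_def)
  have 1: "t = f1 x y z \<longleftrightarrow> (\<exists>s. [x, y, z, t, s] \<in> S) \<or> (\<not> (\<exists>s s'. [x, y, z, s', s] \<in> S) \<and> t = 0)"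
    and 2: "t = f2 x y z \<longleftrightarrow> (\<exists>s. [x, y, z, s, t] \<in> S) \<or> (\<not> (\<exists>s s'. [x, y, z, s', s] \<in> S) \<and> t = 0)" for t x y z
    by (auto simp: f1_def f2_def mem)
  note sh = definable_term_shift[OF u] definable_term_shift[OF v] definable_term_shift[OF w]
  show "definable_term (\<lambda>e. f1 (u e) (v e) (w e))"
    by (rule definable_term_graph[OF _ 1]) (intro definable_intros definable_pred_mem[OF S] sh)
  show "definable_term (\<lambda>e. f2 (u e) (v e) (w e))"
    by (rule definable_term_graph[OF _ 2]) (intro definable_intros definable_pred_mem[OF S] sh)
qed

lemma solutions:
  obtains a where "a > 0"
    "\<And>x. 0 < x \<Longrightarrow> x < a \<Longrightarrow> (x, \<gamma> x) \<in> \<Omega> \<and> (\<gamma> has_vector_derivative F (x, \<gamma> x)) (at x)"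
    "\<And>x. 0 < x \<Longrightarrow> x < a \<Longrightarrow> (x, \<delta> x) \<in> \<Omega> \<and> (\<delta> has_vector_derivative F (x, \<delta> x)) (at x)"
proof -
  obtain a b where a: "a > 0" "b > 0"
    "\<forall>x\<in>{0<..<a}. (x, \<gamma> x) \<in> \<Omega> \<and> (\<gamma> has_vector_derivative F (x, \<gamma> x)) (at x)"
    "\<forall>x\<in>{0<..<b}. (x, \<delta> x) \<in> \<Omega> \<and> (\<delta> has_vector_derivative F (x, \<delta> x)) (at x)"
    using solution_\<gamma> solution_\<delta> unfolding solution_at_0_def by blast
  show thesis
    by (rule that[of "min a b"]) (use a in auto)
qed

lemma eventually_solutions:
  "\<forall>\<^sub>0 x. (x, \<gamma> x) \<in> \<Omega> \<and> (\<gamma> has_vector_derivative F (x, \<gamma> x)) (at x)"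
  "\<forall>\<^sub>0 x. (x, \<delta> x) \<in> \<Omega> \<and> (\<delta> has_vector_derivative F (x, \<delta> x)) (at x)"
proof -
  obtain a where a: "a > 0"
    "\<And>x. 0 < x \<Longrightarrow> x < a \<Longrightarrow> (x, \<gamma> x) \<in> \<Omega> \<and> (\<gamma> has_vector_derivative F (x, \<gamma> x)) (at x)"
    "\<And>x. 0 < x \<Longrightarrow> x < a \<Longrightarrow> (x, \<delta> x) \<in> \<Omega> \<and> (\<delta> has_vector_derivative F (x, \<delta> x)) (at x)"
    by (rule solutions) (rule that)
  show "\<forall>\<^sub>0 x. (x, \<gamma> x) \<in> \<Omega> \<and> (\<gamma> has_vector_derivative F (x, \<gamma> x)) (at x)"
    "\<forall>\<^sub>0 x. (x, \<delta> x) \<in> \<Omega> \<and> (\<delta> has_vector_derivative F (x, \<delta> x)) (at x)"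
    unfolding eventually_at_right_0 using a by blast+
qed

lemma coordinate_derivatives:
  assumes "(x, \<alpha> x) \<in> \<Omega>" "(\<alpha> has_vector_derivative F (x, \<alpha> x)) (at x)"
  shows "((\<lambda>x. fst (\<alpha> x)) has_real_derivative f1 x (fst (\<alpha> x)) (snd (\<alpha> x))) (at x)"
    "((\<lambda>x. snd (\<alpha> x)) has_real_derivative f2 x (fst (\<alpha> x)) (snd (\<alpha> x))) (at x)"
  using assms bounded_linear.has_vector_derivative[OF bounded_linear_fst assms(2)]
    bounded_linear.has_vector_derivative[OF bounded_linear_snd assms(2)]
  by (simp_all add: f1_def f2_def has_real_derivative_iff_has_vector_derivative)

lemma eventually_coordinate_derivatives:
  "\<forall>\<^sub>0 x. (\<gamma>\<^sub>1 has_real_derivative f1 x (\<gamma>\<^sub>1 x) (\<gamma>\<^sub>2 x)) (at x)"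
  "\<forall>\<^sub>0 x. (\<gamma>\<^sub>2 has_real_derivative f2 x (\<gamma>\<^sub>1 x) (\<gamma>\<^sub>2 x)) (at x)"
  "\<forall>\<^sub>0 x. (\<delta>\<^sub>1 has_real_derivative f1 x (\<delta>\<^sub>1 x) (\<delta>\<^sub>2 x)) (at x)"
  "\<forall>\<^sub>0 x. (\<delta>\<^sub>2 has_real_derivative f2 x (\<delta>\<^sub>1 x) (\<delta>\<^sub>2 x)) (at x)"
  by (rule eventually_mono[OF eventually_solutions(1)] eventually_mono[OF eventually_solutions(2)],
      rule coordinate_derivatives, simp, simp)+

lemma solutions_differ: "\<forall>\<^sub>0 x. \<delta> x \<noteq> \<gamma> x"
proof -
  obtain a where a: "a > 0"
    "\<And>x. 0 < x \<Longrightarrow> x < a \<Longrightarrow> (x, \<gamma> x) \<in> \<Omega> \<and> (\<gamma> has_vector_derivative F (x, \<gamma> x)) (at x)"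
    "\<And>x. 0 < x \<Longrightarrow> x < a \<Longrightarrow> (x, \<delta> x) \<in> \<Omega> \<and> (\<delta> has_vector_derivative F (x, \<delta> x)) (at x)"
    by (rule solutions) (rule that)
  define \<phi> where "\<phi> x = \<delta> x - \<gamma> x" for x
  define \<phi>' where "\<phi>' x = F (x, \<delta> x) - F (x, \<gamma> x)" for x
  have "\<phi> x0 \<noteq> 0" if x0: "0 < x0" "x0 < a" for x0
  proof
    assume z: "\<phi> x0 = 0"
    have "\<phi> x = 0" if x: "0 < x" "x < a" for x
    proof (rule zero_spreads[of a \<phi> \<phi>', OF _ _ x0 z x])
      show "(\<phi> has_vector_derivative \<phi>' y) (at y)" if "0 < y" "y < a" for y
        unfolding \<phi>_def[abs_def] \<phi>'_def using a that by (intro has_vector_derivative_diff) auto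
      fix y assume y: "0 < y" "y < a" "\<phi> y = 0"
      obtain L where "\<forall>\<^sub>F x in nhds y. (x, \<delta> x) \<in> \<Omega> \<and> (x, \<gamma> x) \<in> \<Omega> \<and>
          norm (F (x, \<delta> x) - F (x, \<gamma> x)) \<le> L * norm (\<delta> x - \<gamma> x)"
      proof (rule C1_on_lipschitz_along_curves[OF open_domain F_C1, of y \<delta> \<gamma>])
        show "isCont \<delta> y" "isCont \<gamma> y" using a(2,3)[OF y(1,2)] has_vector_derivative_continuous by blast+
        show "(y, \<delta> y) \<in> \<Omega>" using a(3)[OF y(1,2)] by blast
        show "\<gamma> y = \<delta> y" using y(3) by (simp add: \<phi>_def)
      qed
      then show "\<exists>L. \<forall>\<^sub>F x in nhds y. norm (\<phi>' x) \<le> L * norm (\<phi> x)"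
        unfolding \<phi>_def \<phi>'_def by (auto elim: eventually_mono)
    qed
    then have "\<forall>\<^sub>0 x. \<gamma> x = \<delta> x"
      unfolding eventually_at_right_0 using a(1) by (auto simp: \<phi>_def)
    then show False using flat by (simp add: flat_contact_def different_germs_def)
  qed
  then show ?thesis unfolding eventually_at_right_0 using a(1) by (auto simp: \<phi>_def)
qed

lemma flat_components:
  "\<forall>\<^sub>0 x. \<bar>\<delta>\<^sub>1 x - \<gamma>\<^sub>1 x\<bar> < x ^ k" "\<forall>\<^sub>0 x. \<bar>\<delta>\<^sub>2 x - \<gamma>\<^sub>2 x\<bar> < x ^ k"
proof -
  have "\<forall>\<^sub>0 x. norm (\<delta> x - \<gamma> x) \<le> x ^ Suc k"
    using flat unfolding flat_contact_def by blast
  moreover have "\<forall>\<^sub>0 x. 0 < x \<and> x < 1"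
    unfolding eventually_at_right_0 by (auto intro: exI[of _ 1])
  ultimately have n: "\<forall>\<^sub>0 x. norm (\<delta> x - \<gamma> x) < x ^ k"
  proof eventually_elim
    case (elim x)
    then have "x ^ Suc k < x ^ k" by simp
    then show ?case using elim by linarith
  qed
  have le: "\<bar>\<delta>\<^sub>1 x - \<gamma>\<^sub>1 x\<bar> \<le> norm (\<delta> x - \<gamma> x)" "\<bar>\<delta>\<^sub>2 x - \<gamma>\<^sub>2 x\<bar> \<le> norm (\<delta> x - \<gamma> x)" for x
  proof -
    have "norm (fst p) \<le> norm p" "norm (snd p) \<le> norm p" for p :: "real \<times> real"
      by (metis norm_fst_le prod.collapse, metis norm_snd_le prod.collapse)
    from this[of "\<delta> x - \<gamma> x"] show "\<bar>\<delta>\<^sub>1 x - \<gamma>\<^sub>1 x\<bar> \<le> norm (\<delta> x - \<gamma> x)"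
      "\<bar>\<delta>\<^sub>2 x - \<gamma>\<^sub>2 x\<bar> \<le> norm (\<delta> x - \<gamma> x)" by simp_all
  qed
  show "\<forall>\<^sub>0 x. \<bar>\<delta>\<^sub>1 x - \<gamma>\<^sub>1 x\<bar> < x ^ k"
    using n by eventually_elim (use le in \<open>blast intro: le_less_trans\<close>)
  show "\<forall>\<^sub>0 x. \<bar>\<delta>\<^sub>2 x - \<gamma>\<^sub>2 x\<bar> < x ^ k"
    using n by eventually_elim (use le in \<open>blast intro: le_less_trans\<close>)
qed

text \<open>All crossings of the half axis \<open>\<epsilon>\<^sub>1 = 0 < \<sigma> \<epsilon>\<^sub>2\<close> by \<open>\<epsilon> = \<delta> - \<gamma>\<close> have the same direction, because
  the sign of \<open>\<epsilon>\<^sub>1'\<close> there is that of a definable function of \<open>(x, \<gamma> x, \<sigma> \<epsilon>\<^sub>2)\<close>. If \<open>\<epsilon>\<^sub>1'\<close> vanishes there,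
  the half axis is invariant.\<close>

lemma half_axis_crossing:
  assumes \<sigma>: "\<sigma> = 1 \<or> \<sigma> = (-1::real)"
  defines "d \<equiv> \<lambda>x. f1 x (\<delta>\<^sub>1 x) (\<delta>\<^sub>2 x) - f1 x (\<gamma>\<^sub>1 x) (\<gamma>\<^sub>2 x)"
  shows "(\<forall>\<^sub>0 x. \<delta>\<^sub>1 x - \<gamma>\<^sub>1 x = 0 \<and> \<sigma> * (\<delta>\<^sub>2 x - \<gamma>\<^sub>2 x) > 0 \<longrightarrow> d x > 0) \<or>
    (\<forall>\<^sub>0 x. \<delta>\<^sub>1 x - \<gamma>\<^sub>1 x = 0 \<and> \<sigma> * (\<delta>\<^sub>2 x - \<gamma>\<^sub>2 x) > 0 \<longrightarrow> d x < 0) \<or>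
    (\<forall>\<^sub>0 x. \<delta>\<^sub>1 x - \<gamma>\<^sub>1 x = 0)"
proof -
  define h where "h x u v t = f1 x u (v + \<sigma> * t) - f1 x u v" for x u v t
  have dh: "definable_term u \<Longrightarrow> definable_term v \<Longrightarrow> definable_term w \<Longrightarrow> definable_term z \<Longrightarrow> definable_term (\<lambda>e. h (u e) (v e) (w e) (z e))" for u v w z
    unfolding h_def by (intro definable_intros definable_term_f)
  have \<sigma>\<sigma>: "\<sigma> * (\<sigma> * t) = t" for t using \<sigma> by auto
  have d_h: "d x = h x (\<gamma>\<^sub>1 x) (\<gamma>\<^sub>2 x) (\<sigma> * (\<delta>\<^sub>2 x - \<gamma>\<^sub>2 x))" if "\<delta>\<^sub>1 x - \<gamma>\<^sub>1 x = 0" for x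
    using that by (simp add: d_def h_def \<sigma>\<sigma>)
  have small: "\<forall>\<^sub>0 x. \<sigma> * (\<delta>\<^sub>2 x - \<gamma>\<^sub>2 x) < x ^ k" for k
    using flat_components(2)[of k] by eventually_elim (use \<sigma> in auto)
  define P where "P = {xs. length xs = 4 \<and> h (xs ! 0) (xs ! 1) (xs ! 2) (xs ! 3) > 0}"
  define N where "N = {xs. length xs = 4 \<and> h (xs ! 0) (xs ! 1) (xs ! 2) (xs ! 3) < 0}"
  have P: "P \<in> D 4" unfolding P_def by (rule definable_pred_Collect) (intro definable_intros dh; simp)
  have N: "N \<in> D 4" unfolding N_def by (rule definable_pred_Collect) (intro definable_intros dh; simp)
  have mem: "[x, u, v, t] \<in> P \<longleftrightarrow> h x u v t > 0" "[x, u, v, t] \<in> N \<longleftrightarrow> h x u v t < 0" for x u v t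
    by (simp_all add: P_def N_def)
  obtain k1 where "(\<forall>\<^sub>0 x. \<forall>t. 0 < t \<and> t < x ^ k1 \<longrightarrow> [x, \<gamma>\<^sub>1 x, \<gamma>\<^sub>2 x, t] \<in> P) \<or>
     (\<forall>\<^sub>0 x. \<forall>t. 0 < t \<and> t < x ^ k1 \<longrightarrow> [x, \<gamma>\<^sub>1 x, \<gamma>\<^sub>2 x, t] \<notin> P)"
    by (rule flat_dichotomy[OF separation P])
  moreover obtain k2 where "(\<forall>\<^sub>0 x. \<forall>t. 0 < t \<and> t < x ^ k2 \<longrightarrow> [x, \<gamma>\<^sub>1 x, \<gamma>\<^sub>2 x, t] \<in> N) \<or>
     (\<forall>\<^sub>0 x. \<forall>t. 0 < t \<and> t < x ^ k2 \<longrightarrow> [x, \<gamma>\<^sub>1 x, \<gamma>\<^sub>2 x, t] \<notin> N)"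
    by (rule flat_dichotomy[OF separation N])
  ultimately consider
      (pos) "\<forall>\<^sub>0 x. \<forall>t. 0 < t \<and> t < x ^ k1 \<longrightarrow> h x (\<gamma>\<^sub>1 x) (\<gamma>\<^sub>2 x) t > 0"
    | (neg) "\<forall>\<^sub>0 x. \<forall>t. 0 < t \<and> t < x ^ k2 \<longrightarrow> h x (\<gamma>\<^sub>1 x) (\<gamma>\<^sub>2 x) t < 0"
    | (zero) "\<forall>\<^sub>0 x. \<forall>t. 0 < t \<and> t < x ^ k1 \<longrightarrow> \<not> h x (\<gamma>\<^sub>1 x) (\<gamma>\<^sub>2 x) t > 0"
        "\<forall>\<^sub>0 x. \<forall>t. 0 < t \<and> t < x ^ k2 \<longrightarrow> \<not> h x (\<gamma>\<^sub>1 x) (\<gamma>\<^sub>2 x) t < 0"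
    unfolding mem by blast
  then show ?thesis
  proof cases
    case pos
    then have "\<forall>\<^sub>0 x. \<delta>\<^sub>1 x - \<gamma>\<^sub>1 x = 0 \<and> \<sigma> * (\<delta>\<^sub>2 x - \<gamma>\<^sub>2 x) > 0 \<longrightarrow> d x > 0"
      using small[of k1] by eventually_elim (simp add: d_h)
    then show ?thesis by blast
  next
    case neg
    then have "\<forall>\<^sub>0 x. \<delta>\<^sub>1 x - \<gamma>\<^sub>1 x = 0 \<and> \<sigma> * (\<delta>\<^sub>2 x - \<gamma>\<^sub>2 x) > 0 \<longrightarrow> d x < 0"
      using small[of k2] by eventually_elim (simp add: d_h)
    then show ?thesis by blast
  next
    case zero
    have ev: "\<forall>\<^sub>0 x. (\<sigma> * (\<delta>\<^sub>2 x - \<gamma>\<^sub>2 x) > 0 \<longrightarrow> h x (\<gamma>\<^sub>1 x) (\<gamma>\<^sub>2 x) (\<sigma> * (\<delta>\<^sub>2 x - \<gamma>\<^sub>2 x)) = 0) \<and>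
        \<delta> x \<noteq> \<gamma> x \<and> ((x, \<gamma> x) \<in> \<Omega> \<and> (\<gamma> has_vector_derivative F (x, \<gamma> x)) (at x)) \<and>
        ((x, \<delta> x) \<in> \<Omega> \<and> (\<delta> has_vector_derivative F (x, \<delta> x)) (at x))"
      using zero small[of k1] small[of k2] solutions_differ eventually_solutions
      by eventually_elim (auto simp: not_less intro: antisym)
    then obtain a where a: "a > 0" and
      ax: "\<And>x. 0 < x \<Longrightarrow> x < a \<Longrightarrow> \<sigma> * (\<delta>\<^sub>2 x - \<gamma>\<^sub>2 x) > 0 \<Longrightarrow> h x (\<gamma>\<^sub>1 x) (\<gamma>\<^sub>2 x) (\<sigma> * (\<delta>\<^sub>2 x - \<gamma>\<^sub>2 x)) = 0"
      "\<And>x. 0 < x \<Longrightarrow> x < a \<Longrightarrow> \<delta> x \<noteq> \<gamma> x"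
      "\<And>x. 0 < x \<Longrightarrow> x < a \<Longrightarrow> (x, \<gamma> x) \<in> \<Omega> \<and> (\<gamma> has_vector_derivative F (x, \<gamma> x)) (at x)"
      "\<And>x. 0 < x \<Longrightarrow> x < a \<Longrightarrow> (x, \<delta> x) \<in> \<Omega> \<and> (\<delta> has_vector_derivative F (x, \<delta> x)) (at x)"
      unfolding eventually_at_right_0 by blast
    define \<phi> where "\<phi> x = \<delta>\<^sub>1 x - \<gamma>\<^sub>1 x" for x
    define \<psi> where "\<psi> x = \<sigma> * (\<delta>\<^sub>2 x - \<gamma>\<^sub>2 x)" for x
    have deriv: "(\<phi> has_real_derivative d x) (at x)" if "0 < x" "x < a" for x
      unfolding \<phi>_def[abs_def] d_def using coordinate_derivatives ax(3,4)[OF that] by (intro DERIV_diff) auto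
    have cont: "isCont \<gamma> x" "isCont \<delta> x" if "0 < x" "x < a" for x
      using ax(3,4)[OF that] has_vector_derivative_continuous by auto
    have lim\<psi>: "(\<psi> \<longlongrightarrow> \<psi> x) (nhds x)" if "0 < x" "x < a" for x
    proof -
      have "isCont \<psi> x" unfolding \<psi>_def[abs_def] using cont[OF that] by (intro continuous_intros)
      then show ?thesis by (simp add: continuous_at tendsto_nhds_iff)
    qed
    have lim\<phi>: "(\<phi> \<longlongrightarrow> \<phi> x) (nhds x)" if "0 < x" "x < a" for x
      using DERIV_isCont[OF deriv[OF that]] by (simp add: continuous_at tendsto_nhds_iff)
    have "\<exists>b. \<forall>x\<in>{0<..<a}. (\<phi> x = 0 \<and> \<psi> x > 0) = b"
    proof (rule constant_if_locally_constant[OF connected_Ioo])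
      fix z assume "z \<in> {0<..<a}"
      then have z: "0 < z" "z < a" by auto
      have nz: "\<forall>\<^sub>F x in nhds z. 0 < x \<and> x < a"
        using eventually_nhds_in_open[of "{0<..<a}" z] z by simp
      show "\<forall>\<^sub>F x in nhds z. (\<phi> x = 0 \<and> \<psi> x > 0) = (\<phi> z = 0 \<and> \<psi> z > 0)"
      proof (cases "\<phi> z = 0 \<and> \<psi> z > 0")
        case True
        have eq: "(\<gamma>\<^sub>1 z, \<delta>\<^sub>2 z) = \<delta> z" using True by (simp add: \<phi>_def prod_eq_iff)
        have \<psi>pos: "\<forall>\<^sub>F x in nhds z. \<psi> x > 0" using order_tendstoD(1)[OF lim\<psi>[OF z]] True by blast
        have c: "isCont (\<lambda>x. (\<gamma>\<^sub>1 x, \<delta>\<^sub>2 x)) z" using cont[OF z] by (intro continuous_intros)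
        obtain L where L: "L \<ge> 0" "\<forall>\<^sub>F x in nhds z. (x, \<delta> x) \<in> \<Omega> \<and> (x, (\<gamma>\<^sub>1 x, \<delta>\<^sub>2 x)) \<in> \<Omega> \<and>
          norm (F (x, \<delta> x) - F (x, (\<gamma>\<^sub>1 x, \<delta>\<^sub>2 x))) \<le> L * norm (\<delta> x - (\<gamma>\<^sub>1 x, \<delta>\<^sub>2 x))"
          by (rule C1_on_lipschitz_along_curves[OF open_domain F_C1, of z \<delta> "\<lambda>x. (\<gamma>\<^sub>1 x, \<delta>\<^sub>2 x)"])
            (use ax(4)[OF z] eq cont(2)[OF z] c in auto)
        have "\<forall>\<^sub>F x in nhds z. norm (d x) \<le> L * norm (\<phi> x)"
          using L(2) \<psi>pos nz
        proof eventually_elim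
          case (elim x)
          have "f1 x (\<gamma>\<^sub>1 x) (\<delta>\<^sub>2 x) - f1 x (\<gamma>\<^sub>1 x) (\<gamma>\<^sub>2 x) = 0"
            using ax(1)[of x] elim by (simp add: h_def \<psi>_def \<sigma>\<sigma>)
          then have "d x = fst (F (x, \<delta> x) - F (x, (\<gamma>\<^sub>1 x, \<delta>\<^sub>2 x)))"
            using elim by (simp add: d_def f1_def)
          then have "norm (d x) \<le> norm (F (x, \<delta> x) - F (x, (\<gamma>\<^sub>1 x, \<delta>\<^sub>2 x)))"
            using norm_fst_le by (metis prod.collapse)
          also have "\<dots> \<le> L * norm (\<delta> x - (\<gamma>\<^sub>1 x, \<delta>\<^sub>2 x))" using elim by blast
          also have "\<delta> x - (\<gamma>\<^sub>1 x, \<delta>\<^sub>2 x) = (\<phi> x, 0)" by (simp add: prod_eq_iff \<phi>_def)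
          finally show ?case by (simp add: norm_Pair)
        qed
        moreover have "\<forall>\<^sub>F x in nhds z. (\<phi> has_vector_derivative d x) (at x)"
          using nz by eventually_elim (use deriv in \<open>simp add: has_real_derivative_iff_has_vector_derivative\<close>)
        ultimately have "\<forall>\<^sub>F x in nhds z. \<phi> x = 0"
          using True by (intro zero_spreads_locally[of \<phi> d z L]) auto
        then show ?thesis using \<psi>pos by eventually_elim (use True in simp)
      next
        case False
        show ?thesis
        proof (cases "\<phi> z = 0")
          case True
          then have "\<psi> z \<noteq> 0" using ax(2)[OF z] \<sigma> by (auto simp: \<phi>_def \<psi>_def prod_eq_iff)
          then have "\<psi> z < 0" using False True by simp
          from order_tendstoD(2)[OF lim\<psi>[OF z] this] show ?thesis
            by eventually_elim (use False in simp)
        next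
          case False
          then have "\<forall>\<^sub>F x in nhds z. \<phi> x \<noteq> 0"
            using topological_tendstoD[OF lim\<phi>[OF z], of "- {0}"] by auto
          then show ?thesis by eventually_elim (use False in simp)
        qed
      qed
    qed
    then obtain b where b0: "\<forall>x\<in>{0<..<a}. (\<phi> x = 0 \<and> \<psi> x > 0) = b" ..
    have b: "(\<phi> x = 0 \<and> \<psi> x > 0) = b" if "0 < x" "x < a" for x
      using bspec[OF b0, of x] that by simp
    show ?thesis
    proof (cases b)
      case True
      then have "\<forall>\<^sub>0 x. \<phi> x = 0"
        unfolding eventually_at_right_0 using a b by blast
      then show ?thesis by (simp add: \<phi>_def)
    next
      case False
      then have "\<forall>\<^sub>0 x. \<phi> x = 0 \<and> \<psi> x > 0 \<longrightarrow> d x > 0"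
        unfolding eventually_at_right_0 using a b by blast
      then show ?thesis unfolding \<phi>_def \<psi>_def by blast
    qed
  qed
qed

lemma trichotomy:
  shows "(\<forall>\<^sub>0 x. \<delta>\<^sub>1 x - \<gamma>\<^sub>1 x = 0) \<or> (\<forall>\<^sub>0 x. \<delta>\<^sub>1 x - \<gamma>\<^sub>1 x \<noteq> 0) \<or>
    interlaced \<gamma> \<delta>"
proof -
  define \<phi> where "\<phi> x = \<delta>\<^sub>1 x - \<gamma>\<^sub>1 x" for x
  define \<psi> where "\<psi> x = \<delta>\<^sub>2 x - \<gamma>\<^sub>2 x" for x
  define d where "d x = f1 x (\<delta>\<^sub>1 x) (\<delta>\<^sub>2 x) - f1 x (\<gamma>\<^sub>1 x) (\<gamma>\<^sub>2 x)" for x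
  have deriv: "\<forall>\<^sub>0 x. (\<phi> has_real_derivative d x) (at x)"
    using eventually_coordinate_derivatives(1,3) unfolding \<phi>_def[abs_def] d_def
    by eventually_elim (intro DERIV_diff)
  have nz: "\<forall>\<^sub>0 x. \<phi> x = 0 \<longrightarrow> \<psi> x > 0 \<or> \<psi> x < 0"
    using solutions_differ by eventually_elim (auto simp: \<phi>_def \<psi>_def prod_eq_iff)
  have rotating: "filterlim \<theta> at_bot (at_right 0)"
    if acc: "\<not> (\<forall>\<^sub>0 x. \<phi> x \<noteq> 0)" and a: "a > 0"
      and cont: "continuous_on {0<..<a} \<theta>"
      and \<theta>: "\<And>x. 0 < x \<Longrightarrow> x < a \<Longrightarrow> norm (\<delta> x - \<gamma> x) > 0 \<and> \<phi> x = norm (\<delta> x - \<gamma> x) * cos (\<theta> x)"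
      and cross: "\<forall>\<^sub>0 x. \<phi> x = 0 \<longrightarrow> d x * sin (\<theta> x) < 0" for a \<theta>
  proof -
    obtain b where b: "b > 0" "\<And>x. 0 < x \<Longrightarrow> x < b \<Longrightarrow> (\<phi> has_real_derivative d x) (at x) \<and> (\<phi> x = 0 \<longrightarrow> d x * sin (\<theta> x) < 0)"
      using eventually_conj[OF deriv cross] unfolding eventually_at_right_0 by blast
    show ?thesis
    proof (rule rotation_at_bot[of "min a b" \<theta> "\<lambda>x. norm (\<delta> x - \<gamma> x)" \<phi> d])
      show "isCont \<theta> x" if "0 < x" "x < min a b" for x
        using cont that by (simp add: continuous_on_eq_continuous_at)
      show "\<exists>x>0. x < c \<and> \<phi> x = 0" if "c > 0" for c
        using acc that unfolding eventually_at_right_0 by blast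
    qed (use a b \<theta> in auto)
  qed
  have pol: "\<phi> x = norm (\<delta> x - \<gamma> x) * cos (\<theta> x)" "\<psi> x = norm (\<delta> x - \<gamma> x) * sin (\<theta> x)" "norm (\<delta> x - \<gamma> x) > 0"
    if "angle_measure a (\<lambda>x. \<delta> x - \<gamma> x) \<theta>" "0 < x" "x < a" for a \<theta> x
  proof -
    have *: "\<delta> x - \<gamma> x \<noteq> 0" "(\<delta> x - \<gamma> x) /\<^sub>R norm (\<delta> x - \<gamma> x) = (cos (\<theta> x), sin (\<theta> x))"
      using that unfolding angle_measure_def by auto
    show n: "norm (\<delta> x - \<gamma> x) > 0" using *(1) by simp
    have "fst (\<delta> x - \<gamma> x) / norm (\<delta> x - \<gamma> x) = cos (\<theta> x)" "snd (\<delta> x - \<gamma> x) / norm (\<delta> x - \<gamma> x) = sin (\<theta> x)"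
      using arg_cong[OF *(2), of fst] arg_cong[OF *(2), of snd] by (simp_all add: divide_inverse mult.commute)
    then show "\<phi> x = norm (\<delta> x - \<gamma> x) * cos (\<theta> x)" "\<psi> x = norm (\<delta> x - \<gamma> x) * sin (\<theta> x)"
      using n by (auto simp: \<phi>_def \<psi>_def field_simps)
  qed
  have il: "interlaced \<gamma> \<delta>" if acc: "\<not> (\<forall>\<^sub>0 x. \<phi> x \<noteq> 0)"
    and cross: "(\<forall>\<^sub>0 x. \<phi> x = 0 \<longrightarrow> d x * \<psi> x < 0) \<or> (\<forall>\<^sub>0 x. \<phi> x = 0 \<longrightarrow> d x * \<psi> x > 0)"
    unfolding interlaced_def
  proof (intro conjI allI impI)
    show "\<forall>\<^sub>0 x. \<delta> x \<noteq> \<gamma> x" by (rule solutions_differ)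
    fix a :: real and \<theta> :: "real \<Rightarrow> real"
    assume a: "a > 0" and am: "angle_measure a (\<lambda>x. \<delta> x - \<gamma> x) \<theta>"
    note p = pol[OF am]
    have cont: "continuous_on {0<..<a} \<theta>" using am by (simp add: angle_measure_def)
    have ev: "\<forall>\<^sub>0 x. 0 < x \<and> x < a" unfolding eventually_at_right_0 using a by blast
    from cross show "filterlim \<theta> at_top (at_right 0) \<or> filterlim \<theta> at_bot (at_right 0)"
    proof
      assume "\<forall>\<^sub>0 x. \<phi> x = 0 \<longrightarrow> d x * \<psi> x < 0"
      then have "\<forall>\<^sub>0 x. \<phi> x = 0 \<longrightarrow> d x * sin (\<theta> x) < 0"
        using ev
      proof eventually_elim
        case (elim x)
        have "d x * \<psi> x = norm (\<delta> x - \<gamma> x) * (d x * sin (\<theta> x))" using p(2)[of x] elim by simp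
        then show ?case using elim mult_less_cancel_left_pos[OF p(3)[of x], of "d x * sin (\<theta> x)" 0]
          by (simp only: mult_zero_right)
      qed
      then have "filterlim \<theta> at_bot (at_right 0)"
        by (intro rotating[OF acc a cont]) (use p in auto)
      then show ?thesis ..
    next
      assume "\<forall>\<^sub>0 x. \<phi> x = 0 \<longrightarrow> d x * \<psi> x > 0"
      then have "\<forall>\<^sub>0 x. \<phi> x = 0 \<longrightarrow> d x * sin (- \<theta> x) < 0"
        using ev
      proof eventually_elim
        case (elim x)
        have "d x * \<psi> x = norm (\<delta> x - \<gamma> x) * (d x * sin (\<theta> x))" using p(2)[of x] elim by simp
        then show ?case using elim mult_less_cancel_left_pos[OF p(3)[of x], of 0 "d x * sin (\<theta> x)"]
          by (simp only: mult_zero_right sin_minus mult_minus_right neg_less_0_iff_less)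
      qed
      then have "filterlim (\<lambda>x. - \<theta> x) at_bot (at_right 0)"
        by (intro rotating[OF acc a continuous_on_minus[OF cont]]) (use p in auto)
      then have "filterlim \<theta> at_top (at_right 0)" by (simp add: filterlim_uminus_at_top)
      then show ?thesis ..
    qed
  qed
  have same_pos: "\<forall>\<^sub>0 x. \<phi> x \<noteq> 0" if "\<forall>\<^sub>0 x. \<phi> x = 0 \<longrightarrow> d x > 0"
    by (rule eventually_nonzero_if_same_crossing[OF deriv that])
  have same_neg: "\<forall>\<^sub>0 x. \<phi> x \<noteq> 0" if "\<forall>\<^sub>0 x. \<phi> x = 0 \<longrightarrow> d x < 0"
  proof -
    have "\<forall>\<^sub>0 x. ((\<lambda>x. - \<phi> x) has_real_derivative - d x) (at x)"
      using deriv by eventually_elim (intro DERIV_minus)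
    from eventually_nonzero_if_same_crossing[OF this] that show ?thesis by simp
  qed
  have up: "(\<forall>\<^sub>0 x. \<phi> x = 0 \<and> \<psi> x > 0 \<longrightarrow> d x > 0) \<or> (\<forall>\<^sub>0 x. \<phi> x = 0 \<and> \<psi> x > 0 \<longrightarrow> d x < 0) \<or>
      (\<forall>\<^sub>0 x. \<phi> x = 0)"
    using half_axis_crossing[of 1] by (simp add: \<phi>_def \<psi>_def d_def)
  have down: "(\<forall>\<^sub>0 x. \<phi> x = 0 \<and> \<psi> x < 0 \<longrightarrow> d x > 0) \<or> (\<forall>\<^sub>0 x. \<phi> x = 0 \<and> \<psi> x < 0 \<longrightarrow> d x < 0) \<or>
      (\<forall>\<^sub>0 x. \<phi> x = 0)"
    using half_axis_crossing[of "-1"] by (simp add: \<phi>_def \<psi>_def d_def)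
  consider "\<forall>\<^sub>0 x. \<phi> x = 0"
    | (pp) "\<forall>\<^sub>0 x. \<phi> x = 0 \<and> \<psi> x > 0 \<longrightarrow> d x > 0" "\<forall>\<^sub>0 x. \<phi> x = 0 \<and> \<psi> x < 0 \<longrightarrow> d x > 0"
    | (pn) "\<forall>\<^sub>0 x. \<phi> x = 0 \<and> \<psi> x > 0 \<longrightarrow> d x > 0" "\<forall>\<^sub>0 x. \<phi> x = 0 \<and> \<psi> x < 0 \<longrightarrow> d x < 0"
    | (np) "\<forall>\<^sub>0 x. \<phi> x = 0 \<and> \<psi> x > 0 \<longrightarrow> d x < 0" "\<forall>\<^sub>0 x. \<phi> x = 0 \<and> \<psi> x < 0 \<longrightarrow> d x > 0"
    | (nn) "\<forall>\<^sub>0 x. \<phi> x = 0 \<and> \<psi> x > 0 \<longrightarrow> d x < 0" "\<forall>\<^sub>0 x. \<phi> x = 0 \<and> \<psi> x < 0 \<longrightarrow> d x < 0"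
    using up down by blast
  then have "(\<forall>\<^sub>0 x. \<phi> x = 0) \<or> (\<forall>\<^sub>0 x. \<phi> x \<noteq> 0) \<or> interlaced \<gamma> \<delta>"
  proof cases
    case pp
    then have "\<forall>\<^sub>0 x. \<phi> x = 0 \<longrightarrow> d x > 0" using nz by eventually_elim blast
    then show ?thesis using same_pos by blast
  next
    case nn
    then have "\<forall>\<^sub>0 x. \<phi> x = 0 \<longrightarrow> d x < 0" using nz by eventually_elim blast
    then show ?thesis using same_neg by blast
  next
    case pn
    then have "\<forall>\<^sub>0 x. \<phi> x = 0 \<longrightarrow> d x * \<psi> x > 0"
      using nz by eventually_elim (auto simp: zero_less_mult_iff)
    then show ?thesis using il by blast
  next
    case np
    then have "\<forall>\<^sub>0 x. \<phi> x = 0 \<longrightarrow> d x * \<psi> x < 0"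
      using nz by eventually_elim (auto simp: mult_less_0_iff)
    then show ?thesis using il by blast
  qed blast
  then show ?thesis by (simp add: \<phi>_def)
qed

end

definition fibre_boundary :: "real list set \<Rightarrow> real list \<Rightarrow> real \<Rightarrow> bool" where
  "fibre_boundary A p t \<longleftrightarrow> (\<forall>r>0. (\<exists>s. \<bar>s - t\<bar> < r \<and> p @ [s] \<in> A) \<and> (\<exists>s. \<bar>s - t\<bar> < r \<and> p @ [s] \<notin> A))"

lemma same_side_if_no_boundary:
  assumes "\<And>s. min t u \<le> s \<Longrightarrow> s \<le> max t u \<Longrightarrow> \<not> fibre_boundary A p s"
  shows "p @ [t] \<in> A \<longleftrightarrow> p @ [u] \<in> A"
proof -
  have "\<exists>b. \<forall>s\<in>{min t u..max t u}. (p @ [s] \<in> A) = b"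
  proof (rule constant_if_locally_constant)
    fix s assume "s \<in> {min t u..max t u}"
    then obtain r where r: "r > 0" "(\<forall>z. \<bar>z - s\<bar> < r \<longrightarrow> p @ [z] \<notin> A) \<or> (\<forall>z. \<bar>z - s\<bar> < r \<longrightarrow> p @ [z] \<in> A)"
      using assms[of s] by (auto simp: fibre_boundary_def)
    then show "\<forall>\<^sub>F z in nhds s. (p @ [z] \<in> A) = (p @ [s] \<in> A)"
      unfolding eventually_nhds_metric dist_real_def by (intro exI[of _ r]) auto
  qed simp
  then show ?thesis by (metis atLeastAtMost_iff max.cobounded1 max.cobounded2 min.cobounded1 min.cobounded2)
qed

context ominimal_structure
begin

lemma definable_pred_fibre_boundary:
  assumes A: "A \<in> D (Suc m)" and "definable_vec m v" "definable_term u"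
  shows "definable_pred (\<lambda>e. fibre_boundary A (v e) (u e))"
  unfolding fibre_boundary_def
  by (intro definable_intros definable_pred_mem[OF A] definable_vec_shift[OF assms(2)] definable_term_shift[OF assms(3)])

lemma finite_fibre_boundary:
  assumes A: "A \<in> D (Suc m)" and p: "length p = m"
  shows "finite {t. fibre_boundary A p t}"
proof (rule ccontr)
  assume inf: "infinite {t. fibre_boundary A p t}"
  have "definable_pred (\<lambda>e. fibre_boundary A p (e 0))" by (intro definable_pred_fibre_boundary[OF A] definable_intros p)
  from infinite_contains_interval[OF this inf]
  obtain u v where uv: "u < v" "\<And>t. u \<le> t \<Longrightarrow> t \<le> v \<Longrightarrow> fibre_boundary A p t" by metis
  have mem: "definable_pred (\<lambda>e. p @ [e 0] \<in> A)" by (rule definable_pred_mem[OF A]) (intro definable_intros p)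
  define P where "P t \<longleftrightarrow> (u < t \<and> t < v) \<and> p @ [t] \<in> A" for t
  define N where "N t \<longleftrightarrow> (u < t \<and> t < v) \<and> p @ [t] \<notin> A" for t
  have dP: "definable_pred (\<lambda>e. P (e 0))" unfolding P_def by (intro definable_intros mem)
  have dN: "definable_pred (\<lambda>e. N (e 0))" unfolding N_def by (intro definable_intros mem)
  have "{u<..<v} = {t. P t} \<union> {t. N t}" by (auto simp: P_def N_def)
  moreover have "infinite {u<..<v}" using uv(1) by (rule infinite_Ioo)
  ultimately have "infinite {t. P t} \<or> infinite {t. N t}" by (metis finite_Un)
  then obtain a b where ab: "a < b" "(\<forall>t. a \<le> t \<and> t \<le> b \<longrightarrow> P t) \<or> (\<forall>t. a \<le> t \<and> t \<le> b \<longrightarrow> N t)"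
    using infinite_contains_interval[OF dP] infinite_contains_interval[OF dN] by metis
  define c where "c = (a + b) / 2"
  have c: "a < c" "c < b" using ab(1) by (auto simp: c_def)
  have "u \<le> c" "c \<le> v" using ab(2) c by (auto simp: P_def N_def intro: less_imp_le)
  then have "fibre_boundary A p c" by (rule uv(2))
  moreover have "min (c - a) (b - c) > 0" using c by simp
  ultimately obtain s s' where "\<bar>s - c\<bar> < min (c - a) (b - c)" "p @ [s] \<in> A" "\<bar>s' - c\<bar> < min (c - a) (b - c)" "p @ [s'] \<notin> A"
    unfolding fibre_boundary_def by blast
  moreover from this have "a \<le> s \<and> s \<le> b" "a \<le> s' \<and> s' \<le> b" by linarith+
  ultimately show False using ab(2) by (auto simp: P_def N_def)
qed

end

context flat_solutions
begin

definition c4 :: "real \<Rightarrow> real list" where "c4 x = [x, \<gamma>\<^sub>1 x, \<gamma>\<^sub>2 x, \<delta>\<^sub>1 x]"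

definition c5 :: "real \<Rightarrow> real list" where "c5 x = [x, \<gamma>\<^sub>1 x, \<gamma>\<^sub>2 x, \<delta>\<^sub>1 x, \<delta>\<^sub>2 x]"

definition speed :: "nat \<Rightarrow> real list \<Rightarrow> real \<Rightarrow> real" where
  "speed j p t = [1, f1 (p ! 0) (p ! 1) (p ! 2), f2 (p ! 0) (p ! 1) (p ! 2), f1 (p ! 0) (p ! 3) t,
     f2 (p ! 0) (p ! 3) t] ! j"

lemma less_4_cases: "j < 4 \<Longrightarrow> j = 0 \<or> j = 1 \<or> j = 2 \<or> j = (3::nat)"
  by auto

lemma speed_simps: "speed 0 p t = 1" "speed 1 p t = f1 (p ! 0) (p ! 1) (p ! 2)"
  "speed 2 p t = f2 (p ! 0) (p ! 1) (p ! 2)" "speed 3 p t = f1 (p ! 0) (p ! 3) t"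
  "speed 4 p t = f2 (p ! 0) (p ! 3) t"
  by (simp_all add: speed_def numeral_eq_Suc)

lemma c4_nth: "c4 x ! 0 = x" "c4 x ! 1 = \<gamma>\<^sub>1 x" "c4 x ! 2 = \<gamma>\<^sub>2 x" "c4 x ! 3 = \<delta>\<^sub>1 x"
  by (simp_all add: c4_def)

lemma speed_c4:
  assumes "j < 4"
  shows "\<forall>\<^sub>0 x. ((\<lambda>x. c4 x ! j) has_real_derivative speed j (c4 x) (\<delta>\<^sub>2 x)) (at x)"
  using less_4_cases[OF assms]
  by (elim disjE) (simp_all only: c4_nth speed_simps DERIV_ident eventually_True eventually_coordinate_derivatives)

lemma definable_term_speed:
  assumes p: "definable_vec m p" and m: "m \<ge> 4" and t: "definable_term t" and j: "j < 5"
  shows "definable_term (\<lambda>e. speed j (p e) (t e))"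
proof -
  have n: "definable_term (\<lambda>e. p e ! 0)" "definable_term (\<lambda>e. p e ! 1)" "definable_term (\<lambda>e. p e ! 2)" "definable_term (\<lambda>e. p e ! 3)"
    by (rule definable_term_nth[OF p], use m in simp)+
  have "j = 0 \<or> j = 1 \<or> j = 2 \<or> j = 3 \<or> j = 4" using j by auto
  then show ?thesis
    by (elim disjE) (simp_all only: speed_simps, (intro definable_term_const definable_term_f n t)+)
qed

lemma definable_comparison:
  assumes c: "complete_germ 4 c4" and g: "definable_op 4 g"
  shows "(\<forall>\<^sub>0 x. \<delta>\<^sub>2 x = g (c4 x)) \<or> (\<forall>\<^sub>0 x. \<delta>\<^sub>2 x > g (c4 x)) \<or>
    (\<forall>\<^sub>0 x. \<delta>\<^sub>2 x < g (c4 x))"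
proof -
  obtain k sel Dl where sel': "\<forall>l<k. sel l < 4" and Dl': "\<forall>l<k. definable_op 4 (Dl l)"
    and dg: "\<forall>\<^sub>0 x. ((\<lambda>x. g (c4 x)) has_real_derivative
      (\<Sum>l<(k::nat). Dl l (c4 x) * speed (sel l) (c4 x) (\<delta>\<^sub>2 x))) (at x)"
    by (rule definable_along_curve_has_derivative[OF c g speed_c4]) (assumption, rule that)
  note sel = sel'[rule_format] and Dl = Dl'[rule_format]
  define \<phi> where "\<phi> x = \<delta>\<^sub>2 x - g (c4 x)" for x
  define H where "H p t = speed 4 p t - (\<Sum>l<k. Dl l p * speed (sel l) p t)" for p t
  have deriv: "\<forall>\<^sub>0 x. (\<phi> has_real_derivative H (c4 x) (\<delta>\<^sub>2 x)) (at x)"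
    using eventually_coordinate_derivatives(4) dg
  proof eventually_elim
    case (elim x)
    have "f2 x (\<delta>\<^sub>1 x) (\<delta>\<^sub>2 x) = speed 4 (c4 x) (\<delta>\<^sub>2 x)" by (simp only: speed_simps c4_nth)
    then show ?case unfolding \<phi>_def[abs_def] H_def using DERIV_diff[OF elim] by simp
  qed
  define h where "h p = H p (g p)" for p
  have h: "definable_op 4 h" unfolding definable_op_def h_def H_def
  proof (intro definable_intros definable_term_speed[of 4])
    fix l assume l: "l < k"
    show "definable_term (\<lambda>e. Dl l (map e [0..<4]))" using Dl[OF l] by (simp add: definable_op_def)
    show "sel l < 5" using sel[OF l] by simp
  qed (use g in \<open>simp_all add: definable_op_def\<close>)
  have h0: "H (c4 x) (\<delta>\<^sub>2 x) = h (c4 x)" if "\<phi> x = 0" for x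
    using that by (simp add: h_def \<phi>_def)
  have "definable_pred (\<lambda>e. h (map e [0..<4]) > 0)" using h unfolding definable_op_def by (intro definable_intros)
  note pos = complete_germ_predicate[OF c this]
  have "definable_pred (\<lambda>e. h (map e [0..<4]) < 0)" using h unfolding definable_op_def by (intro definable_intros)
  note neg = complete_germ_predicate[OF c this]
  have contD: "\<forall>\<^sub>0 x. isCont \<phi> x"
    using deriv by eventually_elim (rule DERIV_isCont)
  consider "\<forall>\<^sub>0 x. h (c4 x) > 0" | "\<forall>\<^sub>0 x. h (c4 x) < 0"
    | (zero) "\<forall>\<^sub>0 x. h (c4 x) = 0"
  proof -
    have "\<forall>\<^sub>0 x. h (c4 x) = 0"
      if "\<forall>\<^sub>0 x. \<not> h (c4 x) > 0" "\<forall>\<^sub>0 x. \<not> h (c4 x) < 0"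
      using that by eventually_elim simp
    then show thesis using pos neg that by blast
  qed
  then have "(\<forall>\<^sub>0 x. \<phi> x = 0) \<or> (\<forall>\<^sub>0 x. \<phi> x \<noteq> 0)"
  proof cases
    case 1
    then have "\<forall>\<^sub>0 x. \<phi> x = 0 \<longrightarrow> H (c4 x) (\<delta>\<^sub>2 x) > 0" by eventually_elim (simp add: h0)
    then show ?thesis using eventually_nonzero_if_same_crossing[OF deriv] by blast
  next
    case 2
    then have "\<forall>\<^sub>0 x. - \<phi> x = 0 \<longrightarrow> - H (c4 x) (\<delta>\<^sub>2 x) > 0" by eventually_elim (simp add: h0)
    moreover have "\<forall>\<^sub>0 x. ((\<lambda>x. - \<phi> x) has_real_derivative - H (c4 x) (\<delta>\<^sub>2 x)) (at x)"
      using deriv by eventually_elim (intro DERIV_minus)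
    ultimately have "\<forall>\<^sub>0 x. - \<phi> x \<noteq> 0"
      by (intro eventually_nonzero_if_same_crossing)
    then show ?thesis by simp
  next
    case zero
    have contDl: "\<forall>\<^sub>0 x. isCont (\<lambda>x. Dl l (c4 x)) x" if l: "l < k" for l
    proof -
      obtain k' sel' Dl' where "\<forall>\<^sub>0 x. ((\<lambda>x. Dl l (c4 x)) has_real_derivative
         (\<Sum>l<(k'::nat). Dl' l (c4 x) * speed (sel' l) (c4 x) (\<delta>\<^sub>2 x))) (at x)"
        by (rule definable_along_curve_has_derivative[OF c Dl[OF l] speed_c4]) (assumption, rule that)
      then show ?thesis by eventually_elim (rule DERIV_isCont)
    qed
    have "\<forall>\<^sub>0 x. \<forall>l<k. isCont (\<lambda>x. Dl l (c4 x)) x"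
      by (rule eventually_all_less[OF contDl])
    then have "\<forall>\<^sub>0 x. (\<phi> has_real_derivative H (c4 x) (\<delta>\<^sub>2 x)) (at x) \<and> h (c4 x) = 0 \<and>
      (\<forall>l<k. isCont (\<lambda>x. Dl l (c4 x)) x) \<and> isCont (\<lambda>x. g (c4 x)) x \<and>
      ((x, \<delta> x) \<in> \<Omega> \<and> (\<delta> has_vector_derivative F (x, \<delta> x)) (at x))"
      using deriv zero dg eventually_solutions(2)
      by eventually_elim (blast intro: DERIV_isCont)
    then obtain a where a: "a > 0" and
      ax: "\<And>x. 0 < x \<Longrightarrow> x < a \<Longrightarrow> (\<phi> has_real_derivative H (c4 x) (\<delta>\<^sub>2 x)) (at x)"
        "\<And>x. 0 < x \<Longrightarrow> x < a \<Longrightarrow> h (c4 x) = 0"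
        "\<And>x l. 0 < x \<Longrightarrow> x < a \<Longrightarrow> l < k \<Longrightarrow> isCont (\<lambda>x. Dl l (c4 x)) x"
        "\<And>x. 0 < x \<Longrightarrow> x < a \<Longrightarrow> isCont (\<lambda>x. g (c4 x)) x"
        "\<And>x. 0 < x \<Longrightarrow> x < a \<Longrightarrow> (x, \<delta> x) \<in> \<Omega>"
        "\<And>x. 0 < x \<Longrightarrow> x < a \<Longrightarrow> (\<delta> has_vector_derivative F (x, \<delta> x)) (at x)"
      unfolding eventually_at_right_0 by blast
    have bound: "\<exists>L. \<forall>\<^sub>F x in nhds z. norm (H (c4 x) (\<delta>\<^sub>2 x)) \<le> L * norm (\<phi> x)"
      if z: "0 < z" "z < a" "\<phi> z = 0" for z
    proof -
      have nz: "\<forall>\<^sub>F x in nhds z. 0 < x \<and> x < a"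
        using eventually_nhds_in_open[of "{0<..<a}" z] z by simp
      have cd: "isCont \<delta> z" using has_vector_derivative_continuous[OF ax(6)[OF z(1,2)]] .
      then have c2: "isCont (\<lambda>x. (\<delta>\<^sub>1 x, g (c4 x))) z" using ax(4)[OF z(1,2)] by (intro continuous_intros)
      obtain L where L: "L \<ge> 0" "\<forall>\<^sub>F x in nhds z. (x, \<delta> x) \<in> \<Omega> \<and> (x, (\<delta>\<^sub>1 x, g (c4 x))) \<in> \<Omega> \<and>
          norm (F (x, \<delta> x) - F (x, (\<delta>\<^sub>1 x, g (c4 x)))) \<le> L * norm (\<delta> x - (\<delta>\<^sub>1 x, g (c4 x)))"
        by (rule C1_on_lipschitz_along_curves[OF open_domain F_C1, of z \<delta> "\<lambda>x. (\<delta>\<^sub>1 x, g (c4 x))"])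
          (use ax(5)[OF z(1,2)] z(3) cd c2 in \<open>auto simp: prod_eq_iff \<phi>_def\<close>)
      define B where "B l = \<bar>Dl l (c4 z)\<bar> + 1" for l
      have "\<forall>\<^sub>F x in nhds z. \<forall>l<k. \<bar>Dl l (c4 x)\<bar> < B l"
      proof (rule eventually_all_less)
        fix l assume "l < k"
        then have "((\<lambda>x. Dl l (c4 x)) \<longlongrightarrow> Dl l (c4 z)) (nhds z)"
          using ax(3)[OF z(1,2)] by (simp add: continuous_at tendsto_nhds_iff)
        then have "((\<lambda>x. \<bar>Dl l (c4 x)\<bar>) \<longlongrightarrow> \<bar>Dl l (c4 z)\<bar>) (nhds z)" by (rule tendsto_rabs)
        then show "\<forall>\<^sub>F x in nhds z. \<bar>Dl l (c4 x)\<bar> < B l"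
          by (rule order_tendstoD(2)) (simp add: B_def)
      qed
      with L(2) nz have "\<forall>\<^sub>F x in nhds z. norm (H (c4 x) (\<delta>\<^sub>2 x)) \<le> (L + (\<Sum>l<k. B l * L)) * norm (\<phi> x)"
      proof eventually_elim
        case (elim x)
        define t where "t = g (c4 x)"
        have "norm (F (x, \<delta> x) - F (x, (\<delta>\<^sub>1 x, t))) \<le> L * norm (\<delta> x - (\<delta>\<^sub>1 x, t))"
          using elim by (simp add: t_def)
        also have "\<delta> x - (\<delta>\<^sub>1 x, t) = (0, \<phi> x)" by (simp add: prod_eq_iff \<phi>_def t_def)
        finally have n: "norm (F (x, \<delta> x) - F (x, (\<delta>\<^sub>1 x, t))) \<le> L * norm (\<phi> x)" by (simp add: norm_Pair)
        have fs: "norm (fst p) \<le> norm p" "norm (snd p) \<le> norm p" for p :: "real \<times> real"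
          by (metis norm_fst_le prod.collapse, metis norm_snd_le prod.collapse)
        have "f1 x (\<delta>\<^sub>1 x) (\<delta>\<^sub>2 x) - f1 x (\<delta>\<^sub>1 x) t = fst (F (x, \<delta> x) - F (x, (\<delta>\<^sub>1 x, t)))"
          "f2 x (\<delta>\<^sub>1 x) (\<delta>\<^sub>2 x) - f2 x (\<delta>\<^sub>1 x) t = snd (F (x, \<delta> x) - F (x, (\<delta>\<^sub>1 x, t)))"
          using elim by (auto simp: f1_def f2_def t_def)
        then have 3: "\<bar>speed 3 (c4 x) (\<delta>\<^sub>2 x) - speed 3 (c4 x) t\<bar> \<le> L * \<bar>\<phi> x\<bar>"
          and 4: "\<bar>speed 4 (c4 x) (\<delta>\<^sub>2 x) - speed 4 (c4 x) t\<bar> \<le> L * \<bar>\<phi> x\<bar>"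
          using fs[of "F (x, \<delta> x) - F (x, (\<delta>\<^sub>1 x, t))"] n unfolding speed_simps c4_nth real_norm_def
          by (metis order_trans)+
        have sp: "\<bar>speed j (c4 x) (\<delta>\<^sub>2 x) - speed j (c4 x) t\<bar> \<le> L * \<bar>\<phi> x\<bar>" if "j < 4" for j
          using less_4_cases[OF that]
        proof (elim disjE)
          show "j = 3 \<Longrightarrow> ?thesis" using 3 by simp
        qed (simp_all only: speed_simps, use L(1) in simp_all)
        have "H (c4 x) (\<delta>\<^sub>2 x) = H (c4 x) (\<delta>\<^sub>2 x) - H (c4 x) t"
          using ax(2)[of x] elim by (simp add: h_def t_def)
        also have "\<dots> = (speed 4 (c4 x) (\<delta>\<^sub>2 x) - speed 4 (c4 x) t) -
            (\<Sum>l<k. Dl l (c4 x) * (speed (sel l) (c4 x) (\<delta>\<^sub>2 x) - speed (sel l) (c4 x) t))"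
          by (simp add: H_def right_diff_distrib sum_subtractf)
        finally have eq: "H (c4 x) (\<delta>\<^sub>2 x) = (speed 4 (c4 x) (\<delta>\<^sub>2 x) - speed 4 (c4 x) t) -
            (\<Sum>l<k. Dl l (c4 x) * (speed (sel l) (c4 x) (\<delta>\<^sub>2 x) - speed (sel l) (c4 x) t))" .
        have "\<bar>H (c4 x) (\<delta>\<^sub>2 x)\<bar> \<le> L * \<bar>\<phi> x\<bar> + (\<Sum>l<k. B l * L * \<bar>\<phi> x\<bar>)"
          unfolding eq
        proof (rule order_trans[OF abs_triangle_ineq4], rule add_mono[OF 4])
          show "\<bar>\<Sum>l<k. Dl l (c4 x) * (speed (sel l) (c4 x) (\<delta>\<^sub>2 x) - speed (sel l) (c4 x) t)\<bar> \<le> (\<Sum>l<k. B l * L * \<bar>\<phi> x\<bar>)"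
          proof (rule order_trans[OF sum_abs], rule sum_mono)
            fix l assume "l \<in> {..<k}"
            then have l: "l < k" by simp
            show "\<bar>Dl l (c4 x) * (speed (sel l) (c4 x) (\<delta>\<^sub>2 x) - speed (sel l) (c4 x) t)\<bar> \<le> B l * L * \<bar>\<phi> x\<bar>"
              unfolding abs_mult mult.assoc
              using elim l by (intro mult_mono sp sel) (auto simp: B_def intro: less_imp_le)
          qed
        qed
        then show ?case by (simp only: real_norm_def distrib_right sum_distrib_right)
      qed
      then show ?thesis ..
    qed
    show ?thesis
    proof (cases "\<exists>z>0. z < a \<and> \<phi> z = 0")
      case True
      then obtain z where z: "0 < z" "z < a" "\<phi> z = 0" by blast
      have "\<phi> x = 0" if "0 < x" "x < a" for x
        by (rule zero_spreads[of a \<phi> "\<lambda>x. H (c4 x) (\<delta>\<^sub>2 x)", OF _ bound z that])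
          (use ax(1) in \<open>simp add: has_real_derivative_iff_has_vector_derivative\<close>)
      then show ?thesis unfolding eventually_at_right_0 using a by blast
    next
      case False
      then show ?thesis unfolding eventually_at_right_0 using a by blast
    qed
  qed
  then show ?thesis
  proof
    assume "\<forall>\<^sub>0 x. \<phi> x = 0"
    then have "\<forall>\<^sub>0 x. \<delta>\<^sub>2 x = g (c4 x)" by eventually_elim (simp add: \<phi>_def)
    then show ?thesis ..
  next
    assume "\<forall>\<^sub>0 x. \<phi> x \<noteq> 0"
    from eventually_signed[OF contD this] show ?thesis by (simp add: \<phi>_def)
  qed
qed

lemma complete_germ_c5_if_complete_germ_c4:
  assumes c: "complete_germ 4 c4"
  shows "complete_germ 5 c5"
  unfolding complete_germ_def
proof (intro conjI allI ballI)
  fix A assume "A \<in> D 5"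
  then have A: "A \<in> D (Suc 4)" by simp
  have c5: "c5 x = c4 x @ [\<delta>\<^sub>2 x]" for x by (simp add: c4_def c5_def)
  define Y where "Y = {xs. length xs = Suc 4 \<and> fibre_boundary A (take 4 xs) (xs ! 4)}"
  have tk: "take 4 (map e [0..<Suc 4]) = map e [0..<4]" for e :: "nat \<Rightarrow> real"
    by (intro nth_equalityI) (auto simp del: upt_Suc)
  have Y: "Y \<in> D (Suc 4)" unfolding Y_def
    by (rule definable_pred_Collect, unfold tk) (intro definable_pred_fibre_boundary[OF A] definable_intros, auto)
  have fib: "p @ [t] \<in> Y \<longleftrightarrow> fibre_boundary A p t" if "length p = 4" for p t
    using that by (simp add: Y_def nth_append)
  have "finite {t. p @ [t] \<in> Y}" if "length p = 4" for p
    unfolding fib[OF that] by (rule finite_fibre_boundary[OF A that])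
  note fin = this
  have cc: "eventually_continuous 4 c4" unfolding eventually_continuous_def
    by (intro allI impI eventually_mono[OF speed_c4] DERIV_isCont)
  obtain n f where f': "\<forall>i<n. definable_op 4 (f i)"
    and Yf: "\<forall>\<^sub>0 x. (\<forall>i<n. \<forall>j<n. i < j \<longrightarrow> f i (c4 x) < f j (c4 x)) \<and>
       {t. c4 x @ [t] \<in> Y} = (\<lambda>i. f i (c4 x)) ` {..<(n::nat)}"
    by (rule uniform_finiteness_along_curve[OF c cc Y fin]) (assumption, rule that)
  note f = f'[rule_format]
  show "(\<forall>\<^sub>0 x. c5 x \<in> A) \<or> (\<forall>\<^sub>0 x. c5 x \<notin> A)"
  proof (cases "\<exists>i<n. \<forall>\<^sub>0 x. \<delta>\<^sub>2 x = f i (c4 x)")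
    case True
    then obtain i where i: "i < n" "\<forall>\<^sub>0 x. \<delta>\<^sub>2 x = f i (c4 x)" by blast
    have "definable_pred (\<lambda>e. map e [0..<4] @ [f i (map e [0..<4])] \<in> A)"
      by (rule definable_pred_mem[OF A]) (intro definable_intros definable_term_app[OF f[OF i(1)]])
    from complete_germ_predicate[OF c this] show ?thesis
    proof
      assume "\<forall>\<^sub>0 x. c4 x @ [f i (c4 x)] \<in> A"
      then have "\<forall>\<^sub>0 x. c5 x \<in> A" using i(2) by eventually_elim (simp add: c5)
      then show ?thesis ..
    next
      assume "\<forall>\<^sub>0 x. c4 x @ [f i (c4 x)] \<notin> A"
      then have "\<forall>\<^sub>0 x. c5 x \<notin> A" using i(2) by eventually_elim (simp add: c5)
      then show ?thesis ..
    qed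
  next
    case False
    define below where "below i \<longleftrightarrow> (\<forall>\<^sub>0 x. \<delta>\<^sub>2 x > f i (c4 x))" for i
    define gap where "gap p t \<longleftrightarrow> (\<forall>i<n. (below i \<longrightarrow> f i p < t) \<and> (\<not> below i \<longrightarrow> t < f i p))" for p t
    have "\<forall>\<^sub>0 x. (below i \<longrightarrow> f i (c4 x) < \<delta>\<^sub>2 x) \<and> (\<not> below i \<longrightarrow> \<delta>\<^sub>2 x < f i (c4 x))"
      if i: "i < n" for i
    proof (cases "below i")
      case True
      then show ?thesis by (simp add: below_def)
    next
      case below: False
      then have "\<forall>\<^sub>0 x. \<delta>\<^sub>2 x < f i (c4 x)"
        using definable_comparison[OF c f[OF i]] False i unfolding below_def by blast
      then show ?thesis using below by simp
    qed
    then have gap: "\<forall>\<^sub>0 x. gap (c4 x) (\<delta>\<^sub>2 x)"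
      unfolding gap_def by (rule eventually_all_less)
    have side: "c4 x @ [t] \<in> A \<longleftrightarrow> c4 x @ [u] \<in> A"
      if Yx: "{t. c4 x @ [t] \<in> Y} = (\<lambda>i. f i (c4 x)) ` {..<n}" and tu: "gap (c4 x) t" "gap (c4 x) u" for x t u
    proof (rule same_side_if_no_boundary)
      fix s assume s: "min t u \<le> s" "s \<le> max t u"
      show "\<not> fibre_boundary A (c4 x) s"
      proof
        assume "fibre_boundary A (c4 x) s"
        then have "c4 x @ [s] \<in> Y" using fib[OF complete_germ_length[OF c]] by simp
        then obtain i where i: "i < n" "s = f i (c4 x)" using Yx by auto
        show False
        proof (cases "below i")
          case True
          then have "s < t" "s < u" using tu i by (auto simp: gap_def)
          then show False using s by simp
        next
          case False
          then have "t < s" "u < s" using tu i by (auto simp: gap_def)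
          then show False using s by simp
        qed
      qed
    qed
    have "definable_pred (\<lambda>e. \<exists>t. gap (map e [0..<4]) t \<and> map e [0..<4] @ [t] \<in> A)"
      unfolding gap_def by (intro definable_intros definable_pred_mem[OF A] definable_term_app[OF f])
    from complete_germ_predicate[OF c this] show ?thesis
    proof
      assume "\<forall>\<^sub>0 x. \<exists>t. gap (c4 x) t \<and> c4 x @ [t] \<in> A"
      then have "\<forall>\<^sub>0 x. c5 x \<in> A"
        using Yf gap by eventually_elim (use side c5 in metis)
      then show ?thesis ..
    next
      assume "\<forall>\<^sub>0 x. \<not> (\<exists>t. gap (c4 x) t \<and> c4 x @ [t] \<in> A)"
      then have "\<forall>\<^sub>0 x. c5 x \<notin> A"
        using gap by eventually_elim (use c5 in metis)
      then show ?thesis ..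
    qed
  qed
qed (simp add: c5_def)

end

lemma unbounded_angle_oscillates:
  fixes \<theta> :: "real \<Rightarrow> real"
  assumes a: "a > 0" and cont: "continuous_on {0<..<a} \<theta>" and lim: "filterlim \<theta> at_top (at_right 0)"
  shows "\<not> (\<forall>\<^sub>0 x. cos (\<theta> x) = 0)" "\<not> (\<forall>\<^sub>0 x. cos (\<theta> x) \<noteq> 0)"
proof -
  have hit: "\<exists>x. 0 < x \<and> x < b \<and> cos (\<theta> x) = cos y" if b: "b > 0" for b y
  proof -
    define c where "c = min a b / 2"
    have c: "0 < c" "c < a" "c < b" using a b by (auto simp: c_def)
    obtain k :: nat where "real k > (\<theta> c - y) / (2 * pi)" using reals_Archimedean2 by blast
    then have k: "y + 2 * real k * pi > \<theta> c" by (simp add: field_simps)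
    have "\<forall>\<^sub>0 x. \<theta> x \<ge> y + 2 * real k * pi"
      using lim unfolding filterlim_at_top by blast
    then obtain d where d: "d > 0" "\<And>x. 0 < x \<Longrightarrow> x < d \<Longrightarrow> \<theta> x \<ge> y + 2 * real k * pi"
      unfolding eventually_at_right_0 by blast
    define x0 where "x0 = min c d / 2"
    have x0: "0 < x0" "x0 < c" "x0 < d" using c(1) d(1) by (auto simp: x0_def)
    have "\<exists>x\<ge>x0. x \<le> c \<and> \<theta> x = y + 2 * real k * pi"
      by (rule IVT2') (use k d(2) x0 c in \<open>auto intro: continuous_on_subset[OF cont]\<close>)
    then obtain x where x: "x0 \<le> x" "x \<le> c" "\<theta> x = y + 2 * real k * pi" by blast
    have "cos (\<theta> x) = cos y"
      unfolding x(3) cos_add cos_2npi sin_2npi by simp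
    then show ?thesis using x x0 c by (intro exI[of _ x]) auto
  qed
  show "\<not> (\<forall>\<^sub>0 x. cos (\<theta> x) = 0)"
    unfolding eventually_at_right_0 using hit[of _ 0] by fastforce
  show "\<not> (\<forall>\<^sub>0 x. cos (\<theta> x) \<noteq> 0)"
    unfolding eventually_at_right_0 using hit[of _ "pi / 2"] by fastforce
qed

context flat_solutions
begin

lemma continuous_solutions:
  "\<forall>\<^sub>0 x. isCont \<gamma> x" "\<forall>\<^sub>0 x. isCont \<delta> x"
  by (rule eventually_mono[OF eventually_solutions(1)], blast intro: has_vector_derivative_continuous)
    (rule eventually_mono[OF eventually_solutions(2)], blast intro: has_vector_derivative_continuous)

lemma complete_germ_abs:
  assumes cont: "\<forall>\<^sub>0 x. isCont y x" and nz: "\<forall>\<^sub>0 x. y x \<noteq> 0"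
    and flat: "\<And>k::nat. \<forall>\<^sub>0 x. \<bar>y x\<bar> < x ^ k"
  obtains s where "complete_germ 4 (\<lambda>x. [x, \<gamma>\<^sub>1 x, \<gamma>\<^sub>2 x, \<bar>y x\<bar>])" "\<forall>\<^sub>0 x. y x = s * \<bar>y x\<bar>"
proof -
  have "\<forall>\<^sub>0 x. 0 < \<bar>y x\<bar>" using nz by simp
  from complete_germ_flat[OF separation this flat] have c: "complete_germ 4 (\<lambda>x. [x, \<gamma>\<^sub>1 x, \<gamma>\<^sub>2 x, \<bar>y x\<bar>])" .
  from eventually_signed[OF cont nz] show thesis
  proof
    assume "\<forall>\<^sub>0 x. y x > 0"
    then have "\<forall>\<^sub>0 x. y x = 1 * \<bar>y x\<bar>" by eventually_elim simp
    then show thesis by (rule that[OF c])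
  next
    assume "\<forall>\<^sub>0 x. y x < 0"
    then have "\<forall>\<^sub>0 x. y x = - 1 * \<bar>y x\<bar>" by eventually_elim simp
    then show thesis by (rule that[OF c])
  qed
qed

lemma complete_germ_c5:
  assumes "\<not> interlaced \<gamma> \<delta>"
  shows "complete_germ 5 c5"
proof -
  have len5: "length (c5 x) = Suc (Suc (Suc (Suc (Suc 0))))" for x by (simp add: c5_def)
  have len4: "length (c4 x) = Suc (Suc (Suc (Suc 0)))" for x by (simp add: c4_def)
  from trichotomy assms consider
    (eq) "\<forall>\<^sub>0 x. \<delta>\<^sub>1 x - \<gamma>\<^sub>1 x = 0" | (ne) "\<forall>\<^sub>0 x. \<delta>\<^sub>1 x - \<gamma>\<^sub>1 x \<noteq> 0" by blast
  then show ?thesis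
  proof cases
    case eq
    have "\<forall>\<^sub>0 x. \<delta>\<^sub>2 x - \<gamma>\<^sub>2 x \<noteq> 0"
      using eq solutions_differ by eventually_elim (auto simp: prod_eq_iff)
    moreover have "\<forall>\<^sub>0 x. isCont (\<lambda>x. \<delta>\<^sub>2 x - \<gamma>\<^sub>2 x) x"
      using continuous_solutions by eventually_elim (intro continuous_intros)
    ultimately obtain s where c: "complete_germ 4 (\<lambda>x. [x, \<gamma>\<^sub>1 x, \<gamma>\<^sub>2 x, \<bar>\<delta>\<^sub>2 x - \<gamma>\<^sub>2 x\<bar>])"
      and s: "\<forall>\<^sub>0 x. \<delta>\<^sub>2 x - \<gamma>\<^sub>2 x = s * \<bar>\<delta>\<^sub>2 x - \<gamma>\<^sub>2 x\<bar>"
      using complete_germ_abs[of "\<lambda>x. \<delta>\<^sub>2 x - \<gamma>\<^sub>2 x"] flat_components(2) by blast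
    have "complete_germ (Suc (Suc (Suc (Suc (Suc 0))))) c5"
    proof (rule complete_germ_map[OF c _ len5])
      show "definable_vec (Suc (Suc (Suc (Suc (Suc 0))))) (\<lambda>e. (\<lambda>p. [p ! 0, p ! 1, p ! 2, p ! 1, p ! 2 + s * p ! 3]) (map e [0..<4]))"
        by (intro definable_intros; simp)
      show "\<forall>\<^sub>0 x. c5 x = (\<lambda>p. [p ! 0, p ! 1, p ! 2, p ! 1, p ! 2 + s * p ! 3])
          [x, \<gamma>\<^sub>1 x, \<gamma>\<^sub>2 x, \<bar>\<delta>\<^sub>2 x - \<gamma>\<^sub>2 x\<bar>]"
        using eq s by eventually_elim (simp add: c5_def)
    qed
    then show ?thesis by (simp add: numeral_eq_Suc)
  next
    case ne
    have "\<forall>\<^sub>0 x. isCont (\<lambda>x. \<delta>\<^sub>1 x - \<gamma>\<^sub>1 x) x"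
      using continuous_solutions by eventually_elim (intro continuous_intros)
    then obtain s where c: "complete_germ 4 (\<lambda>x. [x, \<gamma>\<^sub>1 x, \<gamma>\<^sub>2 x, \<bar>\<delta>\<^sub>1 x - \<gamma>\<^sub>1 x\<bar>])"
      and s: "\<forall>\<^sub>0 x. \<delta>\<^sub>1 x - \<gamma>\<^sub>1 x = s * \<bar>\<delta>\<^sub>1 x - \<gamma>\<^sub>1 x\<bar>"
      using complete_germ_abs[of "\<lambda>x. \<delta>\<^sub>1 x - \<gamma>\<^sub>1 x"] ne flat_components(1) by blast
    have "complete_germ (Suc (Suc (Suc (Suc 0)))) c4"
    proof (rule complete_germ_map[OF c _ len4])
      show "definable_vec (Suc (Suc (Suc (Suc 0)))) (\<lambda>e. (\<lambda>p. [p ! 0, p ! 1, p ! 2, p ! 1 + s * p ! 3]) (map e [0..<4]))"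
        by (intro definable_intros; simp)
      show "\<forall>\<^sub>0 x. c4 x = (\<lambda>p. [p ! 0, p ! 1, p ! 2, p ! 1 + s * p ! 3])
          [x, \<gamma>\<^sub>1 x, \<gamma>\<^sub>2 x, \<bar>\<delta>\<^sub>1 x - \<gamma>\<^sub>1 x\<bar>]"
        using s by eventually_elim (simp add: c4_def)
    qed
    then show ?thesis by (intro complete_germ_c5_if_complete_germ_c4) (simp add: numeral_eq_Suc)
  qed
qed

lemma germ_ring_eq: "germ_ring D \<gamma> \<delta> = {germ_of (\<lambda>x. f (c5 x)) |f. definable_op 5 f}"
proof (intro equalityI subsetI)
  fix g assume "g \<in> germ_ring D \<gamma> \<delta>"
  then obtain f A where fA: "g = germ_of (\<lambda>x. f (c5 x))" "definable_fun D 5 A f" "\<forall>\<^sub>0 x. c5 x \<in> A"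
    unfolding germ_ring_def c5_def by blast
  define f' where "f' xs = (if xs \<in> A then f xs else 0)" for xs
  have "definable_op 5 f'" unfolding f'_def[abs_def] by (rule definable_fun_total[OF fA(2)])
  moreover have "g = germ_of (\<lambda>x. f' (c5 x))"
    unfolding fA(1) germ.abs_eq_iff germ_rel_def using fA(3) by eventually_elim (simp add: f'_def)
  ultimately show "g \<in> {germ_of (\<lambda>x. f (c5 x)) |f. definable_op 5 f}" by blast
next
  fix g assume "g \<in> {germ_of (\<lambda>x. f (c5 x)) |f. definable_op 5 f}"
  then obtain f where f: "definable_op 5 f" "g = germ_of (\<lambda>x. f (c5 x))" by blast
  have "\<forall>\<^sub>0 x. c5 x \<in> {xs. length xs = 5}" by (simp add: c5_def)
  then show "g \<in> germ_ring D \<gamma> \<delta>"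
    using definable_op_total[OF f(1)] f(2) unfolding germ_ring_def c5_def by blast
qed

lemma c5_nth: "c5 x ! 0 = x" "c5 x ! 1 = \<gamma>\<^sub>1 x" "c5 x ! 2 = \<gamma>\<^sub>2 x" "c5 x ! 3 = \<delta>\<^sub>1 x" "c5 x ! 4 = \<delta>\<^sub>2 x"
  by (simp_all add: c5_def)

lemma speed_c5:
  assumes "j < 5"
  shows "\<forall>\<^sub>0 x. ((\<lambda>x. c5 x ! j) has_real_derivative speed j (c5 x) (c5 x ! 4)) (at x)"
proof -
  have "j = 0 \<or> j = 1 \<or> j = 2 \<or> j = 3 \<or> j = 4" using assms by auto
  then show ?thesis
    by (elim disjE) (simp_all only: c5_nth speed_simps DERIV_ident eventually_True eventually_coordinate_derivatives)
qed

lemma hardy_field_if_complete_germ: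
  assumes c: "complete_germ 5 c5"
  shows "hardy_field (germ_ring D \<gamma> \<delta>)"
  unfolding hardy_field_def germ_ring_eq
proof (intro conjI ballI impI)
  show "is_subring {germ_of (\<lambda>x. f (c5 x)) |f. definable_op 5 f}"
    unfolding is_subring_def
  proof (intro conjI ballI)
    have "definable_op 5 (\<lambda>_. 1)" unfolding definable_op_def by (rule definable_term_const)
    then show "1 \<in> {germ_of (\<lambda>x. f (c5 x)) |f. definable_op 5 f}"
      unfolding one_germ_def by (intro CollectI exI[of _ "\<lambda>_. 1"]) simp
    fix g h assume "g \<in> {germ_of (\<lambda>x. f (c5 x)) |f. definable_op 5 f}" "h \<in> {germ_of (\<lambda>x. f (c5 x)) |f. definable_op 5 f}"
    then obtain u v where u: "definable_op 5 u" "g = germ_of (\<lambda>x. u (c5 x))" and v: "definable_op 5 v" "h = germ_of (\<lambda>x. v (c5 x))" by blast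
    have "definable_op 5 (\<lambda>p. u p - v p)" "definable_op 5 (\<lambda>p. u p * v p)"
      using u(1) v(1) unfolding definable_op_def by (simp_all add: definable_term_diff definable_term_mult)
    moreover have "g - h = germ_of (\<lambda>x. (\<lambda>p. u p - v p) (c5 x))" "g * h = germ_of (\<lambda>x. (\<lambda>p. u p * v p) (c5 x))"
      unfolding u v by (simp_all add: minus_germ.abs_eq times_germ.abs_eq)
    ultimately have "(\<exists>f. g - h = germ_of (\<lambda>x. f (c5 x)) \<and> definable_op 5 f) \<and> (\<exists>f. g * h = germ_of (\<lambda>x. f (c5 x)) \<and> definable_op 5 f)"
      by (intro conjI exI[of _ "\<lambda>p. u p - v p"] exI[of _ "\<lambda>p. u p * v p"])
    then show "g - h \<in> {germ_of (\<lambda>x. f (c5 x)) |f. definable_op 5 f}" "g * h \<in> {germ_of (\<lambda>x. f (c5 x)) |f. definable_op 5 f}"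
      by simp_all
  qed
next
  fix g assume "g \<in> {germ_of (\<lambda>x. f (c5 x)) |f. definable_op 5 f}" and nz: "g \<noteq> 0"
  then obtain u where u: "definable_op 5 u" "g = germ_of (\<lambda>x. u (c5 x))" by blast
  have "definable_pred (\<lambda>e. u (map e [0..<5]) = 0)" using u(1) unfolding definable_op_def by (intro definable_intros)
  from complete_germ_predicate[OF c this] have ne: "\<forall>\<^sub>0 x. u (c5 x) \<noteq> 0"
    using nz unfolding u zero_germ_def germ.abs_eq_iff germ_rel_def by blast
  have "definable_op 5 (\<lambda>p. inverse (u p))" using u(1) unfolding definable_op_def by (rule definable_term_inverse)
  moreover have "g * germ_of (\<lambda>x. (\<lambda>p. inverse (u p)) (c5 x)) = 1"
    unfolding u one_germ_def times_germ.abs_eq germ.abs_eq_iff germ_rel_def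
    using ne by eventually_elim simp
  ultimately show "\<exists>h\<in>{germ_of (\<lambda>x. f (c5 x)) |f. definable_op 5 f}. g * h = 1"
    by (intro bexI[of _ "germ_of (\<lambda>x. inverse (u (c5 x)))"] CollectI
        exI[of _ "\<lambda>p. inverse (u p)"] conjI refl)
next
  fix g assume "g \<in> {germ_of (\<lambda>x. f (c5 x)) |f. definable_op 5 f}"
  then obtain u where u: "definable_op 5 u" "g = germ_of (\<lambda>x. u (c5 x))" by blast
  obtain k sel Dl where sel': "\<forall>l<k. sel l < 5" and Dl': "\<forall>l<k. definable_op 5 (Dl l)"
    and deriv: "\<forall>\<^sub>0 x. ((\<lambda>x. u (c5 x)) has_real_derivative
      (\<Sum>l<(k::nat). Dl l (c5 x) * speed (sel l) (c5 x) (c5 x ! 4))) (at x)"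
    by (rule definable_along_curve_has_derivative[OF c u(1) speed_c5]) (assumption, rule that)
  note sel = sel'[rule_format] and Dl = Dl'[rule_format]
  define u' where "u' p = (\<Sum>l<k. Dl l p * speed (sel l) p (p ! 4))" for p
  have "definable_op 5 u'" unfolding definable_op_def u'_def
  proof (intro definable_intros definable_term_speed[of 5])
    fix l assume l: "l < k"
    show "definable_term (\<lambda>e. Dl l (map e [0..<5]))" using Dl[OF l] by (simp add: definable_op_def)
    show "sel l < 5" using sel[OF l] .
  qed simp_all
  moreover have "germ_has_derivative g (germ_of (\<lambda>x. u' (c5 x)))"
    unfolding germ_has_derivative_def using u(2) deriv by (intro exI conjI) (auto simp: u'_def)
  ultimately show "\<exists>g'\<in>{germ_of (\<lambda>x. f (c5 x)) |f. definable_op 5 f}. germ_has_derivative g g'" by blast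
qed

lemma not_hardy_field_if_interlaced:
  assumes il: "interlaced \<gamma> \<delta>"
  shows "\<not> hardy_field (germ_ring D \<gamma> \<delta>)"
proof
  assume hf: "hardy_field (germ_ring D \<gamma> \<delta>)"
  have "\<forall>\<^sub>0 x. isCont (\<lambda>x. \<delta> x - \<gamma> x) x \<and> \<delta> x - \<gamma> x \<noteq> 0"
    using continuous_solutions solutions_differ by eventually_elim (simp add: continuous_diff)
  then obtain a where a: "a > 0" "\<And>x. 0 < x \<Longrightarrow> x < a \<Longrightarrow> isCont (\<lambda>x. \<delta> x - \<gamma> x) x"
    "\<And>x. 0 < x \<Longrightarrow> x < a \<Longrightarrow> \<delta> x - \<gamma> x \<noteq> 0"
    unfolding eventually_at_right_0 by blast
  obtain \<theta> where \<theta>: "angle_measure a (\<lambda>x. \<delta> x - \<gamma> x) \<theta>"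
    by (rule angle_measure_exists[of a "\<lambda>x. \<delta> x - \<gamma> x"]) (use a in blast)+
  have cont: "continuous_on {0<..<a} \<theta>" using \<theta> by (simp add: angle_measure_def)
  have osc: "\<not> (\<forall>\<^sub>0 x. cos (\<theta> x) = 0) \<and> \<not> (\<forall>\<^sub>0 x. cos (\<theta> x) \<noteq> 0)"
  proof -
    have "filterlim \<theta> at_top (at_right 0) \<or> filterlim \<theta> at_bot (at_right 0)"
      using il \<theta> a(1) unfolding interlaced_def by blast
    then show ?thesis
    proof
      assume "filterlim \<theta> at_top (at_right 0)"
      from unbounded_angle_oscillates[OF a(1) cont this] show ?thesis by blast
    next
      assume "filterlim \<theta> at_bot (at_right 0)"
      then have "filterlim (\<lambda>x. - \<theta> x) at_top (at_right 0)" by (simp add: filterlim_uminus_at_top)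
      from unbounded_angle_oscillates[OF a(1) continuous_on_minus[OF cont] this] show ?thesis by simp
    qed
  qed
  have pol: "\<delta>\<^sub>1 x - \<gamma>\<^sub>1 x = 0 \<longleftrightarrow> cos (\<theta> x) = 0" if x: "0 < x" "x < a" for x
  proof -
    have *: "\<delta> x - \<gamma> x \<noteq> 0" "(\<delta> x - \<gamma> x) /\<^sub>R norm (\<delta> x - \<gamma> x) = (cos (\<theta> x), sin (\<theta> x))"
      using \<theta> x unfolding angle_measure_def by auto
    from arg_cong[OF *(2), of fst] have "inverse (norm (\<delta> x - \<gamma> x)) * (\<delta>\<^sub>1 x - \<gamma>\<^sub>1 x) = cos (\<theta> x)" by simp
    moreover have "inverse (norm (\<delta> x - \<gamma> x)) \<noteq> 0" using *(1) by simp
    ultimately show ?thesis by (metis mult_eq_0_iff)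
  qed
  have ev: "\<forall>\<^sub>0 x. 0 < x \<and> x < a" unfolding eventually_at_right_0 using a(1) by blast
  define g where "g = germ_of (\<lambda>x. (\<lambda>p. p ! 3 - p ! 1) (c5 x))"
  have "definable_op 5 (\<lambda>p. p ! 3 - p ! 1)" unfolding definable_op_def by (intro definable_intros; simp)
  then have "g \<in> germ_ring D \<gamma> \<delta>"
    unfolding germ_ring_eq g_def by (intro CollectI exI[of _ "\<lambda>p. p ! 3 - p ! 1"] conjI refl)
  then consider "g = 0" | h where "g * h = 1" using hf unfolding hardy_field_def by blast
  then show False
  proof cases
    case 1
    then have "\<forall>\<^sub>0 x. \<delta>\<^sub>1 x - \<gamma>\<^sub>1 x = 0"
      unfolding g_def zero_germ_def germ.abs_eq_iff germ_rel_def c5_nth .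
    then have "\<forall>\<^sub>0 x. cos (\<theta> x) = 0" using ev by eventually_elim (use pol in blast)
    then show False using osc by blast
  next
    case (2 h)
    obtain w where w: "h = germ_of w" by (metis Quotient3_abs_rep Quotient3_germ)
    have "\<forall>\<^sub>0 x. (\<delta>\<^sub>1 x - \<gamma>\<^sub>1 x) * w x = 1"
      using 2 unfolding w g_def one_germ_def times_germ.abs_eq germ.abs_eq_iff germ_rel_def c5_nth .
    then have "\<forall>\<^sub>0 x. cos (\<theta> x) \<noteq> 0"
      using ev
    proof eventually_elim
      case (elim x)
      then have "\<delta>\<^sub>1 x - \<gamma>\<^sub>1 x \<noteq> 0" by auto
      then show ?case using pol[of x] elim by blast
    qed
    then show False using osc by blast
  qed
qed

end

theorem theorem1p3:
  fixes D :: "nat \<Rightarrow> real list set set"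
    and \<Omega> :: "(real \<times> real \<times> real) set"
    and F :: "real \<times> real \<times> real \<Rightarrow> real \<times> real"
    and \<gamma> \<delta> :: "real \<Rightarrow> real \<times> real"
  assumes "poly_bounded_ominimal_structure D"
    and "open \<Omega>" and "\<Omega> \<subseteq> {0..} \<times> UNIV" and "(0, 0, 0) \<in> closure \<Omega>"
    and "definable_map D \<Omega> F" and "C1_on \<Omega> F"
    and "solution_at_0 \<Omega> F \<gamma>" and "regular_separation D \<gamma>"
    and "solution_at_0 \<Omega> F \<delta>" and "different_germs \<gamma> \<delta>" and "flat_contact \<gamma> \<delta>"
  shows "(hardy_field (germ_ring D \<gamma> \<delta>) \<or> interlaced \<gamma> \<delta>) \<and>
    \<not> (hardy_field (germ_ring D \<gamma> \<delta>) \<and> interlaced \<gamma> \<delta>)"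
proof -
  interpret poly_bounded_ominimal_structure D by fact
  interpret flat_solutions D \<Omega> F \<gamma> \<delta>
    by unfold_locales fact+
  show ?thesis
    using hardy_field_if_complete_germ[OF complete_germ_c5] not_hardy_field_if_interlaced by blast
qed

end
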